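(* Fix a positive integer $h$. Let $T_n$ be a $2$-dimensional determinantal hypertree on $[n]$, let $\mathcal{G}_n=\mathcal{G}_{n,h}$ be the set of graphs on the vertex set $[n]$ consisting of $h$ vertex disjoint $5$-cycles and $n-5h$ isolated vertices, and let \[X_n=|\{G\in \mathcal{G}_n\,:\, G\in Z^1(T_n,\mathbb{F}_2)\}|.\] Then for all large enough $n$ (depending on $h$), we have \[\mathbb{E}X_n\ge \frac{e^{-100h}}{h!}\qquad\text{ and }\qquad\mathbb{E}X^2_n\le \frac{(100h)^{5h}}{(h!)^2}.\]
   Context: A $2$-dimensional simplicial complex $S$ on the vertex set $[n]=\{1,\dots,n\}$ is called a ($2$-dimensional) hypertree if (a) $S$ has complete $1$-skeleton (all vertices and all pairs from $[n]$ are faces); (b) the number of triangular faces of $S$ is $\binom{n-1}{2}$; (c) the homology group $H_1(S,\mathbb{Z})$ is finite. Let $\mathcal{C}(n,2)$ be the set of hypertrees on $[n]$. Kalai's formula states $\sum_{S\in\mathcal{C}(n,2)}|H_1(S,\mathbb{Z})|^2=n^{\binom{n-2}{2}}$. A determinantal hypertree $T_n$ is a random element of $\mathcal{C}(n,2)$ with distribution $\mathbb{P}(T_n=S)=|H_1(S,\mathbb{Z})|^2/n^{\binom{n-2}{2}}$ for $S\in\mathcal{C}(n,2)$. For a complex $S$ on $[n]$ with complete $1$-skeleton, a cochain in $C^1(S,\mathbb{F}_2)$ is determined by its support, so $C^1(S,\mathbb{F}_2)$ is identified with the set of graphs on $[n]$ (a graph $G$ corresponds to the indicator cochain of its edge set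 $E(G)$). $Z^1(S,\mathbb{F}_2)$ denotes the space of $1$-cocycles; thus $G\in Z^1(S,\mathbb{F}_2)$ means that the indicator cochain of $E(G)$ is a cocycle. *)

theory Defs
  imports
    "HOL-Algebra.Elementary_Groups"
    "HOL-Algebra.Free_Abelian_Groups"
    "HOL-Library.Z2"
    "HOL-Probability.Probability_Mass_Function"
begin

section \<open>Simplicial complexes, integral homology, cochains\<close>

text \<open>A complex is represented by its set of nonempty faces; leaving out the empty face makes
  the representation unique, so that complexes can be counted.\<close>

definition simplicial_complex :: "'a set \<Rightarrow> 'a set set \<Rightarrow> bool" where
  "simplicial_complex V S \<longleftrightarrow>
     (\<forall>\<sigma>\<in>S. finite \<sigma> \<and> \<sigma> \<noteq> {} \<and> \<sigma> \<subseteq> V) \<and>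
     (\<forall>v\<in>V. {v} \<in> S) \<and>
     (\<forall>\<sigma>\<in>S. \<forall>\<tau>. \<tau> \<subseteq> \<sigma> \<and> \<tau> \<noteq> {} \<longrightarrow> \<tau> \<in> S)"

definition faces :: "nat \<Rightarrow> 'a set set \<Rightarrow> 'a set set" where
  "faces k S = {\<sigma>\<in>S. card \<sigma> = Suc k}"

text \<open>Simplices are oriented by the order of their vertices: if \<open>v\<close> is the \<open>i\<close>-th smallest vertex
  of \<open>\<sigma>\<close>, counting from 0, then \<open>\<sigma> - {v}\<close> occurs in the boundary of \<open>\<sigma>\<close> with sign \<open>(-1)^i\<close>.\<close>

definition incidence_sign :: "'a::linorder set \<Rightarrow> 'a \<Rightarrow> 'r::comm_ring_1" where
  "incidence_sign \<sigma> v = (- 1) ^ card {w\<in>\<sigma>. w < v}"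

definition simplicial_chain_group :: "nat \<Rightarrow> 'a set set \<Rightarrow> ('a set \<Rightarrow>\<^sub>0 int) monoid" where
  "simplicial_chain_group k S = free_Abelian_group (faces k S)"

text \<open>The condition \<open>\<sigma> \<noteq> {v}\<close> makes the boundary of a vertex zero (unreduced homology).\<close>

definition simplicial_boundary :: "('a::linorder set \<Rightarrow>\<^sub>0 int) \<Rightarrow> ('a set \<Rightarrow>\<^sub>0 int)" where
  "simplicial_boundary =
     frag_extend (\<lambda>\<sigma>. \<Sum>v | v \<in> \<sigma> \<and> \<sigma> \<noteq> {v}. frag_cmul (incidence_sign \<sigma> v) (frag_of (\<sigma> - {v})))"

definition simplicial_cycles :: "nat \<Rightarrow> 'a::linorder set set \<Rightarrow> ('a set \<Rightarrow>\<^sub>0 int) set" where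
  "simplicial_cycles k S = {c \<in> carrier (simplicial_chain_group k S). simplicial_boundary c = 0}"

definition simplicial_boundaries :: "nat \<Rightarrow> 'a::linorder set set \<Rightarrow> ('a set \<Rightarrow>\<^sub>0 int) set" where
  "simplicial_boundaries k S = simplicial_boundary ` carrier (simplicial_chain_group (Suc k) S)"

definition simplicial_homology_group ::
    "nat \<Rightarrow> 'a::linorder set set \<Rightarrow> ('a set \<Rightarrow>\<^sub>0 int) set monoid" where
  "simplicial_homology_group k S =
     subgroup_generated (simplicial_chain_group k S) (simplicial_cycles k S)
       Mod simplicial_boundaries k S"

text \<open>Cochains are extended by zero outside the \<open>k\<close>-faces.\<close>

definition cochains :: "nat \<Rightarrow> 'a set set \<Rightarrow> ('a set \<Rightarrow> 'r::comm_ring_1) set" where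
  "cochains k S = {f. \<forall>\<sigma>. \<sigma> \<notin> faces k S \<longrightarrow> f \<sigma> = 0}"

definition coboundary ::
    "nat \<Rightarrow> 'a::linorder set set \<Rightarrow> ('a set \<Rightarrow> 'r::comm_ring_1) \<Rightarrow> 'a set \<Rightarrow> 'r" where
  "coboundary k S f =
     (\<lambda>\<sigma>. if \<sigma> \<in> faces (Suc k) S then \<Sum>v\<in>\<sigma>. incidence_sign \<sigma> v * f (\<sigma> - {v}) else 0)"

definition cocycles :: "nat \<Rightarrow> 'a::linorder set set \<Rightarrow> ('a set \<Rightarrow> 'r::comm_ring_1) set" where
  "cocycles k S = {f \<in> cochains k S. coboundary k S f = (\<lambda>_. 0)}"

section \<open>Determinantal hypertrees\<close>

text \<open>Dimension 2 is read as dimension at most 2. For \<open>n \<ge> 3\<close> the number of triangles forces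
  dimension exactly 2, and for \<open>n = 1, 2\<close> the complete graph is then the only hypertree, as Kalai's
  formula requires.\<close>

definition hypertrees :: "nat \<Rightarrow> nat set set set" where
  "hypertrees n = {S.
     simplicial_complex {1..n} S \<and>
     (\<forall>\<sigma>\<in>S. card \<sigma> \<le> 3) \<and>
     (\<forall>\<sigma>. \<sigma> \<subseteq> {1..n} \<and> (card \<sigma> = 1 \<or> card \<sigma> = 2) \<longrightarrow> \<sigma> \<in> S) \<and>
     card (faces 2 S) = (n - 1) choose 2 \<and>
     finite (carrier (simplicial_homology_group 1 S))}"

definition determinantal_hypertree :: "nat \<Rightarrow> nat set set pmf \<Rightarrow> bool" where
  "determinantal_hypertree n T \<longleftrightarrow>
     set_pmf T \<subseteq> hypertrees n \<and>
     (\<forall>S\<in>hypertrees n.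
        pmf T S = (real (Coset.order (simplicial_homology_group 1 S)))\<^sup>2 / real n ^ ((n - 2) choose 2))"

section \<open>Disjoint unions of 5-cycles as cocycles\<close>

definition is_cycle_graph :: "nat \<Rightarrow> 'a set set \<Rightarrow> bool" where
  "is_cycle_graph k C \<longleftrightarrow>
     (\<exists>vs. distinct vs \<and> length vs = k \<and> C = {{vs ! i, vs ! (Suc i mod k)} | i. i < k})"

text \<open>A graph on \<open>{1..n}\<close> is given by its edge set. Since \<open>\<Union>C\<close> is the vertex set of a cycle \<open>C\<close>,
  the \<open>h\<close> cycles cover \<open>5 * h\<close> vertices, and the other \<open>n - 5 * h\<close> vertices are isolated because
  no edge contains them.\<close>

definition five_cycle_graphs :: "nat \<Rightarrow> nat \<Rightarrow> nat set set set" where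
  "five_cycle_graphs n h = {E. \<exists>\<C>.
     finite \<C> \<and> card \<C> = h \<and>
     (\<forall>C\<in>\<C>. is_cycle_graph 5 C \<and> \<Union>C \<subseteq> {1..n}) \<and>
     pairwise (\<lambda>C D. \<Union>C \<inter> \<Union>D = {}) \<C> \<and>
     E = \<Union>\<C>}"

definition five_cycle_cocycle_count :: "nat \<Rightarrow> nat \<Rightarrow> nat set set \<Rightarrow> nat" where
  "five_cycle_cocycle_count n h S =
     card {E \<in> five_cycle_graphs n h. (indicator E :: nat set \<Rightarrow> bit) \<in> cocycles 1 S}"

end

theory Submission
  imports Defs "Jordan_Normal_Form.Determinant" "HOL-Combinatorics.Multiset_Permutations"
begin

text \<open>For a root vertex, the triangles of a hypertree index the columns of a square submatrix of the
  boundary matrix whose rows are the edges avoiding the root, and the order of \<open>H\<^sub>1\<close> is the absolute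
  value of its determinant. By Cauchy--Binet and the identity \<open>det (1 - X Y) = det (1 - Y X)\<close>, the
  probability that the random hypertree avoids a set \<open>B\<close> of triangles is the determinant of
  \<open>1 - (1/n) \<partial>\<^sub>B \<partial>\<^sub>B\<^sup>T\<close> on the space of edges. A graph is a cocycle iff the hypertree avoids the
  triangles that contain an odd number of its edges.

  Only two triangles through an edge of a disjoint union of 5-cycles contain an even number of edges, so
  Hadamard's inequality bounds the probability that two such graphs are both cocycles by \<open>4/n\<close> to the
  number of edges of their union. Summing over ordered vertex lists gives the second moment. For the first
  moment, completing squares in the variables of the other edges leaves on the edges of the graph,
  up to small errors, 4 minus the Laplacian of the cycles, which is bounded below because 5 is odd.\<close>

section \<open>Determinants of finitely indexed matrices\<close>

text \<open>About n^(5h) graphs compete with a cocycle probability of order n^(-5h), so both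
  determinant estimates must be right up to a factor depending on h alone. The matrix has order n^2
  rows, hence a smallest-eigenvalue bound is useless for the lower estimate. What saves it: only
  about \<open>5 * h * n\<close> edges off the graph lie in an odd triangle, each costs a factor 1 -
  O(1/n), and all others cost nothing. The determinant over all edges arises because \<partial>
  \<partial>^T acts on cycles as multiplication by n. This makes the inverse of the reduced
  Laplacian explicit, and makes \<partial>^T \<partial> / n the kernel of the random set of
  triangles. On the edge side a diagonal entry merely counts triangles through an edge, which is why
  4/n appears. Determinants are compared through Schur complements, so that inequalities between
  quadratic forms are the only spectral input.\<close>

definition enum :: "'a set \<Rightarrow> nat \<Rightarrow> 'a" where
  "enum I = (SOME e. bij_betw e {..<card I} I)"

lemma bij_betw_enum: "finite I \<Longrightarrow> bij_betw (enum I) {..<card I} I"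
  unfolding enum_def
  using ex_bij_betw_nat_finite[of I] by (metis atLeast0LessThan someI_ex)

lemma enum_in: "finite I \<Longrightarrow> i < card I \<Longrightarrow> enum I i \<in> I"
  using bij_betw_enum[of I] by (auto simp: bij_betw_def)

lemma enum_inj: "finite I \<Longrightarrow> i < card I \<Longrightarrow> j < card I \<Longrightarrow> enum I i = enum I j \<longleftrightarrow> i = j"
  using bij_betw_enum[of I] by (auto simp: bij_betw_def inj_on_def)

lemma sum_enum: "finite I \<Longrightarrow> (\<Sum>i<card I. g (enum I i)) = (\<Sum>i\<in>I. g i)"
  by (rule sum.reindex_bij_betw[OF bij_betw_enum])

lemma prod_enum: "finite I \<Longrightarrow> (\<Prod>i<card I. g (enum I i)) = (\<Prod>i\<in>I. g i)"
  by (rule prod.reindex_bij_betw[OF bij_betw_enum])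

text \<open>\<open>mat\<close> uses initial segments of the naturals as index sets, so every finite
  set gets one arbitrary but fixed enumeration. The determinant of \<open>matrix_of I I f\<close>
  does not depend on it; for two different index sets of equal size its sign does, but only absolute
  values and products of two such determinants matter later.\<close>

definition matrix_of :: "'a set \<Rightarrow> 'b set \<Rightarrow> ('a \<Rightarrow> 'b \<Rightarrow> 'r) \<Rightarrow> 'r mat" where
  "matrix_of I J f = mat (card I) (card J) (\<lambda>(i, j). f (enum I i) (enum J j))"

lemma matrix_of_carrier [simp]: "matrix_of I J f \<in> carrier_mat (card I) (card J)"
  by (simp add: matrix_of_def)

lemma matrix_of_cong:
  assumes "finite I" "finite J" "\<And>i j. i \<in> I \<Longrightarrow> j \<in> J \<Longrightarrow> f i j = g i j"
  shows "matrix_of I J f = matrix_of I J g"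
  by (rule eq_matI) (auto simp: matrix_of_def assms enum_in)

lemma matrix_of_mult:
  assumes "finite J"
  shows "matrix_of I J f * matrix_of J K g = matrix_of I K (\<lambda>i k. \<Sum>j\<in>J. f i j * g j k)"
  by (rule eq_matI)
    (auto simp: matrix_of_def scalar_prod_def sum_enum[OF assms, symmetric] atLeast0LessThan)

lemma matrix_of_id:
  assumes "finite I"
  shows "matrix_of I I (\<lambda>i j. of_bool (i = j)) = 1\<^sub>m (card I)"
  by (rule eq_matI) (use assms in \<open>auto simp: matrix_of_def enum_inj\<close>)

lemma matrix_of_diff:
  "matrix_of I J (\<lambda>i j. f i j - g i j :: 'r :: ab_group_add) = matrix_of I J f - matrix_of I J g"
  by (rule eq_matI) (auto simp: matrix_of_def)

lemma matrix_of_transpose: "transpose_mat (matrix_of I J f) = matrix_of J I (\<lambda>j i. f i j)"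
  by (rule eq_matI) (auto simp: matrix_of_def)

lemma det_matrix_of_mult:
  assumes "finite I"
  shows "det (matrix_of I I (\<lambda>i k. \<Sum>j\<in>I. f i j * g j k)) =
    det (matrix_of I I f) * det (matrix_of I I g)"
  using det_mult[of "matrix_of I I f" "card I" "matrix_of I I g"]
  by (simp add: matrix_of_mult[OF assms])

lemma det_matrix_of_transpose:
  "det (matrix_of I I (\<lambda>i j. f j i)) = det (matrix_of I I f)"
  using det_transpose[of "matrix_of I I f" "card I"] by (simp add: matrix_of_transpose)

lemma det_matrix_of_diag:
  fixes d :: "'a \<Rightarrow> 'r :: comm_ring_1"
  assumes "finite I"
  shows "det (matrix_of I I (\<lambda>i j. if i = j then d i else 0)) = (\<Prod>i\<in>I. d i)"
proof -
  let ?A = "matrix_of I I (\<lambda>i j. if i = j then d i else 0)"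
  have "upper_triangular ?A"
    using assms by (auto simp: matrix_of_def enum_inj upper_triangular_def)
  then have "det ?A = prod_list (diag_mat ?A)"
    by (rule det_upper_triangular[OF _ matrix_of_carrier])
  also have "\<dots> = (\<Prod>i<card I. d (enum I i))"
    by (simp add: prod_list_diag_prod matrix_of_def atLeast0LessThan)
  finally show ?thesis using prod_enum[OF assms] by simp
qed

text \<open>Both sides are the determinant of the block matrix with blocks 1, X, Y, 1: multiplying
  it by the same unipotent matrix \<open>?L\<close> from the left and from the right clears the
  lower left block and leaves one side or the other.\<close>

lemma det_one_minus_mult_commute:
  fixes X Y :: "'r :: idom mat"
  assumes X: "X \<in> carrier_mat m k" and Y: "Y \<in> carrier_mat k m"
  shows "det (1\<^sub>m m - X * Y) = det (1\<^sub>m k - Y * X)"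
proof -
  let ?F = "four_block_mat (1\<^sub>m m) X Y (1\<^sub>m k)"
  let ?L = "four_block_mat (1\<^sub>m m) (0\<^sub>m m k) (- Y) (1\<^sub>m k)"
  have F: "?F \<in> carrier_mat (m + k) (m + k)" and L: "?L \<in> carrier_mat (m + k) (m + k)"
    using X Y by auto
  have L1: "det ?L = 1"
    using Y by (subst det_four_block_mat_upper_right_zero[where n = m and m = k]) auto
  have "?L * ?F = four_block_mat (1\<^sub>m m) X (0\<^sub>m k m) (1\<^sub>m k - Y * X)"
    using X Y
    by (subst mult_four_block_mat[where ?nr1.0 = m and ?n1.0 = m and ?n2.0 = k and ?nr2.0 = k and ?nc1.0 = m and ?nc2.0 = k])
      (auto simp: uminus_l_inv_mat comm_add_mat minus_add_uminus_mat[of "1\<^sub>m k" k k "Y * X"])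
  then have "det ?L * det ?F = det (1\<^sub>m k - Y * X)"
    using X Y F L
    by (subst det_mult[symmetric, OF L F])
      (simp, subst det_four_block_mat_lower_left_zero[where n = m and m = k], auto)
  moreover have "?F * ?L = four_block_mat (1\<^sub>m m - X * Y) X (0\<^sub>m k m) (1\<^sub>m k)"
    using X Y
    by (subst mult_four_block_mat[where ?nr1.0 = m and ?n1.0 = m and ?n2.0 = k and ?nr2.0 = k and ?nc1.0 = m and ?nc2.0 = k])
      (auto simp: minus_add_uminus_mat[of "1\<^sub>m m" m m "X * Y"])
  then have "det ?F * det ?L = det (1\<^sub>m m - X * Y)"
    using X Y F L
    by (subst det_mult[symmetric, OF F L])
      (simp, subst det_four_block_mat_lower_left_zero[where n = m and m = k], auto)
  ultimately show ?thesis using L1 by (simp add: mult.commute)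
qed

lemma det_matrix_of_one_minus_commute:
  fixes f :: "'a \<Rightarrow> 'b \<Rightarrow> 'r :: idom"
  assumes "finite I" "finite J"
  shows "det (matrix_of I I (\<lambda>i i'. of_bool (i = i') - (\<Sum>j\<in>J. f i j * g j i'))) =
    det (matrix_of J J (\<lambda>j j'. of_bool (j = j') - (\<Sum>i\<in>I. g j i * f i j')))"
  using det_one_minus_mult_commute[of "matrix_of I J f" "card I" "card J" "matrix_of J I g"]
  by (simp add: matrix_of_diff matrix_of_id matrix_of_mult assms)

text \<open>Multilinear expansion gives a sum over all maps \<phi> from row indices to T. A map that
  is not injective produces two equal rows; an injective one is grouped by its image S and differs
  from \<open>enum S\<close> by a permutation.\<close>

theorem Cauchy_Binet:
  fixes f g :: "'a \<Rightarrow> 'b \<Rightarrow> 'r :: comm_ring_1"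
  assumes I: "finite I" and T: "finite T"
  shows "det (matrix_of I I (\<lambda>i k. \<Sum>t\<in>T. f i t * g k t)) =
    (\<Sum>S | S \<subseteq> T \<and> card S = card I. det (matrix_of I S f) * det (matrix_of I S g))"
proof -
  define m where "m = card I"
  define a where "a i t = f (enum I i) t" for i t
  define b where "b i t = g (enum I i) t" for i t
  let ?M = "{0..<m}"
  let ?P = "{p. p permutes ?M}"
  let ?\<Phi> = "?M \<rightarrow>\<^sub>E T"
  define D where "D \<phi> = det (mat m m (\<lambda>(i, k). b k (\<phi> i)))" for \<phi>
  have fin\<Phi>: "finite ?\<Phi>" using T by (intro finite_PiE) auto
  have D0: "D \<phi> = 0" if "\<not> inj_on \<phi> ?M" for \<phi>
  proof -
    from that obtain i j where "i < m" "j < m" "i \<noteq> j" "\<phi> i = \<phi> j" by (auto simp: inj_on_def)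
    then show ?thesis unfolding D_def
      by (intro det_identical_rows[of _ m i j]) auto
  qed
  have "det (matrix_of I I (\<lambda>i k. \<Sum>t\<in>T. f i t * g k t)) =
      (\<Sum>p\<in>?P. signof p * (\<Prod>i\<in>?M. \<Sum>t\<in>T. a i t * b (p i) t))"
    by (subst det_def'[of _ m])
      (auto simp: matrix_of_def m_def a_def b_def permutes_in_image intro!: sum.cong prod.cong)
  also have "\<dots> = (\<Sum>p\<in>?P. \<Sum>\<phi>\<in>?\<Phi>. (\<Prod>i\<in>?M. a i (\<phi> i)) * (signof p * (\<Prod>i\<in>?M. b (p i) (\<phi> i))))"
    by (subst prod_sum_PiE) (auto simp: T sum_distrib_left prod.distrib mult_ac intro!: sum.cong)
  also have "\<dots> = (\<Sum>\<phi>\<in>?\<Phi>. (\<Prod>i\<in>?M. a i (\<phi> i)) * D \<phi>)"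
    unfolding D_def
    by (subst sum.swap, subst det_def'[of _ m])
      (auto simp: sum_distrib_left permutes_in_image intro!: sum.cong prod.cong)
  also have "\<dots> = (\<Sum>\<phi> | \<phi> \<in> ?\<Phi> \<and> inj_on \<phi> ?M. (\<Prod>i\<in>?M. a i (\<phi> i)) * D \<phi>)"
    by (rule sum.mono_neutral_right) (auto simp: fin\<Phi> D0)
  also have "\<dots> = (\<Sum>S | S \<subseteq> T \<and> card S = m.
      \<Sum>\<phi> | \<phi> \<in> {\<phi>. \<phi> \<in> ?\<Phi> \<and> inj_on \<phi> ?M} \<and> \<phi> ` ?M = S. (\<Prod>i\<in>?M. a i (\<phi> i)) * D \<phi>)"
    by (rule sum.group[symmetric]) (auto simp: fin\<Phi> T card_image)
  also have "\<dots> = (\<Sum>S | S \<subseteq> T \<and> card S = m. det (matrix_of I S f) * det (matrix_of I S g))"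
  proof (rule sum.cong[OF refl])
    fix S assume "S \<in> {S. S \<subseteq> T \<and> card S = m}"
    then have S: "S \<subseteq> T" and Sm: "m = card S" by auto
    have finS: "finite S" using S T finite_subset by blast
    have bij: "bij_betw (enum S) ?M S" using bij_betw_enum[OF finS] Sm by (simp add: atLeast0LessThan)
    let ?A = "{\<phi>. \<phi> \<in> {\<phi>. \<phi> \<in> ?\<Phi> \<and> inj_on \<phi> ?M} \<and> \<phi> ` ?M = S}"
    let ?h = "\<lambda>p. restrict (enum S \<circ> p) ?M"
    have bijh: "bij_betw ?h ?P ?A"
    proof (rule bij_betwI')
      fix p q assume p: "p \<in> ?P" and q: "q \<in> ?P"
      show "(?h p = ?h q) = (p = q)"
      proof
        assume eq: "?h p = ?h q"
        show "p = q"
        proof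
          fix i show "p i = q i"
          proof (cases "i \<in> ?M")
            case True
            then have "enum S (p i) = enum S (q i)" using fun_cong[OF eq, of i] by simp
            moreover have "p i \<in> ?M" "q i \<in> ?M" using p q True by (auto simp: permutes_in_image)
            ultimately show ?thesis using enum_inj[OF finS] Sm by auto
          next
            case False then show ?thesis using p q by (auto simp: permutes_def)
          qed
        qed
      qed simp
    next
      fix p assume p: "p \<in> ?P"
      have "bij_betw (enum S \<circ> p) ?M S"
        using p bij by (auto intro: bij_betw_trans permutes_imp_bij)
      then have "bij_betw (?h p) ?M S" by (subst bij_betw_cong[of _ _ "enum S \<circ> p"]) auto
      then show "?h p \<in> ?A" using S by (auto simp: bij_betw_def)
    next
      fix \<phi> assume \<phi>: "\<phi> \<in> ?A"
      then have b1: "bij_betw \<phi> ?M S" by (auto simp: bij_betw_def)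
      define p where "p i = (if i \<in> ?M then the_inv_into ?M (enum S) (\<phi> i) else i)" for i
      have "bij_betw (the_inv_into ?M (enum S) \<circ> \<phi>) ?M ?M"
        by (rule bij_betw_trans[OF b1 bij_betw_the_inv_into[OF bij]])
      then have "bij_betw p ?M ?M" by (subst bij_betw_cong[of _ _ "the_inv_into ?M (enum S) \<circ> \<phi>"]) (auto simp: p_def)
      then have "p permutes ?M" by (rule bij_imp_permutes) (auto simp: p_def)
      moreover have "\<phi> = ?h p"
      proof
        fix i show "\<phi> i = ?h p i"
          using \<phi> b1 bij f_the_inv_into_f_bij_betw[OF bij, of "\<phi> i"]
          by (cases "i \<in> ?M") (auto simp: p_def PiE_def extensional_def dest: bij_betwE)
      qed
      ultimately show "\<exists>p\<in>?P. \<phi> = ?h p" by blast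
    qed
    have Dh: "D (?h p) = signof p * det (matrix_of I S g)" if p: "p \<in> ?P" for p
    proof -
      have "D (?h p) = det (mat m m (\<lambda>(i, k). (matrix_of S I (\<lambda>t k. g k t)) $$ (p i, k)))"
        unfolding D_def
      proof (rule arg_cong[of _ _ det], rule eq_matI, goal_cases)
        case (1 i k)
        then have "p i \<in> ?M" using p by (simp add: permutes_in_image)
        with 1 show ?case using Sm by (simp add: matrix_of_def b_def m_def)
      qed auto
      also have "\<dots> = signof p * det (matrix_of S I (\<lambda>t k. g k t))"
        by (rule det_permute_rows) (use p Sm m_def in \<open>auto simp: matrix_of_def\<close>)
      also have "det (matrix_of S I (\<lambda>t k. g k t)) = det (matrix_of I S g)"
        using det_transpose[of "matrix_of I S g" m] matrix_of_carrier[of I S g] Sm m_def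
        by (metis matrix_of_transpose)
      finally show ?thesis .
    qed
    have "(\<Sum>\<phi>\<in>?A. (\<Prod>i\<in>?M. a i (\<phi> i)) * D \<phi>) = (\<Sum>p\<in>?P. (\<Prod>i\<in>?M. a i (?h p i)) * D (?h p))"
      by (rule sum.reindex_bij_betw[OF bijh, symmetric])
    also have "\<dots> = (\<Sum>p\<in>?P. signof p * (\<Prod>i\<in>?M. a i (enum S (p i)))) * det (matrix_of I S g)"
      unfolding sum_distrib_right by (intro sum.cong refl) (auto simp: Dh mult_ac)
    also have "(\<Sum>p\<in>?P. signof p * (\<Prod>i\<in>?M. a i (enum S (p i)))) = det (matrix_of I S f)"
      using Sm by (subst det_def'[of _ m])
        (auto simp: matrix_of_def m_def a_def permutes_in_image intro!: sum.cong prod.cong)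
    finally show "(\<Sum>\<phi>\<in>?A. (\<Prod>i\<in>?M. a i (\<phi> i)) * D \<phi>) = det (matrix_of I S f) * det (matrix_of I S g)" .
  qed
  finally show ?thesis by (simp add: m_def)
qed

section \<open>Determinants of positive semidefinite matrices\<close>

definition quad_form :: "nat \<Rightarrow> (nat \<Rightarrow> nat \<Rightarrow> real) \<Rightarrow> (nat \<Rightarrow> real) \<Rightarrow> real" where
  "quad_form n f x = (\<Sum>i<n. \<Sum>j<n. f i j * x i * x j)"

definition schur_complement :: "nat \<Rightarrow> (nat \<Rightarrow> nat \<Rightarrow> real) \<Rightarrow> nat \<Rightarrow> nat \<Rightarrow> real" where
  "schur_complement n f i j = f i j - f i n * f n j / f n n"

abbreviation nat_det :: "nat \<Rightarrow> (nat \<Rightarrow> nat \<Rightarrow> real) \<Rightarrow> real" where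
  "nat_det n f \<equiv> det (mat n n (\<lambda>(i, j). f i j))"

lemma det_schur_complement:
  assumes "f n n \<noteq> 0"
  shows "nat_det (Suc n) f = f n n * nat_det n (schur_complement n f)"
proof -
  let ?A = "mat n n (\<lambda>(i, j). schur_complement n f i j)"
  let ?b = "mat n 1 (\<lambda>(i, j). f i n / f n n)"
  let ?c = "mat 1 n (\<lambda>(i, j). f n j)"
  let ?d = "mat 1 1 (\<lambda>_. f n n)"
  let ?U = "four_block_mat (1\<^sub>m n) ?b (0\<^sub>m 1 n) (1\<^sub>m 1)"
  let ?L = "four_block_mat ?A (0\<^sub>m n 1) ?c ?d"
  have "mat (Suc n) (Suc n) (\<lambda>(i, j). f i j) = four_block_mat (?A + ?b * ?c) (?b * ?d) ?c ?d"
    by (rule eq_matI)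
      (auto simp: schur_complement_def scalar_prod_def assms less_Suc_eq)
  also have "\<dots> = ?U * ?L"
    by (subst mult_four_block_mat[where ?nr1.0 = n and ?n1.0 = n and ?n2.0 = 1 and ?nr2.0 = 1 and ?nc1.0 = n and ?nc2.0 = 1]) auto
  finally have "nat_det (Suc n) f = det (?U * ?L)" by simp
  also have "\<dots> = det ?U * det ?L"
    by (rule det_mult[of _ "n + 1"]) auto
  also have "det ?U = 1"
    by (subst det_four_block_mat_lower_left_zero[where n = n and m = 1]) auto
  also have "det ?L = det ?A * f n n"
    by (subst det_four_block_mat_upper_right_zero[where n = n and m = 1])
      (auto simp: det_single)
  finally show ?thesis by simp
qed

lemma quad_form_Suc:
  assumes sym: "\<And>i j. i \<le> n \<Longrightarrow> j \<le> n \<Longrightarrow> f i j = f j i" and "f n n \<noteq> 0"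
  shows "quad_form (Suc n) f x =
    quad_form n (schur_complement n f) x + f n n * (x n + (\<Sum>i<n. f i n * x i) / f n n)\<^sup>2"
proof -
  define s where "s = (\<Sum>i<n. f i n * x i)"
  have 1: "quad_form (Suc n) f x = quad_form n f x + 2 * x n * s + f n n * (x n)\<^sup>2"
  proof -
    have "(\<Sum>j<n. f n j * x n * x j) = x n * s" "(\<Sum>i<n. f i n * x i * x n) = x n * s"
      by (auto simp: s_def sum_distrib_left sym[of n] intro!: sum.cong)
    then show ?thesis
      by (simp add: quad_form_def sum.distrib power2_eq_square algebra_simps)
  qed
  have "schur_complement n f i j * x i * x j = f i j * x i * x j - (f i n * x i) * (f j n * x j) / f n n"
    if "j < n" for i j
    using that sym[of n j] by (simp add: schur_complement_def algebra_simps)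
  then have "quad_form n (schur_complement n f) x =
      quad_form n f x - (\<Sum>i<n. \<Sum>j<n. (f i n * x i) * (f j n * x j) / f n n)"
    by (simp add: quad_form_def sum_subtractf)
  also have "(\<Sum>i<n. \<Sum>j<n. (f i n * x i) * (f j n * x j) / f n n) = s\<^sup>2 / f n n"
    by (simp add: s_def power2_eq_square sum_product sum_divide_distrib)
  finally have 2: "quad_form n (schur_complement n f) x = quad_form n f x - s\<^sup>2 / f n n" .
  show ?thesis unfolding 1 2 s_def[symmetric] using assms(2)
    by (simp add: field_simps power2_eq_square)
qed

lemma quad_form_unit:
  assumes "k < n"
  shows "quad_form n f (\<lambda>i. if i = k then t else 0) = f k k * t\<^sup>2"
proof -
  have "quad_form n f (\<lambda>i. if i = k then t else 0) =
      (\<Sum>i<n. if i = k then f i k * t * t else 0)"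
    unfolding quad_form_def
    by (intro sum.cong refl) (use assms in \<open>simp add: if_distrib[of "\<lambda>z. _ * z"] cong: if_cong\<close>)
  then show ?thesis using assms by (simp add: power2_eq_square)
qed

text \<open>When the pivot is positive, the inserted value minimises the form in its last
  coordinate. The complement is therefore a partial minimum, and inherits semidefiniteness and
  inequalities between forms.\<close>

lemma quad_form_schur_complement:
  assumes "\<And>i j. i \<le> n \<Longrightarrow> j \<le> n \<Longrightarrow> f i j = f j i" "f n n \<noteq> 0"
  shows "quad_form n (schur_complement n f) x =
    quad_form (Suc n) f (x(n := - (\<Sum>i<n. f i n * x i) / f n n))"
proof -
  have "quad_form n (schur_complement n f) (x(n := t)) = quad_form n (schur_complement n f) x" for t
    by (simp add: quad_form_def)
  then show ?thesis by (subst quad_form_Suc) (use assms in auto)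
qed

text \<open>A semidefinite form that vanishes at a basis vector has a zero row and column
  there.\<close>

lemma det_zero_pivot:
  assumes sym: "\<And>i j. i \<le> n \<Longrightarrow> j \<le> n \<Longrightarrow> f i j = f j i"
    and psd: "\<And>x. 0 \<le> quad_form (Suc n) f x" and "f n n = 0"
  shows "nat_det (Suc n) f = 0"
proof -
  have z: "f i n = 0" if i: "i < n" for i
  proof (rule ccontr)
    assume "f i n \<noteq> 0"
    \<comment> \<open>Chosen so that the form takes the value -1 at \<open>x\<close>.\<close>
    define t where "t = - (f i i + 1) / (2 * f i n)"
    define x where "x j = (if j = n then t else if j = i then 1 else 0)" for j
    have "quad_form (Suc n) f x = (\<Sum>j\<in>{i, n}. \<Sum>k<Suc n. f j k * x j * x k)"
      unfolding quad_form_def by (rule sum.mono_neutral_right) (use i in \<open>auto simp: x_def\<close>)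
    also have "\<dots> = (\<Sum>j\<in>{i, n}. \<Sum>k\<in>{i, n}. f j k * x j * x k)"
      by (intro sum.cong refl sum.mono_neutral_right) (use i in \<open>auto simp: x_def\<close>)
    also have "\<dots> = f i i + 2 * t * f i n"
      using i \<open>f n n = 0\<close> sym[of n i] by (simp add: x_def)
    also have "\<dots> < 0" using \<open>f i n \<noteq> 0\<close> by (simp add: t_def field_simps)
    finally show False using psd[of x] by linarith
  qed
  let ?A = "mat (Suc n) (Suc n) (\<lambda>(i, j). f i j)"
  have "?A $$ (i, n) * cofactor ?A i n = 0" if "i < Suc n" for i
    using that z \<open>f n n = 0\<close> by (cases "i = n") auto
  then show ?thesis
    using laplace_expansion_column[of ?A "Suc n" n] by (metis (no_types, lifting) lessI lessThan_iff mat_carrier sum.neutral)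
qed

text \<open>Eliminating the last index splits off the pivot and replaces each other diagonal entry
  \<open>f i i\<close> by \<open>f i i\<close> minus the square of \<open>f i n\<close> over the
  pivot, which is no larger.\<close>

lemma nat_det_psd:
  assumes "\<And>i j. i < n \<Longrightarrow> j < n \<Longrightarrow> f i j = f j i" and "\<And>x. 0 \<le> quad_form n f x"
  shows "0 \<le> nat_det n f \<and> nat_det n f \<le> (\<Prod>i<n. f i i)"
  using assms
proof (induction n arbitrary: f)
  case (Suc n f)
  have sym: "\<And>i j. i \<le> n \<Longrightarrow> j \<le> n \<Longrightarrow> f i j = f j i" using Suc.prems(1) by simp
  have diag: "0 \<le> f k k" if "k < Suc n" for k
    using Suc.prems(2)[of "\<lambda>i. if i = k then 1 else 0"] quad_form_unit[OF that, of f 1] by simp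
  show ?case
  proof (cases "f n n = 0")
    case True
    with det_zero_pivot[of n f] sym Suc.prems(2) show ?thesis by simp
  next
    case False
    then have pos: "0 < f n n" using diag[of n] by simp
    let ?g = "schur_complement n f"
    have IH: "0 \<le> nat_det n ?g \<and> nat_det n ?g \<le> (\<Prod>i<n. ?g i i)"
    proof (rule Suc.IH)
      show "?g i j = ?g j i" if "i < n" "j < n" for i j
        using sym[of i j] sym[of i n] sym[of j n] that by (simp add: schur_complement_def)
      show "0 \<le> quad_form n ?g x" for x
        using Suc.prems(2) by (subst quad_form_schur_complement) (use sym False in auto)
    qed
    have g0: "0 \<le> ?g i i" if "i < n" for i
    proof -
      have "0 \<le> quad_form n ?g (\<lambda>j. if j = i then 1 else 0)"
        using Suc.prems(2) by (subst quad_form_schur_complement) (use sym False in auto)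
      then show ?thesis using quad_form_unit[OF that, of ?g 1] by simp
    qed
    have "(\<Prod>i<n. ?g i i) \<le> (\<Prod>i<n. f i i)"
    proof (rule prod_mono)
      fix i assume "i \<in> {..<n}"
      then have "?g i i = f i i - (f i n)\<^sup>2 / f n n"
        using sym[of i n] by (simp add: schur_complement_def power2_eq_square)
      moreover have "0 \<le> (f i n)\<^sup>2 / f n n" using pos by simp
      moreover have "0 \<le> ?g i i" using g0 \<open>i \<in> {..<n}\<close> by simp
      ultimately show "0 \<le> ?g i i \<and> ?g i i \<le> f i i" by linarith
    qed
    with IH have "nat_det n ?g \<le> (\<Prod>i<n. f i i)" by linarith
    then have "f n n * nat_det n ?g \<le> f n n * (\<Prod>i<n. f i i)"
      using pos by (intro mult_left_mono) auto
    then show ?thesis using det_schur_complement[of f n, OF False] IH pos by (simp add: mult.commute)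
  qed
qed simp

text \<open>Both determinants are products of successive pivots. The inequality between the forms
  passes to the Schur complements because these are minima over the last coordinate.\<close>

lemma nat_det_mono:
  assumes "\<And>i j. i < n \<Longrightarrow> j < n \<Longrightarrow> f i j = f j i" "\<And>i j. i < n \<Longrightarrow> j < n \<Longrightarrow> g i j = g j i"
    and "\<And>x. 0 \<le> quad_form n g x" "\<And>x. quad_form n g x \<le> quad_form n f x"
  shows "nat_det n g \<le> nat_det n f"
  using assms
proof (induction n arbitrary: f g)
  case (Suc n f g)
  have symf: "\<And>i j. i \<le> n \<Longrightarrow> j \<le> n \<Longrightarrow> f i j = f j i"
    and symg: "\<And>i j. i \<le> n \<Longrightarrow> j \<le> n \<Longrightarrow> g i j = g j i" using Suc.prems(1,2) by simp_all
  let ?e = "\<lambda>i. if i = n then 1 else 0 :: real"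
  have gn: "0 \<le> g n n" and gf: "g n n \<le> f n n"
    using Suc.prems(3)[of ?e] Suc.prems(4)[of ?e] quad_form_unit[of n "Suc n" _ 1] by simp_all
  have psdf: "0 \<le> quad_form (Suc n) f x" for x
    using Suc.prems(3)[of x] Suc.prems(4)[of x] by linarith
  show ?case
  proof (cases "g n n = 0")
    case True
    then have "nat_det (Suc n) g = 0" using det_zero_pivot[of n g] symg Suc.prems(3) by simp
    also have "\<dots> \<le> nat_det (Suc n) f" using nat_det_psd[of "Suc n" f] psdf Suc.prems(1) by simp
    finally show ?thesis .
  next
    case False
    then have posg: "0 < g n n" and posf: "0 < f n n" using gn gf by auto
    let ?f = "schur_complement n f" and ?g = "schur_complement n g"
    have sg: "?g i j = ?g j i" if "i < n" "j < n" for i j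
      using symg[of i j] symg[of i n] symg[of j n] that by (simp add: schur_complement_def)
    have sf: "?f i j = ?f j i" if "i < n" "j < n" for i j
      using symf[of i j] symf[of i n] symf[of j n] that by (simp add: schur_complement_def)
    have pg: "0 \<le> quad_form n ?g x" for x
      using Suc.prems(3) by (subst quad_form_schur_complement) (use symg posg in auto)
    have "nat_det n ?g \<le> nat_det n ?f"
    proof (rule Suc.IH[OF sf sg pg])
      fix x
      \<comment> \<open>The last coordinate minimises the form of \<open>f\<close>, not that of
        \<open>g\<close>: there the \<open>f\<close>-form equals its complement, while the
        \<open>g\<close>-form is only bounded below by its own.\<close>
      define x' where "x' = x(n := - (\<Sum>i<n. f i n * x i) / f n n)"
      have "quad_form n ?g x = quad_form n ?g x'" by (simp add: quad_form_def x'_def)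
      also have "\<dots> \<le> quad_form (Suc n) g x'"
        by (subst quad_form_Suc) (use symg posg in auto)
      also have "\<dots> \<le> quad_form (Suc n) f x'" by (rule Suc.prems(4))
      also have "\<dots> = quad_form n ?f x"
        unfolding x'_def by (subst quad_form_schur_complement) (use symf posf in auto)
      finally show "quad_form n ?g x \<le> quad_form n ?f x" .
    qed
    moreover have "0 \<le> nat_det n ?g" using nat_det_psd[of n ?g] sg pg by simp
    ultimately have "g n n * nat_det n ?g \<le> f n n * nat_det n ?f"
      using gf posf by (intro mult_mono) auto
    then show ?thesis using det_schur_complement[of g n] det_schur_complement[of f n] posf posg by simp
  qed
qed simp

section \<open>Transfer of the determinant inequalities to finite index sets\<close>

lemma quad_form_enum:
  assumes "finite I"
  shows "quad_form (card I) (\<lambda>i j. f (enum I i) (enum I j)) (\<lambda>i. x (enum I i)) =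
    (\<Sum>i\<in>I. \<Sum>j\<in>I. f i j * x i * x j)"
  by (simp add: quad_form_def sum_enum[OF assms, symmetric])

lemma quad_form_enum_inv:
  assumes "finite I"
  shows "quad_form (card I) (\<lambda>i j. f (enum I i) (enum I j)) x =
    (\<Sum>i\<in>I. \<Sum>j\<in>I. f i j * x (inv_into {..<card I} (enum I) i) * x (inv_into {..<card I} (enum I) j))"
proof -
  have "inv_into {..<card I} (enum I) (enum I i) = i" if "i < card I" for i
    using bij_betw_enum[OF assms] that by (simp add: bij_betw_def)
  then show ?thesis
    by (subst quad_form_enum[OF assms, symmetric]) (simp add: quad_form_def)
qed

lemma Hadamard_inequality:
  fixes f :: "'a \<Rightarrow> 'a \<Rightarrow> real"
  assumes I: "finite I" and sym: "\<And>i j. i \<in> I \<Longrightarrow> j \<in> I \<Longrightarrow> f i j = f j i"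
    and psd: "\<And>x. 0 \<le> (\<Sum>i\<in>I. \<Sum>j\<in>I. f i j * x i * x j)"
  shows "det (matrix_of I I f) \<le> (\<Prod>i\<in>I. f i i)"
proof -
  have "nat_det (card I) (\<lambda>i j. f (enum I i) (enum I j)) \<le> (\<Prod>i<card I. f (enum I i) (enum I i))"
    by (rule nat_det_psd[THEN conjunct2]; (unfold quad_form_enum_inv[OF I])?)
      (simp_all add: sym psd enum_in[OF I])
  then show ?thesis by (simp add: matrix_of_def prod_enum[OF I, of "\<lambda>i. f i i"])
qed

lemma det_matrix_of_mono:
  fixes f g :: "'a \<Rightarrow> 'a \<Rightarrow> real"
  assumes I: "finite I" and symf: "\<And>i j. i \<in> I \<Longrightarrow> j \<in> I \<Longrightarrow> f i j = f j i"
    and symg: "\<And>i j. i \<in> I \<Longrightarrow> j \<in> I \<Longrightarrow> g i j = g j i"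
    and psd: "\<And>x. 0 \<le> (\<Sum>i\<in>I. \<Sum>j\<in>I. g i j * x i * x j)"
    and le: "\<And>x. (\<Sum>i\<in>I. \<Sum>j\<in>I. g i j * x i * x j) \<le> (\<Sum>i\<in>I. \<Sum>j\<in>I. f i j * x i * x j)"
  shows "det (matrix_of I I g) \<le> det (matrix_of I I f)"
  unfolding matrix_of_def
  by (rule nat_det_mono; (unfold quad_form_enum_inv[OF I])?)
    (simp_all add: symf symg psd le enum_in[OF I])

text \<open>The form on the left is that of \<open>U\<^sup>T D U\<close> with \<open>D\<close> diagonal and \<open>U\<close> unipotent.\<close>

lemma prod_le_det_matrix_of:
  fixes f :: "'a \<Rightarrow> 'a \<Rightarrow> real"
  assumes I: "finite I" and X: "X \<subseteq> I" and d: "\<And>i. i \<in> I \<Longrightarrow> 0 \<le> d i"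
    and u: "\<And>i j. i \<in> X \<Longrightarrow> j \<in> X \<Longrightarrow> u i j = 0"
    and sym: "\<And>i j. i \<in> I \<Longrightarrow> j \<in> I \<Longrightarrow> f i j = f j i"
    and le: "\<And>x. (\<Sum>i\<in>I. d i * (x i + (\<Sum>j\<in>X. u i j * x j))\<^sup>2) \<le>
      (\<Sum>i\<in>I. \<Sum>j\<in>I. f i j * x i * x j)"
  shows "(\<Prod>i\<in>I. d i) \<le> det (matrix_of I I f)"
proof -
  have finX: "finite X" using I X finite_subset by blast
  \<comment> \<open>Written as 1 minus a product through \<open>X\<close>, so that
    \<open>det_matrix_of_one_minus_commute\<close> turns its determinant into one over
    \<open>X\<close>. There \<open>u\<close> vanishes and only the identity matrix is left.\<close>
  define U where "U i j = of_bool (i = j) - (\<Sum>k\<in>X. - u i k * of_bool (k = j))" for i j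
  define g where "g j k = (\<Sum>i\<in>I. U i j * (\<Sum>l\<in>I. (if i = l then d i else 0) * U l k))" for j k
  have g: "g j k = (\<Sum>i\<in>I. d i * U i j * U i k)" for j k
    unfolding g_def using I
    by (intro sum.cong refl) (simp add: if_distrib[of "\<lambda>z. z * _"] sum.delta cong: if_cong)
  have "det (matrix_of I I U) =
      det (matrix_of X X (\<lambda>j k. of_bool (j = k) - (\<Sum>i\<in>I. of_bool (j = i) * - u i k)))"
    unfolding U_def by (rule det_matrix_of_one_minus_commute[OF I finX])
  also have "matrix_of X X (\<lambda>j k. of_bool (j = k) - (\<Sum>i\<in>I. of_bool (j = i) * - u i k)) =
      matrix_of X X (\<lambda>j k. of_bool (j = k))"
    using X u I by (intro matrix_of_cong finX) (auto simp: sum.neutral of_bool_def)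
  finally have detU: "det (matrix_of I I U) = 1" by (simp add: matrix_of_id[OF finX])
  have "det (matrix_of I I g) = det (matrix_of I I (\<lambda>j i. U i j)) *
      (det (matrix_of I I (\<lambda>i l. if i = l then d i else 0)) * det (matrix_of I I U))"
    unfolding g_def
    by (subst det_matrix_of_mult[OF I], subst det_matrix_of_mult[OF I]) simp
  then have detg: "det (matrix_of I I g) = (\<Prod>i\<in>I. d i)"
    unfolding det_matrix_of_transpose[of I U] by (simp add: detU det_matrix_of_diag[OF I])
  have form: "(\<Sum>j\<in>I. \<Sum>k\<in>I. g j k * x j * x k) = (\<Sum>i\<in>I. d i * (x i + (\<Sum>j\<in>X. u i j * x j))\<^sup>2)"
    for x
  proof -
    have lin: "(\<Sum>j\<in>I. U i j * x j) = x i + (\<Sum>j\<in>X. u i j * x j)" if "i \<in> I" for i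
    proof -
      have "U i j * x j = (if i = j then x j else 0) + (if j \<in> X then u i j * x j else 0)" for j
        using finX by (simp add: U_def of_bool_def if_distrib[of "\<lambda>z. _ * z"] sum_negf algebra_simps cong: if_cong)
      then have "(\<Sum>j\<in>I. U i j * x j) = x i + (\<Sum>j\<in>I. if j \<in> X then u i j * x j else 0)"
        using that I by (simp add: sum.distrib)
      also have "(\<Sum>j\<in>I. if j \<in> X then u i j * x j else 0) = (\<Sum>j\<in>X. u i j * x j)"
        using X I by (intro sum.mono_neutral_cong_right) auto
      finally show ?thesis .
    qed
    have "(\<Sum>j\<in>I. \<Sum>k\<in>I. g j k * x j * x k) =
        (\<Sum>j\<in>I. \<Sum>k\<in>I. \<Sum>i\<in>I. d i * ((U i j * x j) * (U i k * x k)))"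
      by (simp add: g sum_distrib_left sum_distrib_right mult_ac)
    also have "\<dots> = (\<Sum>j\<in>I. \<Sum>i\<in>I. \<Sum>k\<in>I. d i * ((U i j * x j) * (U i k * x k)))"
      by (rule sum.cong[OF refl]) (rule sum.swap)
    also have "\<dots> = (\<Sum>i\<in>I. \<Sum>j\<in>I. \<Sum>k\<in>I. d i * ((U i j * x j) * (U i k * x k)))"
      by (rule sum.swap)
    also have "\<dots> = (\<Sum>i\<in>I. d i * (\<Sum>j\<in>I. U i j * x j)\<^sup>2)"
      unfolding power2_eq_square sum_product by (simp add: sum_distrib_left)
    finally show ?thesis using lin by simp
  qed
  have "det (matrix_of I I g) \<le> det (matrix_of I I f)"
  proof (rule det_matrix_of_mono[OF I sym])
    show "g i j = g j i" for i j by (simp add: g mult_ac)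
    show "0 \<le> (\<Sum>i\<in>I. \<Sum>j\<in>I. g i j * x i * x j)" for x
      unfolding form using d by (intro sum_nonneg) auto
    show "(\<Sum>i\<in>I. \<Sum>j\<in>I. g i j * x i * x j) \<le> (\<Sum>i\<in>I. \<Sum>j\<in>I. f i j * x i * x j)" for x
      unfolding form by (rule le)
  qed
  then show ?thesis by (simp add: detg)
qed

section \<open>The index of an integer lattice\<close>

text \<open>Vectors are functions on all naturals whose values from n on are unconstrained, so that
  functions modulo this set are integer vectors of length n modulo the row span.\<close>

definition row_lattice :: "nat \<Rightarrow> int mat \<Rightarrow> (nat \<Rightarrow> int) set" where
  "row_lattice n A = {x. \<exists>c. \<forall>j<n. x j = (\<Sum>i<n. c i * A $$ (i, j))}"

text \<open>A transversal \<open>R\<close> instead of a quotient group: representatives can be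
  assembled coordinate by coordinate in the induction on n.\<close>

definition has_index :: "nat \<Rightarrow> (nat \<Rightarrow> int) set \<Rightarrow> nat \<Rightarrow> bool" where
  "has_index n L k \<longleftrightarrow>
     (\<exists>R. finite R \<and> card R = k \<and> (\<forall>x. \<exists>!r. r \<in> R \<and> (\<lambda>j. x j - r j) \<in> L))"

lemma row_lattice_mono:
  assumes "\<And>i. i < n \<Longrightarrow> (\<lambda>j. B $$ (i, j)) \<in> row_lattice n A"
  shows "row_lattice n B \<subseteq> row_lattice n A"
proof
  fix x assume "x \<in> row_lattice n B"
  then obtain c where c: "\<And>j. j < n \<Longrightarrow> x j = (\<Sum>i<n. c i * B $$ (i, j))"
    by (auto simp: row_lattice_def)
  from assms have "\<forall>i. \<exists>d. i < n \<longrightarrow> (\<forall>j<n. B $$ (i, j) = (\<Sum>k<n. d k * A $$ (k, j)))"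
    by (auto simp: row_lattice_def)
  then obtain d where d: "\<And>i j. i < n \<Longrightarrow> j < n \<Longrightarrow> B $$ (i, j) = (\<Sum>k<n. d i k * A $$ (k, j))"
    by metis
  have "x j = (\<Sum>k<n. (\<Sum>i<n. c i * d i k) * A $$ (k, j))" if "j < n" for j
  proof -
    have "x j = (\<Sum>i<n. \<Sum>k<n. c i * d i k * A $$ (k, j))"
      using that by (simp add: c d sum_distrib_left mult_ac)
    also have "\<dots> = (\<Sum>k<n. \<Sum>i<n. c i * d i k * A $$ (k, j))" by (rule sum.swap)
    finally show ?thesis by (simp add: sum_distrib_right)
  qed
  then show "x \<in> row_lattice n A"
    by (auto simp: row_lattice_def intro!: exI[of _ "\<lambda>k. \<Sum>i<n. c i * d i k"])
qed

lemma row_lattice_two_rows: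
  assumes "k < n" "l < n" "k \<noteq> l"
  shows "(\<lambda>j. a * A $$ (k, j) + b * A $$ (l, j)) \<in> row_lattice n A"
  unfolding row_lattice_def
  using assms
  by (auto intro!: exI[of _ "\<lambda>i. if i = k then a else if i = l then b else 0"]
      simp: if_distrib[of "\<lambda>z. z * _"] sum.If_cases cong: if_cong)

lemma row_lattice_row:
  assumes "k < n"
  shows "(\<lambda>j. A $$ (k, j)) \<in> row_lattice n A"
  unfolding row_lattice_def
  using assms
  by (auto intro!: exI[of _ "\<lambda>i. if i = k then 1 else 0"]
      simp: if_distrib[of "\<lambda>z. z * _"] cong: if_cong)

lemma row_lattice_restrict:
  "x \<in> row_lattice n A \<Longrightarrow> (\<And>j. j < n \<Longrightarrow> x j = y j) \<Longrightarrow> y \<in> row_lattice n A"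
  by (auto simp: row_lattice_def)

lemma row_lattice_addrow:
  assumes A: "A \<in> carrier_mat n n" and kl: "k < n" "l < n" "k \<noteq> l"
  shows "row_lattice n (addrow a k l A) = row_lattice n A"
proof (rule antisym; rule row_lattice_mono)
  fix i assume i: "i < n"
  show "(\<lambda>j. addrow a k l A $$ (i, j)) \<in> row_lattice n A"
  proof (cases "i = k")
    case True
    have "(\<lambda>j. a * A $$ (l, j) + 1 * A $$ (k, j)) \<in> row_lattice n A"
      using row_lattice_two_rows[of l n k a A 1] kl by simp
    then show ?thesis by (rule row_lattice_restrict) (use True A kl in auto)
  next
    case False
    show ?thesis
      by (rule row_lattice_restrict[OF row_lattice_row[OF i, of A]]) (use False A kl i in auto)
  qed
  show "(\<lambda>j. A $$ (i, j)) \<in> row_lattice n (addrow a k l A)"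
  proof (cases "i = k")
    case True
    have "(\<lambda>j. (- a) * addrow a k l A $$ (l, j) + 1 * addrow a k l A $$ (k, j)) \<in>
        row_lattice n (addrow a k l A)"
      using row_lattice_two_rows[of l n k "- a" "addrow a k l A" 1] kl by simp
    then show ?thesis by (rule row_lattice_restrict) (use True A kl in auto)
  next
    case False
    show ?thesis
      by (rule row_lattice_restrict[OF row_lattice_row[OF i]]) (use False A kl i in auto)
  qed
qed

lemma row_lattice_swaprows:
  assumes A: "A \<in> carrier_mat n n" and kl: "k < n" "l < n"
  shows "row_lattice n (swaprows k l A) = row_lattice n A"
proof (rule antisym; rule row_lattice_mono)
  fix i assume i: "i < n"
  define i' where "i' = (if i = k then l else if i = l then k else i)"
  have i': "i' < n" using i kl by (simp add: i'_def)
  show "(\<lambda>j. swaprows k l A $$ (i, j)) \<in> row_lattice n A"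
    by (rule row_lattice_restrict[OF row_lattice_row[OF i']]) (use A i kl in \<open>auto simp: i'_def\<close>)
  show "(\<lambda>j. A $$ (i, j)) \<in> row_lattice n (swaprows k l A)"
    by (rule row_lattice_restrict[OF row_lattice_row[OF i']]) (use A i kl in \<open>auto simp: i'_def\<close>)
qed

lemma row_lattice_block:
  assumes z: "\<And>i. i < n \<Longrightarrow> A $$ (i, n) = 0"
  shows "x \<in> row_lattice (Suc n) A \<longleftrightarrow>
    (\<exists>c. x n = c * A $$ (n, n) \<and>
      (\<lambda>j. x j - c * A $$ (n, j)) \<in> row_lattice n (mat n n (\<lambda>(i, j). A $$ (i, j))))"
proof
  assume "x \<in> row_lattice (Suc n) A"
  then obtain c where c: "\<And>j. j < Suc n \<Longrightarrow> x j = (\<Sum>i<Suc n. c i * A $$ (i, j))"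
    by (auto simp: row_lattice_def)
  then show "\<exists>c. x n = c * A $$ (n, n) \<and>
      (\<lambda>j. x j - c * A $$ (n, j)) \<in> row_lattice n (mat n n (\<lambda>(i, j). A $$ (i, j)))"
    using z by (intro exI[of _ "c n"]) (auto simp: row_lattice_def intro!: exI[of _ c])
next
  assume "\<exists>c. x n = c * A $$ (n, n) \<and>
      (\<lambda>j. x j - c * A $$ (n, j)) \<in> row_lattice n (mat n n (\<lambda>(i, j). A $$ (i, j)))"
  then obtain c d where c: "x n = c * A $$ (n, n)"
    and d: "\<And>j. j < n \<Longrightarrow> x j - c * A $$ (n, j) = (\<Sum>i<n. d i * A $$ (i, j))"
    by (auto simp: row_lattice_def)
  have "x j = (\<Sum>i<Suc n. (d(n := c)) i * A $$ (i, j))" if "j < Suc n" for j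
    using that c d[of j] z by (cases "j = n") (auto simp: algebra_simps)
  then show "x \<in> row_lattice (Suc n) A" unfolding row_lattice_def by blast
qed

text \<open>A multiple of the last row brings the last coordinate into a fixed system of residues;
  rows of the leading block do not disturb it while they reduce the other coordinates. The
  transversal consists of all pairs of choices.\<close>

lemma has_index_block:
  assumes z: "\<And>i. i < n \<Longrightarrow> A $$ (i, n) = 0" and g: "A $$ (n, n) \<noteq> 0"
    and idx: "has_index n (row_lattice n (mat n n (\<lambda>(i, j). A $$ (i, j)))) k"
  shows "has_index (Suc n) (row_lattice (Suc n) A) (k * nat \<bar>A $$ (n, n)\<bar>)"
proof -
  let ?B = "mat n n (\<lambda>(i, j). A $$ (i, j))"
  define g where "g = A $$ (n, n)"
  obtain R where R: "finite R" "card R = k"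
    and ex1: "\<And>x. \<exists>!r. r \<in> R \<and> (\<lambda>j. x j - r j) \<in> row_lattice n ?B"
    using idx by (auto simp: has_index_def)
  let ?S = "{0..<\<bar>g\<bar>}"
  let ?h = "\<lambda>(r, s). r(n := s) :: nat \<Rightarrow> int"
  have uniq: "r = r'" if "r \<in> R" "r' \<in> R" "\<And>j. j < n \<Longrightarrow> x j - r j = y j"
      "\<And>j. j < n \<Longrightarrow> x j - r' j = y' j" "y \<in> row_lattice n ?B" "y' \<in> row_lattice n ?B"
    for r r' x y y'
  proof -
    have "(\<lambda>j. x j - r j) \<in> row_lattice n ?B" "(\<lambda>j. x j - r' j) \<in> row_lattice n ?B"
      by (rule row_lattice_restrict[OF that(5)], simp add: that(3))
        (rule row_lattice_restrict[OF that(6)], simp add: that(4))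
    with ex1[of x] that(1,2) show ?thesis by blast
  qed
  have zero: "(\<lambda>_. 0) \<in> row_lattice n ?B"
    by (auto simp: row_lattice_def intro!: exI[of _ "\<lambda>_. 0"])
  have inj: "inj_on ?h (R \<times> ?S)"
  proof (rule inj_onI, clarify)
    fix r s r' s' assume *: "r \<in> R" "r' \<in> R" "r(n := s) = r'(n := s')"
    have eq: "r j = r' j" if "j < n" for j using fun_cong[OF *(3), of j] that by simp
    have "r = r'"
      using uniq[OF *(1,2) _ _ zero zero, of r] eq by simp
    moreover have "s = s'" using fun_cong[OF *(3), of n] by simp
    ultimately show "r = r' \<and> s = s'" by simp
  qed
  have "\<exists>!q. q \<in> ?h ` (R \<times> ?S) \<and> (\<lambda>j. x j - q j) \<in> row_lattice (Suc n) A" for x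
  proof -
    \<comment> \<open>The sign makes \<open>x n - s = c * g\<close> hold for negative
      \<open>g\<close> as well.\<close>
    define c where "c = sgn g * (x n div \<bar>g\<bar>)"
    define s where "s = x n mod \<bar>g\<bar>"
    have xn: "x n - s = c * g"
      unfolding s_def c_def by (metis abs_sgn minus_mod_eq_mult_div mult.commute mult.left_commute)
    have s: "s \<in> ?S" using g by (simp add: s_def g_def)
    obtain r where r: "r \<in> R" "(\<lambda>j. (x j - c * A $$ (n, j)) - r j) \<in> row_lattice n ?B"
      using ex1[of "\<lambda>j. x j - c * A $$ (n, j)"] by blast
    have in_L: "(\<lambda>j. x j - (r'(n := s')) j) \<in> row_lattice (Suc n) A \<longleftrightarrow>
        (\<exists>c'. x n - s' = c' * g \<and> (\<lambda>j. (x j - c' * A $$ (n, j)) - r' j) \<in> row_lattice n ?B)" for r' s'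
    proof -
      have "(\<lambda>j. x j - (r'(n := s')) j - c' * A $$ (n, j)) \<in> row_lattice n ?B \<longleftrightarrow>
          (\<lambda>j. (x j - c' * A $$ (n, j)) - r' j) \<in> row_lattice n ?B" for c'
        by (rule iffI; erule row_lattice_restrict) auto
      then show ?thesis using z by (subst row_lattice_block) (auto simp: g_def)
    qed
    show ?thesis
    proof (rule ex1I[of _ "r(n := s)"])
      show "r(n := s) \<in> ?h ` (R \<times> ?S) \<and> (\<lambda>j. x j - (r(n := s)) j) \<in> row_lattice (Suc n) A"
        using r s xn in_L by force
    next
      fix q assume q: "q \<in> ?h ` (R \<times> ?S) \<and> (\<lambda>j. x j - q j) \<in> row_lattice (Suc n) A"
      then obtain r' s' where q': "r' \<in> R" "s' \<in> ?S" "q = r'(n := s')" by auto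
      then obtain c' where c': "x n - s' = c' * g"
        "(\<lambda>j. (x j - c' * A $$ (n, j)) - r' j) \<in> row_lattice n ?B"
        using q in_L by auto
      have "s - s' = (c' - c) * g" using xn c'(1) by (simp add: left_diff_distrib)
      then have "s mod \<bar>g\<bar> = s' mod \<bar>g\<bar>" by (simp add: mod_eq_dvd_iff)
      then have "s' = s" using s q'(2) by simp
      moreover from this have "c' = c" using xn c'(1) g by (simp add: g_def)
      then have "r' = r" using c'(2) r q'(1) ex1[of "\<lambda>j. x j - c * A $$ (n, j)"] by blast
      ultimately show "q = r(n := s)" using q' by simp
    qed
  qed
  moreover have "card (?h ` (R \<times> ?S)) = k * nat \<bar>g\<bar>"
    by (simp add: card_image[OF inj] card_cartesian_product R)
  moreover have "finite (?h ` (R \<times> ?S))" using R by simp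
  ultimately show ?thesis unfolding has_index_def g_def by blast
qed

lemma det_last_column:
  fixes A :: "int mat"
  assumes A: "A \<in> carrier_mat (Suc n) (Suc n)" and z: "\<And>i. i < n \<Longrightarrow> A $$ (i, n) = 0"
  shows "det A = det (mat n n (\<lambda>(i, j). A $$ (i, j))) * A $$ (n, n)"
proof -
  have "A = four_block_mat (mat n n (\<lambda>(i, j). A $$ (i, j))) (0\<^sub>m n 1)
      (mat 1 n (\<lambda>(i, j). A $$ (n, j))) (mat 1 1 (\<lambda>_. A $$ (n, n)))"
    by (rule eq_matI) (use A z in \<open>auto simp: less_Suc_eq\<close>)
  then have "det A = det (mat n n (\<lambda>(i, j). A $$ (i, j))) * det (mat 1 1 (\<lambda>_. A $$ (n, n)))"
    by (metis det_four_block_mat_upper_right_zero mat_carrier)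
  then show ?thesis by (simp add: det_single)
qed

text \<open>Euclid's algorithm on the last column reduces the size of the matrix.\<close>

lemma has_index_row_lattice:
  assumes "A \<in> carrier_mat n n" "det A \<noteq> 0"
  shows "has_index n (row_lattice n A) (nat \<bar>det A\<bar>)"
  using assms
proof (induction n arbitrary: A)
  case 0
  have "row_lattice 0 A = UNIV" by (auto simp: row_lattice_def)
  moreover have "det A = 1" using 0 by simp
  ultimately show ?case by (auto simp: has_index_def intro!: exI[of _ "{\<lambda>_. 0}"])
next
  case (Suc n A)
  from Suc.prems show ?case
  proof (induction "\<Sum>i<Suc n. nat \<bar>A $$ (i, n)\<bar>" arbitrary: A rule: less_induct)
    case (less A)
    note A = less.prems(1)
    show ?case
    proof (cases "\<exists>k l. k < Suc n \<and> l < Suc n \<and> k \<noteq> l \<and> A $$ (l, n) \<noteq> 0 \<and> \<bar>A $$ (l, n)\<bar> \<le> \<bar>A $$ (k, n)\<bar>")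
      case True
      then obtain k l where kl: "k < Suc n" "l < Suc n" "k \<noteq> l" "A $$ (l, n) \<noteq> 0"
        "\<bar>A $$ (l, n)\<bar> \<le> \<bar>A $$ (k, n)\<bar>" by blast
      \<comment> \<open>The entry in row \<open>k\<close> becomes its remainder modulo the entry in
        row \<open>l\<close>, which is smaller in absolute value than both.\<close>
      define a where "a = - (A $$ (k, n) div A $$ (l, n))"
      let ?B = "addrow a k l A"
      have B: "?B \<in> carrier_mat (Suc n) (Suc n)" using A by simp
      have Bk: "?B $$ (k, n) = A $$ (k, n) mod A $$ (l, n)"
        using A kl by (simp add: a_def minus_div_mult_eq_mod[symmetric])
      have Bi: "?B $$ (i, n) = A $$ (i, n)" if "i < Suc n" "i \<noteq> k" for i
        using that A by simp
      have "(\<Sum>i<Suc n. nat \<bar>?B $$ (i, n)\<bar>) < (\<Sum>i<Suc n. nat \<bar>A $$ (i, n)\<bar>)"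
      proof (rule sum_strict_mono_ex1)
        have lt: "\<bar>?B $$ (k, n)\<bar> < \<bar>A $$ (k, n)\<bar>"
          unfolding Bk using abs_mod_less[OF kl(4), of "A $$ (k, n)"] kl(5) by linarith
        show "\<forall>i\<in>{..<Suc n}. nat \<bar>?B $$ (i, n)\<bar> \<le> nat \<bar>A $$ (i, n)\<bar>"
          using Bi lt by (metis lessThan_iff less_imp_le nat_mono order_refl)
        show "\<exists>i\<in>{..<Suc n}. nat \<bar>?B $$ (i, n)\<bar> < nat \<bar>A $$ (i, n)\<bar>"
          using lt kl(1) by (intro bexI[of _ k]) auto
      qed simp
      moreover have detB: "det ?B = det A" by (rule det_addrow[OF kl(2,3) A])
      ultimately have "has_index (Suc n) (row_lattice (Suc n) ?B) (nat \<bar>det ?B\<bar>)"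
        using less.hyps[OF _ B] less.prems(2) by presburger
      then show ?thesis using row_lattice_addrow[OF A kl(1,2,3)] detB by simp
    next
      case False
      \<comment> \<open>At most one entry of the last column is nonzero now, as of two nonzero ones
        the smaller could serve as \<open>l\<close>. Some entry is nonzero, since the determinant
        is.\<close>
      have "\<exists>k<Suc n. A $$ (k, n) \<noteq> 0"
      proof (rule ccontr)
        assume "\<not> ?thesis"
        then have "det A = 0" using det_last_column[OF A] by simp
        with less.prems(2) show False by simp
      qed
      then obtain k where k: "k < Suc n" "A $$ (k, n) \<noteq> 0" by blast
      have zk: "A $$ (i, n) = 0" if "i < Suc n" "i \<noteq> k" for i
        using False k that by (metis abs_ge_zero abs_0 linorder_linear)
      let ?B = "swaprows k n A"
      have B: "?B \<in> carrier_mat (Suc n) (Suc n)" using A by simp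
      have zB: "?B $$ (i, n) = 0" if "i < n" for i
        using that A k zk by auto
      have gB: "?B $$ (n, n) \<noteq> 0" using A k by auto
      have detB: "\<bar>det ?B\<bar> = \<bar>det A\<bar>"
      proof (cases "k = n")
        case True
        then have "?B = A" using A by (intro eq_matI) auto
        then show ?thesis by simp
      next
        case False
        then show ?thesis using det_swaprows[of k "Suc n" n A] k A by simp
      qed
      let ?C = "mat n n (\<lambda>(i, j). ?B $$ (i, j))"
      have detBC: "det ?B = det ?C * ?B $$ (n, n)" by (rule det_last_column[OF B zB])
      then have "det ?C \<noteq> 0" using detB less.prems(2) by auto
      then have "has_index n (row_lattice n ?C) (nat \<bar>det ?C\<bar>)" by (intro Suc.IH) auto
      from has_index_block[OF zB gB this]
      have "has_index (Suc n) (row_lattice (Suc n) ?B) (nat \<bar>det ?B\<bar>)"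
        by (simp add: detBC abs_mult nat_mult_distrib)
      then show ?thesis using row_lattice_swaprows[OF A k(1), of n] detB by simp
    qed
  qed
qed

text \<open>A kernel vector of \<open>A\<close> defines a linear functional that vanishes on the
  lattice but takes infinitely many values, so finitely many cosets cannot cover everything.\<close>

lemma row_lattice_singular:
  assumes A: "A \<in> carrier_mat n n" and "det A = 0" and R: "finite R"
  shows "\<exists>x. \<forall>r\<in>R. (\<lambda>j. x j - r j) \<notin> row_lattice n A"
proof -
  obtain y where y: "y \<in> carrier_vec n" "y \<noteq> 0\<^sub>v n" "A *\<^sub>v y = 0\<^sub>v n"
    using assms det_0_iff_vec_prod_zero[OF A] by blast
  then obtain k where k: "k < n" "y $ k \<noteq> 0" by (metis carrier_vecD eq_vecI index_zero_vec)
  have Ay: "(\<Sum>j<n. A $$ (i, j) * y $ j) = 0" if "i < n" for i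
    using arg_cong[OF y(3), of "\<lambda>v. v $ i"] that A y(1) by (simp add: scalar_prod_def atLeast0LessThan)
  have orth: "(\<Sum>j<n. x j * y $ j) = 0" if x: "x \<in> row_lattice n A" for x
  proof -
    obtain c where c: "\<And>j. j < n \<Longrightarrow> x j = (\<Sum>i<n. c i * A $$ (i, j))"
      using x by (auto simp: row_lattice_def)
    have "(\<Sum>j<n. x j * y $ j) = (\<Sum>j<n. \<Sum>i<n. c i * (A $$ (i, j) * y $ j))"
      by (simp add: c sum_distrib_right mult.assoc)
    also have "\<dots> = (\<Sum>i<n. c i * (\<Sum>j<n. A $$ (i, j) * y $ j))"
      by (subst sum.swap) (simp add: sum_distrib_left)
    finally show ?thesis by (simp add: Ay)
  qed
  define x where "x t j = (if j = k then t else 0)" for t :: int and j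
  have xt: "(\<Sum>j<n. x t j * y $ j) = t * y $ k" for t
    using k by (simp add: x_def if_distrib[of "\<lambda>z. z * _"] cong: if_cong)
  have "\<exists>t. \<forall>r\<in>R. (\<lambda>j. x t j - r j) \<notin> row_lattice n A"
  proof (rule ccontr)
    assume "\<not> ?thesis"
    then have "\<forall>t. \<exists>r\<in>R. (\<lambda>j. x t j - r j) \<in> row_lattice n A" by blast
    then obtain f where f: "\<And>t. f t \<in> R" "\<And>t. (\<lambda>j. x t j - f t j) \<in> row_lattice n A" by metis
    have "t * y $ k = (\<Sum>j<n. f t j * y $ j)" for t
      using orth[OF f(2)[of t]] xt[of t] by (simp add: left_diff_distrib sum_subtractf)
    then have "inj f" using k by (metis injI mult_right_cancel)
    moreover have "finite (range f)" using f(1) R by (meson finite_subset image_subset_iff)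
    ultimately show False using finite_imageD infinite_UNIV_int by blast
  qed
  then show ?thesis by blast
qed

section \<open>The boundary matrix of the complete complex\<close>

definition edges :: "nat \<Rightarrow> nat set set" where
  "edges n = {e. e \<subseteq> {1..n} \<and> card e = 2}"

definition triangles :: "nat \<Rightarrow> nat set set" where
  "triangles n = {t. t \<subseteq> {1..n} \<and> card t = 3}"

definition reduced_edges :: "nat \<Rightarrow> nat set set" where
  "reduced_edges n = {e \<in> edges n. 1 \<notin> e}"

definition boundary_coeff :: "nat set \<Rightarrow> nat set \<Rightarrow> 'r::comm_ring_1" where
  "boundary_coeff \<tau> \<sigma> = (\<Sum>v\<in>\<sigma>. if \<tau> = \<sigma> - {v} then incidence_sign \<sigma> v else 0)"

text \<open>The antisymmetric extension to ordered pairs of vertices. It states the cycle condition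
  without signs and spares most case distinctions on the order of the vertices of a
  triangle.\<close>

definition oriented :: "(nat set \<Rightarrow> 'r::ab_group_add) \<Rightarrow> nat \<Rightarrow> nat \<Rightarrow> 'r" where
  "oriented x u v = (if u < v then x {u, v} else if v < u then - x {u, v} else 0)"

definition cycle_function :: "nat \<Rightarrow> (nat set \<Rightarrow> 'r::comm_ring_1) \<Rightarrow> bool" where
  "cycle_function n x \<longleftrightarrow> (\<forall>v\<in>{1..n}. (\<Sum>u\<in>{1..n}. oriented x u v) = 0)"

lemma finite_edges [simp]: "finite (edges n)"
  by (rule finite_subset[of _ "Pow {1..n}"]) (auto simp: edges_def)

lemma finite_triangles [simp]: "finite (triangles n)"
  by (rule finite_subset[of _ "Pow {1..n}"]) (auto simp: triangles_def)

lemma finite_reduced_edges [simp]: "finite (reduced_edges n)"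
  by (simp add: reduced_edges_def)

lemma reduced_edges_subset: "reduced_edges n \<subseteq> edges n"
  by (auto simp: reduced_edges_def)

lemma card_reduced_edges: "card (reduced_edges n) = (n - 1) choose 2"
proof -
  have "reduced_edges n = {e. e \<subseteq> {2..n} \<and> card e = 2}"
  proof -
    have "e \<subseteq> {1..n} \<and> 1 \<notin> e \<longleftrightarrow> e \<subseteq> {2..n}" for e
      by (auto simp: subset_iff Suc_le_eq numeral_2_eq_2) (metis Suc_lessI less_Suc_eq not_less_eq)
    then show ?thesis by (auto simp: reduced_edges_def edges_def)
  qed
  then show ?thesis using n_subsets[of "{2..n}" 2] by simp
qed

lemma edgesE:
  assumes "e \<in> edges n"
  obtains a b where "a < b" "e = {a, b}" "a \<in> {1..n}" "b \<in> {1..n}"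
proof -
  from assms obtain a b where ab: "e = {a, b}" "a \<noteq> b" by (auto simp: edges_def card_2_iff)
  then have "a \<in> {1..n}" "b \<in> {1..n}" using assms by (auto simp: edges_def)
  then show thesis using ab that[of a b] that[of b a] by (metis insert_commute neqE)
qed

lemma trianglesE:
  assumes "t \<in> triangles n"
  obtains a b c where "a < b" "b < c" "t = {a, b, c}" "a \<in> {1..n}" "b \<in> {1..n}" "c \<in> {1..n}"
proof -
  define l where "l = sorted_list_of_set t"
  have "finite t" "card t = 3" using assms by (auto simp: triangles_def intro: finite_subset)
  then have "length l = 3" "sorted_wrt (<) l" "set l = t" by (auto simp: l_def)
  then obtain a b c where "l = [a, b, c]"
    by (metis (no_types, opaque_lifting) length_0_conv length_Suc_conv numeral_3_eq_3)
  then show thesis using that[of a b c] \<open>sorted_wrt (<) l\<close> \<open>set l = t\<close> assms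
    by (auto simp: triangles_def)
qed

lemma edge_in_edges: "{a, b} \<in> edges n \<longleftrightarrow> a \<noteq> b \<and> a \<in> {1..n} \<and> b \<in> {1..n}"
  by (cases "a = b") (auto simp: edges_def)

lemma edge_in_reduced_edges:
  "{a, b} \<in> reduced_edges n \<longleftrightarrow> a \<noteq> b \<and> a \<in> {2..n} \<and> b \<in> {2..n}"
  by (auto simp: reduced_edges_def edge_in_edges)

lemma triangle_in_triangles:
  "a \<noteq> b \<Longrightarrow> b \<noteq> c \<Longrightarrow> a \<noteq> c \<Longrightarrow>
    {a, b, c} \<in> triangles n \<longleftrightarrow> a \<in> {1..n} \<and> b \<in> {1..n} \<and> c \<in> {1..n}"
  by (auto simp: triangles_def)

lemma oriented_swap: "oriented x u v = - oriented x v u"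
  by (auto simp: oriented_def insert_commute)

lemma oriented_same [simp]: "oriented x u u = 0"
  by (simp add: oriented_def)

section \<open>Incidence numbers of edges and triangles\<close>

lemma boundary_coeff_pair:
  assumes "a < b"
  shows "boundary_coeff \<tau> {a, b} = of_bool (\<tau> = {b}) - (of_bool (\<tau> = {a}) :: 'r::comm_ring_1)"
proof -
  have "{a, b} - {a} = {b}" "{a, b} - {b} = {a}" using assms by auto
  moreover have "{w \<in> {a, b}. w < a} = {}" "{w \<in> {a, b}. w < b} = {a}" using assms by auto
  then have "incidence_sign {a, b} a = (1 :: 'r)" "incidence_sign {a, b} b = (- 1 :: 'r)"
    by (simp_all only: incidence_sign_def) simp_all
  ultimately show ?thesis using assms by (simp add: boundary_coeff_def)
qed

lemma boundary_coeff_triangle: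
  assumes "a < b" "b < c"
  shows "boundary_coeff \<tau> {a, b, c} =
    of_bool (\<tau> = {b, c}) - of_bool (\<tau> = {a, c}) + (of_bool (\<tau> = {a, b}) :: 'r::comm_ring_1)"
proof -
  have "{a, b, c} - {a} = {b, c}" "{a, b, c} - {b} = {a, c}" "{a, b, c} - {c} = {a, b}"
    using assms by auto
  moreover have "{w \<in> {a, b, c}. w < a} = {}" "{w \<in> {a, b, c}. w < b} = {a}"
    "{w \<in> {a, b, c}. w < c} = {a, b}" using assms by auto
  then have "incidence_sign {a, b, c} a = (1 :: 'r)" "incidence_sign {a, b, c} b = (- 1 :: 'r)"
    "incidence_sign {a, b, c} c = (1 :: 'r)"
    using assms by (simp_all only: incidence_sign_def) simp_all
  ultimately show ?thesis using assms by (simp add: boundary_coeff_def)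
qed

lemma sum_boundary_coeff_triangle:
  fixes x :: "nat set \<Rightarrow> 'r::comm_ring_1"
  assumes "a < b" "b < c" "a \<in> {1..n}" "c \<in> {1..n}"
  shows "(\<Sum>e\<in>edges n. x e * boundary_coeff e {a, b, c}) = x {b, c} - x {a, c} + x {a, b}"
proof -
  have e: "{b, c} \<in> edges n" "{a, c} \<in> edges n" "{a, b} \<in> edges n"
    using assms by (auto simp: edge_in_edges)
  have d: "(\<Sum>e\<in>edges n. x e * of_bool (e = f)) = x f" if "f \<in> edges n" for f
    using that by (simp add: of_bool_def if_distrib[of "\<lambda>z. _ * z"] cong: if_cong)
  show ?thesis
    using assms by (simp add: boundary_coeff_triangle d e algebra_simps sum.distrib sum_subtractf)
qed

lemma sum_boundary_coeff_vertex:
  fixes x :: "nat set \<Rightarrow> 'r::comm_ring_1"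
  assumes v: "v \<in> {1..n}"
  shows "(\<Sum>e\<in>edges n. x e * boundary_coeff {v} e) = (\<Sum>u\<in>{1..n}. oriented x u v)"
proof -
  have "(\<Sum>e\<in>edges n. x e * boundary_coeff {v} e) = (\<Sum>e\<in>{e\<in>edges n. v \<in> e}. x e * boundary_coeff {v} e)"
  proof (rule sum.mono_neutral_right)
    show "\<forall>e\<in>edges n - {e \<in> edges n. v \<in> e}. x e * boundary_coeff {v} e = 0"
    proof
      fix e assume e: "e \<in> edges n - {e \<in> edges n. v \<in> e}"
      then obtain a b where "a < b" "e = {a, b}" by (blast elim: edgesE)
      with e show "x e * boundary_coeff {v} e = 0" by (simp add: boundary_coeff_pair)
    qed
  qed auto
  also have "{e\<in>edges n. v \<in> e} = (\<lambda>u. {u, v}) ` ({1..n} - {v})"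
  proof
    show "{e\<in>edges n. v \<in> e} \<subseteq> (\<lambda>u. {u, v}) ` ({1..n} - {v})"
    proof
      fix e assume "e \<in> {e\<in>edges n. v \<in> e}"
      then have "v \<in> e" "e \<in> edges n" by auto
      from this(2) obtain a b where "a < b" "e = {a, b}" "a \<in> {1..n}" "b \<in> {1..n}" by (rule edgesE)
      with \<open>v \<in> e\<close> show "e \<in> (\<lambda>u. {u, v}) ` ({1..n} - {v})" by (auto simp: insert_commute image_iff)
    qed
    show "(\<lambda>u. {u, v}) ` ({1..n} - {v}) \<subseteq> {e\<in>edges n. v \<in> e}"
      using v by (auto simp: edge_in_edges)
  qed
  also have "(\<Sum>e\<in>(\<lambda>u. {u, v}) ` ({1..n} - {v}). x e * boundary_coeff {v} e) =
      (\<Sum>u\<in>{1..n} - {v}. x {u, v} * boundary_coeff {v} {u, v})"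
    by (rule sum.reindex_cong[of "\<lambda>u. {u, v}"]) (auto simp: inj_on_def doubleton_eq_iff)
  also have "\<dots> = (\<Sum>u\<in>{1..n} - {v}. oriented x u v)"
  proof (rule sum.cong[OF refl])
    fix u assume u: "u \<in> {1..n} - {v}"
    show "x {u, v} * boundary_coeff {v} {u, v} = oriented x u v"
    proof (cases "u < v")
      case True then show ?thesis using u by (simp add: boundary_coeff_pair oriented_def)
    next
      case False
      then have "v < u" using u by auto
      then show ?thesis using boundary_coeff_pair[OF \<open>v < u\<close>, of "{v}", where 'r = 'r]
        by (simp add: oriented_def insert_commute)
    qed
  qed
  also have "\<dots> = (\<Sum>u\<in>{1..n}. oriented x u v)"
    by (rule sum.mono_neutral_left) auto
  finally show ?thesis .
qed

lemma boundary_boundary_coeff: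
  assumes "t \<in> triangles n"
  shows "(\<Sum>e\<in>edges n. boundary_coeff e t * boundary_coeff \<tau> e) = (0 :: 'r::comm_ring_1)"
proof -
  obtain a b c where t: "a < b" "b < c" "t = {a, b, c}" "a \<in> {1..n}" "b \<in> {1..n}" "c \<in> {1..n}"
    using assms by (rule trianglesE)
  have "(\<Sum>e\<in>edges n. boundary_coeff e t * boundary_coeff \<tau> e) =
      (\<Sum>e\<in>edges n. boundary_coeff \<tau> e * (boundary_coeff e {a, b, c} :: 'r))"
    by (simp add: t mult.commute)
  then show ?thesis
    using t by (simp add: sum_boundary_coeff_triangle boundary_coeff_pair)
qed

section \<open>Cycles of the complete complex and their basis of cone boundaries\<close>

lemma cycle_function_boundary_coeff:
  assumes "t \<in> triangles n"
  shows "cycle_function n (\<lambda>e. boundary_coeff e t :: 'r::comm_ring_1)"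
  unfolding cycle_function_def
proof
  fix v assume v: "v \<in> {1..n}"
  show "(\<Sum>u\<in>{1..n}. oriented (\<lambda>e. boundary_coeff e t :: 'r) u v) = 0"
    unfolding sum_boundary_coeff_vertex[OF v, symmetric] by (rule boundary_boundary_coeff[OF assms])
qed

lemma cycle_function_sum:
  fixes x :: "'i \<Rightarrow> nat set \<Rightarrow> 'r::comm_ring_1"
  assumes "\<And>i. i \<in> I \<Longrightarrow> cycle_function n (x i)"
  shows "cycle_function n (\<lambda>e. \<Sum>i\<in>I. x i e * c i)"
proof -
  have "oriented (\<lambda>e. \<Sum>i\<in>I. x i e * c i) u v = (\<Sum>i\<in>I. oriented (x i) u v * c i)" for u v
    by (simp add: oriented_def sum_negf)
  then have "(\<Sum>u\<in>{1..n}. oriented (\<lambda>e. \<Sum>i\<in>I. x i e * c i) u v) =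
      (\<Sum>i\<in>I. (\<Sum>u\<in>{1..n}. oriented (x i) u v) * c i)" for v
    by (simp add: sum_distrib_right) (rule sum.swap)
  then show ?thesis using assms by (simp add: cycle_function_def)
qed

lemma cycle_function_diff:
  assumes "cycle_function n x" "cycle_function n y"
  shows "cycle_function n (\<lambda>e. x e - y e)"
proof -
  have "oriented (\<lambda>e. x e - y e) u v = oriented x u v - oriented y u v" for u v
    by (simp add: oriented_def)
  then show ?thesis using assms by (simp add: cycle_function_def sum_subtractf)
qed

text \<open>If all edges avoiding vertex 1 carry zero, the cycle condition at a vertex b other than
  1 involves only the edge {1, b}.\<close>

lemma cycle_function_determined:
  fixes x :: "nat set \<Rightarrow> 'r::comm_ring_1"
  assumes x: "cycle_function n x" and z: "\<And>e. e \<in> reduced_edges n \<Longrightarrow> x e = 0"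
    and e: "e \<in> edges n"
  shows "x e = 0"
proof (cases "1 \<in> e")
  case True
  from e obtain a b where "a < b" "e = {a, b}" "a \<in> {1..n}" "b \<in> {1..n}" by (rule edgesE)
  with True have v: "b \<in> {1..n}" "1 < b" "e = {1, b}" by auto
  have "0 = (\<Sum>u\<in>{1..n}. oriented x u b)" using x v by (simp add: cycle_function_def)
  also have "\<dots> = (\<Sum>u\<in>{1}. oriented x u b)"
  proof (rule sum.mono_neutral_right)
    show "\<forall>u\<in>{1..n} - {1}. oriented x u b = 0"
    proof
      fix u assume "u \<in> {1..n} - {1}"
      then have "u = b \<or> {u, b} \<in> reduced_edges n" using v by (auto simp: edge_in_reduced_edges)
      then show "oriented x u b = 0" using z by (auto simp: oriented_def)
    qed
  qed (use v in auto)
  finally show ?thesis using v by (simp add: oriented_def)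
qed (use e z in \<open>simp add: reduced_edges_def\<close>)

text \<open>Vertex 1 is the smallest, so \<open>f\<close> occurs in the boundary of its cone with
  sign +1, and the two other edges contain 1. Cone boundaries are thus the dual basis to the reduced
  coordinates.\<close>

lemma boundary_coeff_cone:
  assumes "f \<in> reduced_edges n"
  shows "insert 1 f \<in> triangles n"
    and "e \<in> reduced_edges n \<Longrightarrow> boundary_coeff e (insert 1 f) = (of_bool (e = f) :: 'r::comm_ring_1)"
proof -
  obtain a b where f: "a < b" "f = {a, b}" "a \<in> {1..n}" "b \<in> {1..n}"
    using assms reduced_edges_subset by (blast elim: edgesE)
  moreover have "1 < a" using assms f by (auto simp: reduced_edges_def)
  ultimately show "insert 1 f \<in> triangles n" by (auto simp: triangle_in_triangles)
  show "boundary_coeff e (insert 1 f) = (of_bool (e = f) :: 'r::comm_ring_1)" if "e \<in> reduced_edges n"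
    using that f \<open>1 < a\<close> by (auto simp: boundary_coeff_triangle reduced_edges_def)
qed

text \<open>The difference of the two sides is a cycle that vanishes on the reduced edges.\<close>

lemma cycle_function_expansion:
  fixes x :: "nat set \<Rightarrow> 'r::comm_ring_1"
  assumes x: "cycle_function n x" and e: "e \<in> edges n"
  shows "x e = (\<Sum>f\<in>reduced_edges n. boundary_coeff e (insert 1 f) * x f)"
proof -
  let ?y = "\<lambda>e. \<Sum>f\<in>reduced_edges n. boundary_coeff e (insert 1 f) * x f"
  have "cycle_function n (\<lambda>e. x e - ?y e)"
    by (intro cycle_function_diff x cycle_function_sum cycle_function_boundary_coeff
        boundary_coeff_cone)
  moreover have "x f - ?y f = 0" if "f \<in> reduced_edges n" for f
    using that by (simp add: boundary_coeff_cone(2) of_bool_def if_distrib[of "\<lambda>z. z * _"]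
        cong: if_cong del: One_nat_def)
  ultimately have "x e - ?y e = 0" using e by (rule cycle_function_determined)
  then show ?thesis by simp
qed

section \<open>The order of the first homology group\<close>

abbreviation coeff :: "('a \<Rightarrow>\<^sub>0 int) \<Rightarrow> 'a \<Rightarrow> int" where
  "coeff \<equiv> Poly_Mapping.lookup"

abbreviation supp :: "('a \<Rightarrow>\<^sub>0 int) \<Rightarrow> 'a set" where
  "supp \<equiv> Poly_Mapping.keys"

section \<open>Integral chains in coordinates\<close>

lemma lookup_simplicial_boundary:
  assumes T: "finite T" "\<And>\<sigma>. \<sigma> \<in> T \<Longrightarrow> 2 \<le> card \<sigma>" and c: "supp c \<subseteq> T"
  shows "coeff (simplicial_boundary c) \<tau> =
    (\<Sum>\<sigma>\<in>T. coeff c \<sigma> * boundary_coeff \<tau> \<sigma>)"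
proof -
  have "coeff (simplicial_boundary c) \<tau> = (\<Sum>\<sigma>\<in>supp c.
      coeff c \<sigma> * (\<Sum>v | v \<in> \<sigma> \<and> \<sigma> \<noteq> {v}. incidence_sign \<sigma> v * coeff (frag_of (\<sigma> - {v})) \<tau>))"
    by (simp add: simplicial_boundary_def frag_extend_def lookup_sum)
  also have "\<dots> = (\<Sum>\<sigma>\<in>supp c. coeff c \<sigma> * boundary_coeff \<tau> \<sigma>)"
  proof (rule sum.cong[OF refl])
    fix \<sigma> assume "\<sigma> \<in> supp c"
    then have "2 \<le> card \<sigma>" using T c by blast
    then have "{v. v \<in> \<sigma> \<and> \<sigma> \<noteq> {v}} = \<sigma>" by auto
    then show "coeff c \<sigma> * (\<Sum>v | v \<in> \<sigma> \<and> \<sigma> \<noteq> {v}. incidence_sign \<sigma> v * coeff (frag_of (\<sigma> - {v})) \<tau>) =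
        coeff c \<sigma> * boundary_coeff \<tau> \<sigma>"
      by (auto simp: boundary_coeff_def lookup_single when_def intro!: sum.cong)
  qed
  also have "\<dots> = (\<Sum>\<sigma>\<in>T. coeff c \<sigma> * boundary_coeff \<tau> \<sigma>)"
    by (rule sum.mono_neutral_left) (use T c in \<open>auto simp: in_keys_iff\<close>)
  finally show ?thesis .
qed

lemma card_edges_ge: "e \<in> edges n \<Longrightarrow> 2 \<le> card e" by (simp add: edges_def)
lemma card_triangles_ge: "t \<in> triangles n \<Longrightarrow> 2 \<le> card t" by (simp add: triangles_def)

lemma lookup_boundary_edges:
  assumes "supp c \<subseteq> edges n"
  shows "coeff (simplicial_boundary c) \<tau> =
    (\<Sum>e\<in>edges n. coeff c e * boundary_coeff \<tau> e)"
  using assms by (intro lookup_simplicial_boundary) (auto intro: card_edges_ge)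

lemma lookup_boundary_triangles:
  assumes "U \<subseteq> triangles n" "supp c \<subseteq> U"
  shows "coeff (simplicial_boundary c) \<tau> =
    (\<Sum>\<sigma>\<in>U. coeff c \<sigma> * boundary_coeff \<tau> \<sigma>)"
  using assms by (intro lookup_simplicial_boundary) (auto intro: finite_subset card_triangles_ge)

lemma keys_boundary_triangles:
  assumes "U \<subseteq> triangles n" "supp c \<subseteq> U"
  shows "supp (simplicial_boundary c) \<subseteq> edges n"
proof
  fix e assume "e \<in> supp (simplicial_boundary c)"
  then have "(\<Sum>\<sigma>\<in>U. coeff c \<sigma> * boundary_coeff e \<sigma>) \<noteq> 0"
    using lookup_boundary_triangles[OF assms] by (simp add: in_keys_iff)
  then obtain t where "t \<in> U" "boundary_coeff e t \<noteq> (0::int)"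
    by (metis (no_types, lifting) mult_zero_right sum.neutral)
  moreover from this have "t \<in> triangles n" using assms(1) by blast
  then obtain a b c where "a < b" "b < c" "t = {a, b, c}" "a \<in> {1..n}" "b \<in> {1..n}" "c \<in> {1..n}"
    by (rule trianglesE)
  ultimately show "e \<in> edges n"
    by (auto simp: boundary_coeff_triangle of_bool_def edge_in_edges split: if_splits)
qed

lemma boundary_boundary_triangles:
  assumes "U \<subseteq> triangles n" "supp c \<subseteq> U"
  shows "simplicial_boundary (simplicial_boundary c) = 0"
proof (rule poly_mapping_eqI)
  fix \<tau>
  have "coeff (simplicial_boundary (simplicial_boundary c)) \<tau> =
      (\<Sum>e\<in>edges n. (\<Sum>t\<in>U. coeff c t * boundary_coeff e t) * boundary_coeff \<tau> e)"
    by (simp add: lookup_boundary_edges[OF keys_boundary_triangles[OF assms]]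
        lookup_boundary_triangles[OF assms])
  also have "\<dots> = (\<Sum>t\<in>U. coeff c t * (\<Sum>e\<in>edges n. boundary_coeff e t * boundary_coeff \<tau> e))"
    by (simp add: sum_distrib_right sum_distrib_left mult.assoc) (rule sum.swap)
  also have "\<dots> = 0" using assms(1) by (auto intro!: sum.neutral simp: boundary_boundary_coeff)
  finally show "coeff (simplicial_boundary (simplicial_boundary c)) \<tau> =
      coeff 0 \<tau>" by simp
qed

lemma cycle_function_lookup:
  assumes "supp c \<subseteq> edges n" "simplicial_boundary c = 0"
  shows "cycle_function n (coeff c)"
  unfolding cycle_function_def
proof
  fix v assume v: "v \<in> {1..n}"
  show "(\<Sum>u\<in>{1..n}. oriented (coeff c) u v) = 0"
    using lookup_boundary_edges[OF assms(1), of "{v}"] assms(2)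
    by (simp add: sum_boundary_coeff_vertex[OF v, symmetric] del: One_nat_def)
qed

lemma chain_with_coefficients:
  assumes "finite T"
  shows "\<exists>c. supp c \<subseteq> T \<and> (\<forall>t\<in>T. coeff c t = (d t :: int))"
proof -
  define c where "c = (\<Sum>t\<in>T. frag_cmul (d t) (frag_of t))"
  have l: "coeff c s = (if s \<in> T then d s else 0)" for s
    using assms by (simp add: c_def lookup_sum lookup_single when_def
        if_distrib[of "\<lambda>z. _ * z"] cong: if_cong)
  have "s \<in> T" if "s \<in> supp c" for s
    using that l[of s] by (simp add: in_keys_iff split: if_splits)
  then show ?thesis using l by (intro exI[of _ c]) auto
qed

lemma simplicial_boundary_diff:
  "simplicial_boundary (a - b) = simplicial_boundary a - simplicial_boundary b"
  by (simp add: simplicial_boundary_def frag_extend_diff)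

lemma simplicial_boundary_add:
  "simplicial_boundary (a + b) = simplicial_boundary a + simplicial_boundary b"
  by (simp add: simplicial_boundary_def frag_extend_add)

lemma keys_diff_subset: "supp a \<subseteq> T \<Longrightarrow> supp b \<subseteq> T \<Longrightarrow>
    supp (a - b :: 'a \<Rightarrow>\<^sub>0 int) \<subseteq> T"
  using keys_diff[of a b] by blast

lemma keys_add_subset: "supp a \<subseteq> T \<Longrightarrow> supp b \<subseteq> T \<Longrightarrow>
    supp (a + b :: 'a \<Rightarrow>\<^sub>0 int) \<subseteq> T"
  using keys_add[of a b] by blast

text \<open>Cycles are determined by their values off the star of vertex 1, which are arbitrary. So
  \<open>H\<^sub>1\<close> is the quotient of \<open>\<int>\<^sup>m\<close> by the lattice spanned by the reduced boundaries of
  the triangles.\<close>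

lemma homology_group_order:
  fixes S :: "nat set set" and n :: nat
  defines "U \<equiv> faces 2 S"
  defines "D \<equiv> det (matrix_of U (reduced_edges n) (\<lambda>t e. boundary_coeff e t :: int))"
  assumes edges: "faces 1 S = edges n" and U: "U \<subseteq> triangles n"
    and m: "card U = card (reduced_edges n)"
  shows "finite (carrier (simplicial_homology_group 1 S)) \<longleftrightarrow> D \<noteq> 0"
    and "D \<noteq> 0 \<Longrightarrow> Coset.order (simplicial_homology_group 1 S) = nat \<bar>D\<bar>"
proof -
  define m where "m = card (reduced_edges n)"
  define A where "A = matrix_of U (reduced_edges n) (\<lambda>t e. boundary_coeff e t :: int)"
  define Z where "Z = {c :: nat set \<Rightarrow>\<^sub>0 int. supp c \<subseteq> edges n \<and> simplicial_boundary c = 0}"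
  define B where "B = simplicial_boundary ` {c. supp c \<subseteq> U}"
  define \<phi> where "\<phi> c j = coeff c (enum (reduced_edges n) j)"
    for c :: "nat set \<Rightarrow>\<^sub>0 int" and j
  define coset where "coset c = (\<lambda>b. b + c) ` B" for c
  have A: "A \<in> carrier_mat m m" unfolding A_def m_def using m matrix_of_carrier by metis
  have finU: "finite U" by (rule finite_subset[OF U finite_triangles])
  have Zeq: "simplicial_cycles 1 S = Z"
    by (auto simp: simplicial_cycles_def simplicial_chain_group_def edges Z_def simp del: One_nat_def)
  have Beq: "simplicial_boundaries 1 S = B"
    by (auto simp: simplicial_boundaries_def simplicial_chain_group_def B_def U_def numeral_2_eq_2
        free_Abelian_group_def)
  have Z0: "0 \<in> Z" by (simp add: Z_def simplicial_boundary_def)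
  have Zdiff: "a - b \<in> Z" if "a \<in> Z" "b \<in> Z" for a b
    using that by (auto simp: Z_def simplicial_boundary_diff intro: keys_diff_subset[THEN subsetD])
  have Zadd: "a + b \<in> Z" if "a \<in> Z" "b \<in> Z" for a b
    using that by (auto simp: Z_def simplicial_boundary_add intro: keys_add_subset[THEN subsetD])
  have B0: "0 \<in> B" unfolding B_def by (rule image_eqI[of _ _ 0]) (auto simp: simplicial_boundary_def)
  have Bdiff: "a - b \<in> B" if ab: "a \<in> B" "b \<in> B" for a b
  proof -
    from ab obtain a' b' where "a = simplicial_boundary a'" "b = simplicial_boundary b'"
      "supp a' \<subseteq> U" "supp b' \<subseteq> U" by (auto simp: B_def)
    then show ?thesis unfolding B_def
      by (intro image_eqI[of _ _ "a' - b'"]) (auto simp: simplicial_boundary_diff intro: keys_diff_subset[THEN subsetD])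
  qed
  have Badd: "a + b \<in> B" if "a \<in> B" "b \<in> B" for a b
    using Bdiff[OF that(1) Bdiff[OF B0 that(2)]] by simp
  have BZ: "B \<subseteq> Z"
    using keys_boundary_triangles[OF U] boundary_boundary_triangles[OF U] by (auto simp: B_def Z_def)
  have car: "carrier (simplicial_homology_group 1 S) = coset ` Z"
  proof -
    have sub: "subgroup Z (simplicial_chain_group 1 S)"
      unfolding simplicial_chain_group_def edges
    proof (rule group.subgroupI[OF group_free_Abelian_group])
      show "Z \<subseteq> carrier (free_Abelian_group (edges n))" by (auto simp: Z_def)
      show "Z \<noteq> {}" using Z0 by blast
      show "inv\<^bsub>free_Abelian_group (edges n)\<^esub> a \<in> Z" if "a \<in> Z" for a
      proof -
        have "inv\<^bsub>free_Abelian_group (edges n)\<^esub> a = 0 - a"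
          using that by (subst inv_free_Abelian_group) (auto simp: Z_def)
        then show ?thesis using Zdiff[OF Z0 that] by simp
      qed
      show "a \<otimes>\<^bsub>free_Abelian_group (edges n)\<^esub> b \<in> Z" if "a \<in> Z" "b \<in> Z" for a b
        using Zadd[OF that] by simp
    qed
    then have "carrier (subgroup_generated (simplicial_chain_group 1 S) Z) = Z"
      by (rule subgroup.carrier_subgroup_generated_subgroup)
    then show ?thesis
      unfolding simplicial_homology_group_def Zeq Beq FactGroup_def RCOSETS_def r_coset_def
      by (auto simp: coset_def simplicial_chain_group_def)
  qed
  have coset_eq: "coset c = coset c' \<longleftrightarrow> c - c' \<in> B" for c c'
  proof
    assume "coset c = coset c'"
    then have "0 + c \<in> coset c'" using B0 by (auto simp: coset_def)
    then show "c - c' \<in> B" by (auto simp: coset_def)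
  next
    assume *: "c - c' \<in> B"
    then have "c' - c \<in> B" using Bdiff[OF B0 *] by simp
    have "b + c \<in> coset c'" if "b \<in> B" for b
      unfolding coset_def by (rule image_eqI[of _ _ "b + (c - c')"]) (use Badd that * in auto)
    moreover have "b + c' \<in> coset c" if "b \<in> B" for b
      unfolding coset_def by (rule image_eqI[of _ _ "b + (c' - c)"]) (use Badd that \<open>c' - c \<in> B\<close> in auto)
    ultimately show "coset c = coset c'" by (auto simp: coset_def)
  qed
  have lattice: "c - c' \<in> B \<longleftrightarrow> (\<lambda>j. \<phi> c j - \<phi> c' j) \<in> row_lattice m A" if c: "c \<in> Z" "c' \<in> Z" for c c'
  proof
    assume "c - c' \<in> B"
    then obtain d where d: "supp d \<subseteq> U" "c - c' = simplicial_boundary d" by (auto simp: B_def)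
    have "\<phi> c j - \<phi> c' j = (\<Sum>i<m. coeff d (enum U i) * A $$ (i, j))" if "j < m" for j
    proof -
      have "\<phi> c j - \<phi> c' j = coeff (c - c') (enum (reduced_edges n) j)"
        by (simp add: \<phi>_def lookup_minus)
      also have "\<dots> = (\<Sum>t\<in>U. coeff d t * boundary_coeff (enum (reduced_edges n) j) t)"
        unfolding d(2) by (rule lookup_boundary_triangles[OF U d(1)])
      also have "\<dots> = (\<Sum>i<m. coeff d (enum U i) * A $$ (i, j))"
        using that m by (subst sum_enum[OF finU, symmetric]) (simp add: A_def matrix_of_def m_def)
      finally show ?thesis .
    qed
    then show "(\<lambda>j. \<phi> c j - \<phi> c' j) \<in> row_lattice m A" by (auto simp: row_lattice_def)
  next
    assume "(\<lambda>j. \<phi> c j - \<phi> c' j) \<in> row_lattice m A"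
    then obtain d where d: "\<And>j. j < m \<Longrightarrow> \<phi> c j - \<phi> c' j = (\<Sum>i<m. d i * A $$ (i, j))"
      by (auto simp: row_lattice_def)
    obtain w where w: "supp w \<subseteq> U"
      "\<And>t. t \<in> U \<Longrightarrow> coeff w t = d (inv_into {..<card U} (enum U) t)"
      using chain_with_coefficients[OF finU, of "\<lambda>t. d (inv_into {..<card U} (enum U) t)"] by auto
    \<comment> \<open>\<open>w\<close> is chosen to match \<open>c - c'\<close> in the reduced
      coordinates, so this cycle vanishes off the star of 1 and is zero.\<close>
    let ?x = "c - c' - simplicial_boundary w"
    have "simplicial_boundary w \<in> B" using w(1) by (auto simp: B_def)
    then have xZ: "?x \<in> Z" using Zdiff c BZ by blast
    have "coeff ?x e = 0" if "e \<in> reduced_edges n" for e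
    proof -
      have "e \<in> enum (reduced_edges n) ` {..<m}"
        using that bij_betw_imp_surj_on[OF bij_betw_enum[OF finite_reduced_edges[of n]]]
        by (simp add: m_def)
      then obtain j where j: "j < m" "e = enum (reduced_edges n) j" by blast
      have inv: "inv_into {..<card U} (enum U) (enum U i) = i" if "i < card U" for i
        using bij_betw_enum[OF finU] that by (simp add: bij_betw_def)
      have "coeff (simplicial_boundary w) e =
          (\<Sum>i<card U. coeff w (enum U i) * boundary_coeff e (enum U i))"
        unfolding lookup_boundary_triangles[OF U w(1)] by (rule sum_enum[OF finU, symmetric])
      also have "\<dots> = (\<Sum>i<card U. d i * A $$ (i, j))"
        using j by (intro sum.cong refl)
          (simp add: w(2) enum_in[OF finU] inv A_def matrix_of_def m_def)
      also have "card U = m" by (simp add: m m_def)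
      finally show ?thesis using d[OF j(1)] j by (simp add: \<phi>_def lookup_minus)
    qed
    then have "coeff ?x e = 0" if "e \<in> edges n" for e
      using cycle_function_determined[OF cycle_function_lookup] xZ that by (auto simp: Z_def)
    moreover have "coeff ?x e = 0" if "e \<notin> edges n" for e
      using xZ that by (auto simp: Z_def in_keys_iff subset_iff)
    ultimately have "?x = 0" by (intro poly_mapping_eqI) auto
    then show "c - c' \<in> B" using w by (auto simp: B_def)
  qed
  have surj: "\<exists>c\<in>Z. \<forall>j<m. \<phi> c j = x j" for x
  proof -
    \<comment> \<open>The cone over an edge gets as coefficient the value prescribed at that edge;
      by duality the boundary has the prescribed reduced coordinates.\<close>
    let ?d = "\<lambda>t. x (inv_into {..<m} (enum (reduced_edges n)) (t - {1}))"
    obtain w where w: "supp w \<subseteq> insert 1 ` reduced_edges n"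
      "\<forall>t\<in>insert 1 ` reduced_edges n. coeff w t = ?d t"
      using chain_with_coefficients[OF finite_imageI[OF finite_reduced_edges], of "insert 1" n ?d] by blast
    have sub: "insert 1 ` reduced_edges n \<subseteq> triangles n" using boundary_coeff_cone(1) by blast
    have "\<phi> (simplicial_boundary w) j = x j" if j: "j < m" for j
    proof -
      let ?e = "enum (reduced_edges n) j"
      have e: "?e \<in> reduced_edges n" using enum_in[of "reduced_edges n" j] j by (simp add: m_def)
      have inj: "inj_on (insert 1) (reduced_edges n)"
        by (auto simp: inj_on_def reduced_edges_def insert_eq_iff)
      have "\<phi> (simplicial_boundary w) j =
          (\<Sum>f\<in>reduced_edges n. coeff w (insert 1 f) * boundary_coeff ?e (insert 1 f))"
        by (simp add: \<phi>_def lookup_boundary_triangles[OF sub w(1)] sum.reindex[OF inj] del: One_nat_def)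
      also have "\<dots> = (\<Sum>f\<in>reduced_edges n. if ?e = f then ?d (insert 1 f) else 0)"
        using w(2) by (intro sum.cong refl) (auto simp: boundary_coeff_cone(2) e simp del: One_nat_def)
      also have "\<dots> = ?d (insert 1 ?e)" using e by simp
      also have "insert 1 ?e - {1} = ?e" using e by (auto simp: reduced_edges_def)
      finally show ?thesis
        using bij_betw_enum[OF finite_reduced_edges[of n]] j by (simp add: bij_betw_def m_def)
    qed
    moreover have "simplicial_boundary w \<in> Z"
      using keys_boundary_triangles[OF sub w(1)] boundary_boundary_triangles[OF sub w(1)] by (simp add: Z_def)
    ultimately show ?thesis by blast
  qed
  have D: "D = det A" by (simp add: D_def A_def)
  have fin_order: "finite (coset ` Z) \<and> card (coset ` Z) = nat \<bar>D\<bar>" if "D \<noteq> 0"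
  proof -
    have "has_index m (row_lattice m A) (nat \<bar>D\<bar>)"
      unfolding D by (rule has_index_row_lattice[OF A]) (use that D in simp)
    then obtain R where R: "finite R" "card R = nat \<bar>D\<bar>"
      and ex1: "\<And>x. \<exists>!r. r \<in> R \<and> (\<lambda>j. x j - r j) \<in> row_lattice m A"
      by (auto simp: has_index_def)
    obtain z where z: "\<And>r. z r \<in> Z" "\<And>r j. j < m \<Longrightarrow> \<phi> (z r) j = r j"
      using surj by metis
    have eq: "coset c = coset (z r) \<longleftrightarrow> (\<lambda>j. \<phi> c j - r j) \<in> row_lattice m A" if "c \<in> Z" for c r
      using z that unfolding coset_eq lattice[OF that z(1)] by (auto simp: row_lattice_def)
    have "bij_betw (\<lambda>r. coset (z r)) R (coset ` Z)"
    proof (rule bij_betwI')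
      fix r r' assume r: "r \<in> R" "r' \<in> R"
      show "(coset (z r) = coset (z r')) = (r = r')"
      proof
        assume "coset (z r) = coset (z r')"
        then have "(\<lambda>j. \<phi> (z r) j - r' j) \<in> row_lattice m A" using eq[OF z(1)] by simp
        moreover have "(\<lambda>j. \<phi> (z r) j - r j) \<in> row_lattice m A" using eq[OF z(1)] by blast
        ultimately show "r = r'" using ex1 r by blast
      qed simp
    next
      fix y assume "y \<in> coset ` Z"
      then obtain c where c: "c \<in> Z" "y = coset c" by blast
      then show "\<exists>r\<in>R. y = coset (z r)" using ex1[of "\<phi> c"] eq[OF c(1)] by blast
    qed (use z in blast)
    then show ?thesis using R bij_betw_same_card bij_betw_finite by metis
  qed
  \<comment> \<open>Finitely many cosets would be represented by finitely many coordinate vectors,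
    contrary to \<open>row_lattice_singular\<close>.\<close>
  have inf: "infinite (coset ` Z)" if D0: "D = 0"
  proof
    assume "finite (coset ` Z)"
    then obtain C where C: "C \<subseteq> Z" "finite C" "coset ` Z = coset ` C"
      by (metis finite_subset_image order_refl)
    obtain x where x: "\<And>c. c \<in> C \<Longrightarrow> (\<lambda>j. x j - \<phi> c j) \<notin> row_lattice m A"
      using row_lattice_singular[OF A _ finite_imageI[OF C(2), of \<phi>]] D0 D by auto
    obtain z where z: "z \<in> Z" "\<And>j. j < m \<Longrightarrow> \<phi> z j = x j" using surj by metis
    then obtain c where c: "c \<in> C" "coset z = coset c" using C(3) by blast
    then have "(\<lambda>j. \<phi> z j - \<phi> c j) \<in> row_lattice m A" using lattice[OF z(1)] C(1) coset_eq by blast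
    then have "(\<lambda>j. x j - \<phi> c j) \<in> row_lattice m A" by (rule row_lattice_restrict) (simp add: z)
    with x[OF c(1)] show False by blast
  qed
  show "finite (carrier (simplicial_homology_group 1 S)) \<longleftrightarrow> D \<noteq> 0"
    unfolding car using fin_order inf by blast
  show "Coset.order (simplicial_homology_group 1 S) = nat \<bar>D\<bar>" if "D \<noteq> 0"
    unfolding Coset.order_def car using fin_order that by blast
qed

section \<open>Avoidance probabilities of a determinantal hypertree\<close>

text \<open>Adds the complete 1-skeleton. On hypertrees this inverts \<open>faces 2\<close>, so that
  sums over hypertrees become sums over sets of triangles.\<close>

definition graph_complex :: "nat \<Rightarrow> nat set set \<Rightarrow> nat set set" where
  "graph_complex n U = {\<sigma>. \<sigma> \<subseteq> {1..n} \<and> (card \<sigma> = 1 \<or> card \<sigma> = 2)} \<union> U"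

lemma finite_hypertrees: "finite (hypertrees n)"
proof (rule finite_subset)
  show "hypertrees n \<subseteq> Pow (Pow {1..n})"
    by (auto simp: hypertrees_def simplicial_complex_def)
qed simp

lemma faces_hypertree:
  assumes "S \<in> hypertrees n"
  shows "faces 1 S = edges n" "faces 2 S \<subseteq> triangles n"
    "card (faces 2 S) = card (reduced_edges n)" "S = graph_complex n (faces 2 S)"
proof -
  have sc: "simplicial_complex {1..n} S" and c3: "\<forall>\<sigma>\<in>S. card \<sigma> \<le> 3"
    and all: "\<forall>\<sigma>. \<sigma> \<subseteq> {1..n} \<and> (card \<sigma> = 1 \<or> card \<sigma> = 2) \<longrightarrow> \<sigma> \<in> S"
    and cd: "card (faces 2 S) = (n - 1) choose 2"
    using assms unfolding hypertrees_def mem_Collect_eq by blast+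
  have sub: "\<sigma> \<subseteq> {1..n}" "\<sigma> \<noteq> {}" "finite \<sigma>" "card \<sigma> \<le> 3" if "\<sigma> \<in> S" for \<sigma>
    using sc c3 that unfolding simplicial_complex_def by blast+
  have full: "\<sigma> \<in> S" if "\<sigma> \<subseteq> {1..n}" "card \<sigma> = 1 \<or> card \<sigma> = 2" for \<sigma>
    using all that by blast
  have "\<sigma> \<in> faces 1 S \<longleftrightarrow> \<sigma> \<in> edges n" for \<sigma>
    using sub(1)[of \<sigma>] full[of \<sigma>] by (auto simp: faces_def edges_def)
  then show "faces 1 S = edges n" by blast
  have "\<sigma> \<in> triangles n" if "\<sigma> \<in> faces 2 S" for \<sigma>
    using that sub(1)[of \<sigma>] by (simp add: faces_def triangles_def)
  then show "faces 2 S \<subseteq> triangles n" by blast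
  show "card (faces 2 S) = card (reduced_edges n)" using cd by (simp add: card_reduced_edges)
  show "S = graph_complex n (faces 2 S)"
  proof
    show "S \<subseteq> graph_complex n (faces 2 S)"
    proof
      fix \<sigma> assume s: "\<sigma> \<in> S"
      then have "card \<sigma> \<noteq> 0" using sub[OF s] by auto
      then have "card \<sigma> = 1 \<or> card \<sigma> = 2 \<or> card \<sigma> = 3" using sub(4)[OF s] by linarith
      then show "\<sigma> \<in> graph_complex n (faces 2 S)"
        using s sub(1)[OF s] by (auto simp: graph_complex_def faces_def)
    qed
    show "graph_complex n (faces 2 S) \<subseteq> S"
    proof
      fix \<sigma> assume "\<sigma> \<in> graph_complex n (faces 2 S)"
      then show "\<sigma> \<in> S" using full[of \<sigma>] by (auto simp: graph_complex_def faces_def)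
    qed
  qed
qed

lemma faces_graph_complex:
  assumes "U \<subseteq> triangles n"
  shows "faces 1 (graph_complex n U) = edges n" "faces 2 (graph_complex n U) = U"
proof -
  have U: "\<sigma> \<subseteq> {1..n}" "card \<sigma> = 3" if "\<sigma> \<in> U" for \<sigma>
    using assms that by (auto simp: triangles_def)
  have "\<sigma> \<in> faces 1 (graph_complex n U) \<longleftrightarrow> \<sigma> \<in> edges n" for \<sigma>
    using U[of \<sigma>] by (cases "\<sigma> \<in> U") (auto simp: faces_def graph_complex_def edges_def)
  then show "faces 1 (graph_complex n U) = edges n" by blast
  have "\<sigma> \<in> faces 2 (graph_complex n U) \<longleftrightarrow> \<sigma> \<in> U" for \<sigma>
    using U[of \<sigma>] by (cases "\<sigma> \<in> U") (auto simp: faces_def graph_complex_def)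
  then show "faces 2 (graph_complex n U) = U" by blast
qed

lemma simplicial_complex_graph_complex:
  assumes "U \<subseteq> triangles n"
  shows "simplicial_complex {1..n} (graph_complex n U)"
proof -
  have c: "\<sigma> \<subseteq> {1..n}" "card \<sigma> = 1 \<or> card \<sigma> = 2 \<or> card \<sigma> = 3"
    if "\<sigma> \<in> graph_complex n U" for \<sigma>
    using assms that unfolding graph_complex_def triangles_def by blast+
  have fin: "finite \<sigma>" "\<sigma> \<noteq> {}" if "\<sigma> \<in> graph_complex n U" for \<sigma>
    using c[OF that] finite_subset[of \<sigma> "{1..n}"] by auto
  have down: "\<tau> \<in> graph_complex n U"
    if s: "\<sigma> \<in> graph_complex n U" and t: "\<tau> \<subseteq> \<sigma>" "\<tau> \<noteq> {}" for \<sigma> \<tau>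
  proof (cases "\<tau> = \<sigma>")
    case False
    then have "card \<tau> < card \<sigma>" using t fin[OF s] by (intro psubset_card_mono) auto
    moreover have "card \<tau> \<noteq> 0" using t fin[OF s] finite_subset[of \<tau> \<sigma>] by simp
    ultimately have "card \<tau> = 1 \<or> card \<tau> = 2" using c(2)[OF s] by linarith
    moreover have "\<tau> \<subseteq> {1..n}" using t c(1)[OF s] by blast
    ultimately show ?thesis by (simp add: graph_complex_def)
  qed (use s in simp)
  have vert: "{v} \<in> graph_complex n U" if "v \<in> {1..n}" for v
    using that by (simp add: graph_complex_def)
  show ?thesis unfolding simplicial_complex_def
    by (intro conjI ballI allI impI; (elim conjE)?; fact c(1) fin vert down)
qed

section \<open>Weights of hypertrees as squared determinants\<close>

lemma det_boundary_real:
  assumes "U \<subseteq> triangles n" "card U = card (reduced_edges n)"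
  shows "det (matrix_of (reduced_edges n) U boundary_coeff) =
    real_of_int (det (matrix_of U (reduced_edges n) (\<lambda>t e. boundary_coeff e t)))"
proof -
  have int: "of_int (boundary_coeff \<tau> \<sigma>) = (boundary_coeff \<tau> \<sigma> :: real)" for \<tau> \<sigma>
    by (simp add: boundary_coeff_def incidence_sign_def if_distrib[of of_int] cong: if_cong)
  have "matrix_of (reduced_edges n) U boundary_coeff =
      map_mat real_of_int (matrix_of (reduced_edges n) U boundary_coeff)"
    by (rule eq_matI) (auto simp: matrix_of_def int)
  then have "det (matrix_of (reduced_edges n) U boundary_coeff) =
      real_of_int (det (matrix_of (reduced_edges n) U boundary_coeff))"
    by (simp add: of_int_hom.hom_det)
  also have "det (matrix_of (reduced_edges n) U boundary_coeff) =
      det (matrix_of U (reduced_edges n) (\<lambda>t e. boundary_coeff e t :: int))"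
    using det_transpose[of "matrix_of (reduced_edges n) U boundary_coeff :: int mat"]
      matrix_of_carrier[of "reduced_edges n" U boundary_coeff] assms(2)
    by (metis matrix_of_transpose)
  finally show ?thesis .
qed

lemma hypertree_order:
  assumes S: "S \<in> hypertrees n"
  shows "(real (Coset.order (simplicial_homology_group 1 S)))\<^sup>2 =
      (det (matrix_of (reduced_edges n) (faces 2 S) boundary_coeff))\<^sup>2"
    and "det (matrix_of (reduced_edges n) (faces 2 S) boundary_coeff) \<noteq> (0 :: real)"
proof -
  note f = faces_hypertree[OF S]
  have "finite (carrier (simplicial_homology_group 1 S))" using S by (simp add: hypertrees_def)
  then have "det (matrix_of (faces 2 S) (reduced_edges n) (\<lambda>t e. boundary_coeff e t :: int)) \<noteq> 0"
    using homology_group_order(1)[OF f(1-3)] by blast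
  with homology_group_order(2)[OF f(1-3) this] det_boundary_real[OF f(2,3)]
  show "(real (Coset.order (simplicial_homology_group 1 S)))\<^sup>2 =
      (det (matrix_of (reduced_edges n) (faces 2 S) boundary_coeff))\<^sup>2"
    and "det (matrix_of (reduced_edges n) (faces 2 S) boundary_coeff) \<noteq> (0 :: real)"
    by simp_all
qed

lemma graph_complex_hypertree:
  assumes U: "U \<subseteq> triangles n" "card U = card (reduced_edges n)"
    and d: "det (matrix_of (reduced_edges n) U boundary_coeff) \<noteq> (0 :: real)"
  shows "graph_complex n U \<in> hypertrees n"
proof -
  let ?S = "graph_complex n U"
  note f = faces_graph_complex[OF U(1)]
  have "det (matrix_of (faces 2 ?S) (reduced_edges n) (\<lambda>t e. boundary_coeff e t :: int)) \<noteq> 0"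
    using d unfolding f(2) det_boundary_real[OF U] by simp
  then have "finite (carrier (simplicial_homology_group 1 ?S))"
    using homology_group_order(1)[of ?S n] f U by metis
  moreover have "\<forall>\<sigma>\<in>?S. card \<sigma> \<le> 3" using U by (auto simp: graph_complex_def triangles_def)
  ultimately show ?thesis
    using simplicial_complex_graph_complex[OF U(1)] U(2) f(2)
    by (simp add: hypertrees_def card_reduced_edges) (simp add: graph_complex_def)
qed

definition reduced_det :: "nat \<Rightarrow> nat set set \<Rightarrow> real" where
  "reduced_det n G = det (matrix_of (reduced_edges n) (reduced_edges n)
    (\<lambda>e f. \<Sum>t\<in>G. boundary_coeff e t * boundary_coeff f t))"

text \<open>Cauchy-Binet expands the right-hand side over all sets of triangles in \<open>G\<close>
  of the right size. Those with nonzero determinant are exactly the triangle sets of hypertrees, and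
  the squares are the weights.\<close>

lemma sum_hypertrees:
  assumes G: "G \<subseteq> triangles n"
  shows "(\<Sum>S | S \<in> hypertrees n \<and> faces 2 S \<subseteq> G. (real (Coset.order (simplicial_homology_group 1 S)))\<^sup>2) =
    reduced_det n G"
proof -
  let ?F = "reduced_edges n"
  let ?D = "\<lambda>U. det (matrix_of ?F U boundary_coeff) :: real"
  have finG: "finite G" using G finite_triangles by (rule finite_subset)
  have "bij_betw (faces 2) {S \<in> hypertrees n. faces 2 S \<subseteq> G} {U. (U \<subseteq> G \<and> card U = card ?F) \<and> ?D U \<noteq> 0}"
  proof (rule bij_betw_byWitness[where f' = "graph_complex n"])
    show "\<forall>S\<in>{S \<in> hypertrees n. faces 2 S \<subseteq> G}. graph_complex n (faces 2 S) = S"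
      using faces_hypertree(4) by auto
    show "\<forall>U\<in>{U. (U \<subseteq> G \<and> card U = card ?F) \<and> ?D U \<noteq> 0}. faces 2 (graph_complex n U) = U"
      using faces_graph_complex(2) G by auto
    show "faces 2 ` {S \<in> hypertrees n. faces 2 S \<subseteq> G} \<subseteq> {U. (U \<subseteq> G \<and> card U = card ?F) \<and> ?D U \<noteq> 0}"
      using faces_hypertree(3) hypertree_order(2) by auto
    show "graph_complex n ` {U. (U \<subseteq> G \<and> card U = card ?F) \<and> ?D U \<noteq> 0} \<subseteq> {S \<in> hypertrees n. faces 2 S \<subseteq> G}"
      using graph_complex_hypertree faces_graph_complex(2) G by auto
  qed
  then have "(\<Sum>S\<in>{S \<in> hypertrees n. faces 2 S \<subseteq> G}. (?D (faces 2 S))\<^sup>2) =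
      (\<Sum>U\<in>{U. (U \<subseteq> G \<and> card U = card ?F) \<and> ?D U \<noteq> 0}. (?D U)\<^sup>2)"
    by (rule sum.reindex_bij_betw)
  also have "\<dots> = (\<Sum>U | U \<subseteq> G \<and> card U = card ?F. (?D U)\<^sup>2)"
    using finG by (intro sum.mono_neutral_left) auto
  also have "\<dots> = reduced_det n G"
    by (simp add: reduced_det_def Cauchy_Binet[OF finite_reduced_edges finG] power2_eq_square)
  finally have "(\<Sum>S\<in>{S \<in> hypertrees n. faces 2 S \<subseteq> G}. (?D (faces 2 S))\<^sup>2) =
      reduced_det n G" .
  moreover have "(\<Sum>S | S \<in> hypertrees n \<and> faces 2 S \<subseteq> G. (real (Coset.order (simplicial_homology_group 1 S)))\<^sup>2) =
      (\<Sum>S\<in>{S \<in> hypertrees n. faces 2 S \<subseteq> G}. (?D (faces 2 S))\<^sup>2)"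
    by (intro sum.cong refl hypertree_order(1)) auto
  ultimately show ?thesis by simp
qed

text \<open>Taking all triangles for \<open>G\<close> evaluates Kalai's constant, so that it never has to be
  computed: the weights of a probability distribution sum to 1.\<close>

lemma prob_faces_subset:
  assumes T: "determinantal_hypertree n T" and G: "G \<subseteq> triangles n"
  shows "measure_pmf.prob T {S. faces 2 S \<subseteq> G} * reduced_det n (triangles n) = reduced_det n G" "reduced_det n (triangles n) \<noteq> 0"
proof -
  have sup: "set_pmf T \<subseteq> hypertrees n"
    and pm: "\<And>S. S \<in> hypertrees n \<Longrightarrow> pmf T S =
        (real (Coset.order (simplicial_homology_group 1 S)))\<^sup>2 / real n ^ ((n - 2) choose 2)"
    using T by (auto simp: determinantal_hypertree_def)
  have prob: "measure_pmf.prob T {S. faces 2 S \<subseteq> H} = reduced_det n H / real n ^ ((n - 2) choose 2)"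
    if H: "H \<subseteq> triangles n" for H
  proof -
    have "measure_pmf.prob T {S. faces 2 S \<subseteq> H} = measure_pmf.prob T {S \<in> hypertrees n. faces 2 S \<subseteq> H}"
      using sup by (intro measure_pmf.finite_measure_eq_AE) (auto simp: AE_measure_pmf_iff)
    also have "\<dots> = (\<Sum>S | S \<in> hypertrees n \<and> faces 2 S \<subseteq> H. pmf T S)"
      by (rule measure_measure_pmf_finite) (simp add: finite_hypertrees)
    also have "\<dots> = (\<Sum>S | S \<in> hypertrees n \<and> faces 2 S \<subseteq> H.
        (real (Coset.order (simplicial_homology_group 1 S)))\<^sup>2) / real n ^ ((n - 2) choose 2)"
      by (simp add: pm sum_divide_distrib)
    finally show ?thesis unfolding sum_hypertrees[OF H] .
  qed
  have "measure_pmf.prob T {S. faces 2 S \<subseteq> triangles n} = measure_pmf.prob T UNIV"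
    using sup faces_hypertree(2) by (intro measure_pmf.finite_measure_eq_AE) (auto simp: AE_measure_pmf_iff)
  then have one: "reduced_det n (triangles n) / real n ^ ((n - 2) choose 2) = 1"
    using prob[OF order_refl] measure_pmf.prob_space[of T] by (simp only: space_measure_pmf)
  then show "reduced_det n (triangles n) \<noteq> 0" by (metis div_0 zero_neq_one)
  have K: "real n ^ ((n - 2) choose 2) \<noteq> 0" using one by (metis div_by_0 zero_neq_one)
  then have "reduced_det n (triangles n) = real n ^ ((n - 2) choose 2)" using one by simp
  with K show "measure_pmf.prob T {S. faces 2 S \<subseteq> G} * reduced_det n (triangles n) = reduced_det n G"
    unfolding prob[OF G] by (metis nonzero_eq_divide_eq)
qed

section \<open>The up-Laplacian of the complete complex\<close>

lemma triangle_boundary_oriented: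
  fixes x :: "nat set \<Rightarrow> 'r::comm_ring_1"
  assumes "a < b" "a \<in> {1..n}" "b \<in> {1..n}" "w \<in> {1..n}" "w \<noteq> a" "w \<noteq> b"
  shows "boundary_coeff {a, b} {a, b, w} * (\<Sum>e\<in>edges n. x e * boundary_coeff e {a, b, w}) =
    oriented x a b + oriented x b w + oriented x w a"
    and "boundary_coeff {a, b} {a, b, w} * boundary_coeff {a, b} {a, b, w} = (1 :: 'r)"
proof -
  consider "w < a" | "a < w" "w < b" | "b < w" using assms by linarith
  then show "boundary_coeff {a, b} {a, b, w} * (\<Sum>e\<in>edges n. x e * boundary_coeff e {a, b, w}) =
      oriented x a b + oriented x b w + oriented x w a"
  proof cases
    case 1
    then have t: "{a, b, w} = {w, a, b}" by auto
    show ?thesis unfolding t using 1 assms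
      by (subst sum_boundary_coeff_triangle) (auto simp: boundary_coeff_triangle oriented_def insert_commute[of b w] doubleton_eq_iff)
  next
    case 2
    then have t: "{a, b, w} = {a, w, b}" by auto
    show ?thesis unfolding t using 2 assms
      by (subst sum_boundary_coeff_triangle) (auto simp: boundary_coeff_triangle oriented_def insert_commute[of b w]
          insert_commute[of w a] doubleton_eq_iff)
  next
    case 3
    then show ?thesis using assms
      by (subst sum_boundary_coeff_triangle) (auto simp: boundary_coeff_triangle oriented_def insert_commute[of w a] doubleton_eq_iff)
  qed
  consider "w < a" | "a < w" "w < b" | "b < w" using assms by linarith
  then show "boundary_coeff {a, b} {a, b, w} * boundary_coeff {a, b} {a, b, w} = (1 :: 'r)"
  proof cases
    case 1
    then have t: "{a, b, w} = {w, a, b}" by auto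
    show ?thesis unfolding t using 1 assms by (simp add: boundary_coeff_triangle doubleton_eq_iff)
  next
    case 2
    then have t: "{a, b, w} = {a, w, b}" by auto
    show ?thesis unfolding t using 2 assms by (simp add: boundary_coeff_triangle doubleton_eq_iff)
  next
    case 3
    then show ?thesis using assms by (simp add: boundary_coeff_triangle doubleton_eq_iff)
  qed
qed

lemma boundary_coeff_eq_0:
  assumes "t \<in> triangles n" "\<not> e \<subseteq> t"
  shows "boundary_coeff e t = 0"
  using assms(2) by (auto simp: boundary_coeff_def intro!: sum.neutral)

lemma triangles_containing:
  assumes "a \<noteq> b" "a \<in> {1..n}" "b \<in> {1..n}"
  shows "bij_betw (\<lambda>w. {a, b, w}) ({1..n} - {a, b}) {t \<in> triangles n. {a, b} \<subseteq> t}"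
proof (rule bij_betwI')
  fix t assume t: "t \<in> {t \<in> triangles n. {a, b} \<subseteq> t}"
  then have sub: "{a, b} \<subseteq> t" "t \<subseteq> {1..n}" "card t = 3" by (auto simp: triangles_def)
  then have "card (t - {a, b}) = 1" using assms by (subst card_Diff_subset) auto
  then obtain w where w: "t - {a, b} = {w}" by (rule card_1_singletonE)
  then have "w \<in> t - {a, b}" by simp
  moreover from this have "t = {a, b, w}" using sub w by blast
  ultimately show "\<exists>w\<in>{1..n} - {a, b}. t = {a, b, w}" using sub by blast
qed (use assms in \<open>auto simp: triangle_in_triangles\<close>)

text \<open>The triangles through {a, b} with apex w contribute x(a,b) + x(b,w) + x(w,a). The
  degenerate apexes a and b contribute zero and can be added; over all w the last two terms then
  cancel by the cycle condition at b and at a.\<close>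

lemma up_laplacian_cycle:
  fixes x :: "nat set \<Rightarrow> 'r::comm_ring_1"
  assumes x: "cycle_function n x" and e: "e \<in> edges n"
  shows "(\<Sum>t\<in>triangles n. boundary_coeff e t * (\<Sum>e'\<in>edges n. x e' * boundary_coeff e' t)) = of_nat n * x e"
proof -
  obtain a b where ab: "a < b" "e = {a, b}" "a \<in> {1..n}" "b \<in> {1..n}" using e by (rule edgesE)
  let ?g = "\<lambda>t. boundary_coeff e t * (\<Sum>e'\<in>edges n. x e' * boundary_coeff e' t)"
  have "(\<Sum>t\<in>triangles n. ?g t) = (\<Sum>t\<in>{t \<in> triangles n. {a, b} \<subseteq> t}. ?g t)"
    using ab by (intro sum.mono_neutral_right) (auto simp: boundary_coeff_eq_0)
  also have "\<dots> = (\<Sum>w\<in>{1..n} - {a, b}. ?g {a, b, w})"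
    using ab by (subst sum.reindex_bij_betw[OF triangles_containing, symmetric]) auto
  also have "\<dots> = (\<Sum>w\<in>{1..n} - {a, b}. oriented x a b + oriented x b w + oriented x w a)"
  proof (rule sum.cong[OF refl])
    fix w assume "w \<in> {1..n} - {a, b}"
    then show "?g {a, b, w} = oriented x a b + oriented x b w + oriented x w a"
      unfolding ab(2) by (intro triangle_boundary_oriented(1)) (use ab in simp_all)
  qed
  also have "\<dots> = (\<Sum>w\<in>{1..n}. oriented x a b + oriented x b w + oriented x w a)"
    by (rule sum.mono_neutral_left) (auto simp: oriented_swap[of x b a])
  also have "\<dots> = of_nat n * oriented x a b - (\<Sum>w\<in>{1..n}. oriented x w b) + (\<Sum>w\<in>{1..n}. oriented x w a)"
    by (subst oriented_swap[of x b]) (simp add: sum.distrib sum_subtractf)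
  finally show ?thesis using x ab by (simp add: cycle_function_def oriented_def)
qed

text \<open>Up to the factor n, the inverse of the reduced up-Laplacian \<open>A\<close> is the Gram
  matrix \<open>R\<close> of the cone boundaries. So the reduced matrix for the complement of
  \<open>B\<close> is \<open>A\<close> times some \<open>W\<close> that is 1 minus a product through
  all edges; exchanging the two factors of that product moves the determinant from reduced edges to
  all edges.\<close>

lemma det_reduced_ratio:
  assumes n: "n > 0" and B: "B \<subseteq> triangles n"
  shows "reduced_det n (triangles n - B) = reduced_det n (triangles n) *
    det (matrix_of (edges n) (edges n) (\<lambda>e f. of_bool (e = f) - (\<Sum>t\<in>B. boundary_coeff e t * boundary_coeff f t) / real n))"
proof -
  let ?F = "reduced_edges n" and ?E = "edges n" and ?T = "triangles n"
  let ?b = "boundary_coeff :: nat set \<Rightarrow> nat set \<Rightarrow> real"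
  \<comment> \<open>Extends reduced coordinates to the cycle that has them.\<close>
  define \<iota> where "\<iota> e f = ?b e (insert 1 f)" for e f
  define A where "A f g = (\<Sum>t\<in>?T. ?b f t * ?b g t)" for f g
  define R where "R g k = (\<Sum>e\<in>?E. \<iota> e g * \<iota> e k)" for g k
  define W where "W f g = of_bool (f = g) - (\<Sum>e\<in>?E. \<iota> e f / n * (\<Sum>t\<in>B. ?b e t * ?b g t))" for f g
  have finB: "finite B" using B finite_triangles by (rule finite_subset)
  have exp: "(\<Sum>f\<in>?F. \<iota> e f * ?b f t) = ?b e t" if "e \<in> ?E" "t \<in> ?T" for e t
    unfolding \<iota>_def
    by (rule cycle_function_expansion[OF cycle_function_boundary_coeff[OF that(2)] that(1), symmetric])
  have inv: "(\<Sum>g\<in>?F. A f g * R g k) = real n * of_bool (f = k)"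
    if f: "f \<in> ?F" and k: "k \<in> ?F" for f k
  proof -
    have "(\<Sum>g\<in>?F. A f g * R g k) =
        (\<Sum>g\<in>?F. \<Sum>t\<in>?T. \<Sum>e\<in>?E. ?b f t * (\<iota> e k * (\<iota> e g * ?b g t)))"
      unfolding A_def R_def sum_product by (simp add: mult_ac)
    also have "\<dots> = (\<Sum>t\<in>?T. \<Sum>g\<in>?F. \<Sum>e\<in>?E. ?b f t * (\<iota> e k * (\<iota> e g * ?b g t)))" by (rule sum.swap)
    also have "\<dots> = (\<Sum>t\<in>?T. \<Sum>e\<in>?E. \<Sum>g\<in>?F. ?b f t * (\<iota> e k * (\<iota> e g * ?b g t)))"
      by (intro sum.cong refl sum.swap)
    also have "\<dots> = (\<Sum>t\<in>?T. ?b f t * (\<Sum>e\<in>?E. \<iota> e k * ?b e t))"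
      by (simp add: sum_distrib_left[symmetric] exp)
    also have "\<dots> = real n * \<iota> f k"
      unfolding \<iota>_def using f k reduced_edges_subset
      by (intro up_laplacian_cycle cycle_function_boundary_coeff boundary_coeff_cone) auto
    finally show ?thesis using f k by (simp add: \<iota>_def boundary_coeff_cone(2) del: One_nat_def)
  qed
  have AW: "(\<Sum>g\<in>?F. A f g * W g h) = (\<Sum>t\<in>?T - B. ?b f t * ?b h t)" if f: "f \<in> ?F" and h: "h \<in> ?F" for f h
  proof -
    \<comment> \<open>Expanding one boundary coefficient in reduced coordinates by
      \<open>exp\<close> makes \<open>R\<close> visible, which is what \<open>A\<close> cancels
      against.\<close>
    have W: "W g h = of_bool (g = h) - (\<Sum>t\<in>B. \<Sum>k\<in>?F. R g k / n * (?b k t * ?b h t))" for g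
    proof -
      have "(\<Sum>e\<in>?E. \<iota> e g / n * (\<Sum>t\<in>B. ?b e t * ?b h t)) =
          (\<Sum>e\<in>?E. \<Sum>t\<in>B. \<Sum>k\<in>?F. \<iota> e g * \<iota> e k / n * (?b k t * ?b h t))"
      proof (intro sum.cong refl)
        fix e assume e: "e \<in> ?E"
        have "\<iota> e g / n * (?b e t * ?b h t) = (\<Sum>k\<in>?F. \<iota> e g * \<iota> e k / n * (?b k t * ?b h t))" if "t \<in> B" for t
        proof -
          have "t \<in> ?T" using that B by blast
          show ?thesis
            by (subst exp[OF e \<open>t \<in> ?T\<close>, symmetric]) (simp add: sum_distrib_left sum_distrib_right mult_ac)
        qed
        then show "\<iota> e g / n * (\<Sum>t\<in>B. ?b e t * ?b h t) = (\<Sum>t\<in>B. \<Sum>k\<in>?F. \<iota> e g * \<iota> e k / n * (?b k t * ?b h t))"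
          by (simp add: sum_distrib_left)
      qed
      also have "\<dots> = (\<Sum>t\<in>B. \<Sum>e\<in>?E. \<Sum>k\<in>?F. \<iota> e g * \<iota> e k / n * (?b k t * ?b h t))" by (rule sum.swap)
      also have "\<dots> = (\<Sum>t\<in>B. \<Sum>k\<in>?F. \<Sum>e\<in>?E. \<iota> e g * \<iota> e k / n * (?b k t * ?b h t))"
        by (intro sum.cong refl sum.swap)
      finally show ?thesis by (simp add: W_def R_def sum_distrib_right sum_divide_distrib)
    qed
    have "(\<Sum>g\<in>?F. A f g * W g h) = A f h -
        (\<Sum>g\<in>?F. \<Sum>t\<in>B. \<Sum>k\<in>?F. A f g * (R g k / n * (?b k t * ?b h t)))"
      using h by (simp add: W right_diff_distrib sum_subtractf sum_distrib_left of_bool_def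
          if_distrib[of "\<lambda>z. _ * z"] cong: if_cong)
    also have "(\<Sum>g\<in>?F. \<Sum>t\<in>B. \<Sum>k\<in>?F. A f g * (R g k / n * (?b k t * ?b h t))) =
        (\<Sum>t\<in>B. \<Sum>g\<in>?F. \<Sum>k\<in>?F. A f g * (R g k / n * (?b k t * ?b h t)))" by (rule sum.swap)
    also have "\<dots> = (\<Sum>t\<in>B. \<Sum>k\<in>?F. \<Sum>g\<in>?F. A f g * (R g k / n * (?b k t * ?b h t)))"
      by (intro sum.cong refl sum.swap)
    also have "\<dots> = (\<Sum>t\<in>B. \<Sum>k\<in>?F. (\<Sum>g\<in>?F. A f g * R g k) / n * (?b k t * ?b h t))"
      by (simp add: sum_distrib_right sum_divide_distrib mult.assoc)
    also have "\<dots> = (\<Sum>t\<in>B. \<Sum>k\<in>?F. if f = k then ?b k t * ?b h t else 0)"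
      using n f by (intro sum.cong refl) (simp add: inv)
    also have "\<dots> = (\<Sum>t\<in>B. ?b f t * ?b h t)" using f by simp
    also have "A f h - (\<Sum>t\<in>B. ?b f t * ?b h t) = (\<Sum>t\<in>?T - B. ?b f t * ?b h t)"
      unfolding A_def using B by (simp add: sum_diff)
    finally show ?thesis .
  qed
  have "reduced_det n (?T - B) = det (matrix_of ?F ?F (\<lambda>f h. \<Sum>g\<in>?F. A f g * W g h))"
    unfolding reduced_det_def by (rule arg_cong[of _ _ det], rule matrix_of_cong) (simp_all add: AW)
  also have "\<dots> = reduced_det n ?T * det (matrix_of ?F ?F W)"
    by (subst det_matrix_of_mult) (simp_all add: reduced_det_def A_def[abs_def])
  also have "det (matrix_of ?F ?F W) = det (matrix_of ?E ?E
      (\<lambda>e e'. of_bool (e = e') - (\<Sum>f\<in>?F. (\<Sum>t\<in>B. ?b e t * ?b f t) * (\<iota> e' f / n))))"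
    unfolding W_def by (rule det_matrix_of_one_minus_commute) simp_all
  also have "matrix_of ?E ?E (\<lambda>e e'. of_bool (e = e') - (\<Sum>f\<in>?F. (\<Sum>t\<in>B. ?b e t * ?b f t) * (\<iota> e' f / n))) =
      matrix_of ?E ?E (\<lambda>e e'. of_bool (e = e') - (\<Sum>t\<in>B. ?b e t * ?b e' t) / n)"
  proof (rule matrix_of_cong)
    fix e e' assume "e \<in> ?E" and e': "e' \<in> ?E"
    have "(\<Sum>f\<in>?F. (\<Sum>t\<in>B. ?b e t * ?b f t) * (\<iota> e' f / n)) =
        (\<Sum>f\<in>?F. \<Sum>t\<in>B. ?b e t * (\<iota> e' f * ?b f t) / n)"
      by (simp add: sum_distrib_left sum_distrib_right sum_divide_distrib mult_ac)
    also have "\<dots> = (\<Sum>t\<in>B. \<Sum>f\<in>?F. ?b e t * (\<iota> e' f * ?b f t) / n)" by (rule sum.swap)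
    also have "\<dots> = (\<Sum>t\<in>B. ?b e t * (\<Sum>f\<in>?F. \<iota> e' f * ?b f t) / n)"
      by (simp add: sum_distrib_left sum_divide_distrib)
    also have "\<dots> = (\<Sum>t\<in>B. ?b e t * ?b e' t) / n"
      using B e' by (auto simp: exp sum_divide_distrib intro!: sum.cong)
    finally show "of_bool (e = e') - (\<Sum>f\<in>?F. (\<Sum>t\<in>B. ?b e t * ?b f t) * (\<iota> e' f / n)) =
        of_bool (e = e') - (\<Sum>t\<in>B. ?b e t * ?b e' t) / n" by simp
  qed simp_all
  finally show ?thesis .
qed

text \<open>Its determinant equals that of 1 - K restricted to \<open>B\<close>, with K =
  \<partial>^T \<partial> / n the kernel of the determinantal measure on triangles. In the edge
  version the index set does not change with \<open>B\<close>.\<close>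

definition avoidance_matrix :: "nat \<Rightarrow> nat set set \<Rightarrow> nat set \<Rightarrow> nat set \<Rightarrow> real" where
  "avoidance_matrix n B e f = of_bool (e = f) - (\<Sum>t\<in>B. boundary_coeff e t * boundary_coeff f t) / real n"

theorem prob_avoid:
  assumes T: "determinantal_hypertree n T" and n: "n > 0" and B: "B \<subseteq> triangles n"
  shows "measure_pmf.prob T {S. faces 2 S \<inter> B = {}} =
    det (matrix_of (edges n) (edges n) (avoidance_matrix n B))"
proof -
  have "measure_pmf.prob T {S. faces 2 S \<inter> B = {}} = measure_pmf.prob T {S. faces 2 S \<subseteq> triangles n - B}"
    using T faces_hypertree(2)
    by (intro measure_pmf.finite_measure_eq_AE) (auto simp: AE_measure_pmf_iff determinantal_hypertree_def)
  then show ?thesis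
    using prob_faces_subset[OF T, of "triangles n - B"] det_reduced_ratio[OF n B]
    unfolding avoidance_matrix_def[abs_def] by (simp add: mult.commute)
qed

lemma avoidance_matrix_sym: "avoidance_matrix n B e f = avoidance_matrix n B f e"
  by (auto simp: avoidance_matrix_def mult.commute)

lemma avoidance_form:
  shows "(\<Sum>e\<in>edges n. \<Sum>f\<in>edges n. avoidance_matrix n B e f * x e * x f) =
    (\<Sum>e\<in>edges n. (x e)\<^sup>2) - (\<Sum>t\<in>B. (\<Sum>e\<in>edges n. x e * boundary_coeff e t)\<^sup>2) / real n"
proof -
  let ?E = "edges n"
  have "(\<Sum>e\<in>?E. \<Sum>f\<in>?E. avoidance_matrix n B e f * x e * x f) =
      (\<Sum>e\<in>?E. \<Sum>f\<in>?E. (if e = f then x e * x f else 0)) -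
      (\<Sum>e\<in>?E. \<Sum>f\<in>?E. \<Sum>t\<in>B. (x e * boundary_coeff e t) * (x f * boundary_coeff f t)) / n"
  proof -
    have "avoidance_matrix n B e f * x e * x f = (if e = f then x e * x f else 0) -
        (\<Sum>t\<in>B. (x e * boundary_coeff e t) * (x f * boundary_coeff f t)) / n" for e f
    proof -
      have "(\<Sum>t\<in>B. (x e * boundary_coeff e t) * (x f * boundary_coeff f t)) =
          (\<Sum>t\<in>B. boundary_coeff e t * boundary_coeff f t) * (x e * x f)"
        unfolding sum_distrib_right by (intro sum.cong refl) simp
      then show ?thesis by (simp add: avoidance_matrix_def left_diff_distrib)
    qed
    then show ?thesis by (simp add: sum_subtractf sum_divide_distrib)
  qed
  also have "(\<Sum>e\<in>?E. \<Sum>f\<in>?E. (if e = f then x e * x f else 0)) = (\<Sum>e\<in>?E. (x e)\<^sup>2)"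
    by (simp add: power2_eq_square)
  also have "(\<Sum>e\<in>?E. \<Sum>f\<in>?E. \<Sum>t\<in>B. (x e * boundary_coeff e t) * (x f * boundary_coeff f t)) =
      (\<Sum>e\<in>?E. \<Sum>t\<in>B. \<Sum>f\<in>?E. (x e * boundary_coeff e t) * (x f * boundary_coeff f t))"
    by (intro sum.cong refl sum.swap)
  also have "\<dots> = (\<Sum>t\<in>B. \<Sum>e\<in>?E. \<Sum>f\<in>?E. (x e * boundary_coeff e t) * (x f * boundary_coeff f t))"
    by (rule sum.swap)
  also have "\<dots> = (\<Sum>t\<in>B. (\<Sum>e\<in>?E. x e * boundary_coeff e t)\<^sup>2)"
    by (simp only: power2_eq_square sum_product)
  finally show ?thesis .
qed

text \<open>Let L be the up-Laplacian. L x is a cycle for every x, so L L = n L, and the squared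
  norm of n x - L x is n times the difference of the two sides. No eigenvectors are
  required.\<close>

lemma up_laplacian_le:
  fixes x :: "nat set \<Rightarrow> real"
  shows "(\<Sum>t\<in>triangles n. (\<Sum>e\<in>edges n. x e * boundary_coeff e t)\<^sup>2) \<le> n * (\<Sum>e\<in>edges n. (x e)\<^sup>2)"
proof (cases "n = 0")
  case True
  then have "triangles n = {}" by (auto simp: triangles_def)
  then show ?thesis by (simp add: True)
next
  case False
  let ?E = "edges n" and ?T = "triangles n"
  let ?b = "boundary_coeff :: nat set \<Rightarrow> nat set \<Rightarrow> real"
  define d where "d z t = (\<Sum>e\<in>?E. z e * ?b e t)" for z :: "nat set \<Rightarrow> real" and t
  define y where "y e = (\<Sum>t\<in>?T. ?b e t * d x t)" for e
  define q where "q = (\<Sum>t\<in>?T. (d x t)\<^sup>2)"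
  have inner: "(\<Sum>e\<in>?E. z e * y e) = (\<Sum>t\<in>?T. d x t * d z t)" for z
  proof -
    have "(\<Sum>e\<in>?E. z e * y e) = (\<Sum>e\<in>?E. \<Sum>t\<in>?T. d x t * (z e * ?b e t))"
      by (simp add: y_def sum_distrib_left mult_ac)
    also have "\<dots> = (\<Sum>t\<in>?T. \<Sum>e\<in>?E. d x t * (z e * ?b e t))" by (rule sum.swap)
    finally show ?thesis by (simp add: d_def sum_distrib_left)
  qed
  have "cycle_function n y" unfolding y_def
    by (intro cycle_function_sum cycle_function_boundary_coeff)
  then have Ly: "(\<Sum>t\<in>?T. ?b e t * d y t) = n * y e" if "e \<in> ?E" for e
    using up_laplacian_cycle[OF _ that] by (simp add: d_def)
  have xy: "(\<Sum>e\<in>?E. x e * y e) = q" by (simp add: inner q_def power2_eq_square)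
  have "(\<Sum>e\<in>?E. y e * y e) = (\<Sum>t\<in>?T. d x t * d y t)" by (rule inner)
  also have "\<dots> = (\<Sum>t\<in>?T. \<Sum>e\<in>?E. x e * (?b e t * d y t))"
    unfolding d_def[of x] sum_distrib_right by (simp add: mult_ac)
  also have "\<dots> = (\<Sum>e\<in>?E. \<Sum>t\<in>?T. x e * (?b e t * d y t))" by (rule sum.swap)
  also have "\<dots> = (\<Sum>e\<in>?E. x e * (n * y e))"
    by (simp add: sum_distrib_left[symmetric] Ly)
  also have "\<dots> = n * q" by (simp add: xy[symmetric] sum_distrib_left mult_ac)
  finally have yy: "(\<Sum>e\<in>?E. y e * y e) = n * q" .
  have "0 \<le> (\<Sum>e\<in>?E. (n * x e - y e)\<^sup>2)" by (simp add: sum_nonneg)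
  also have "\<dots> = (\<Sum>e\<in>?E. n * n * (x e)\<^sup>2 - 2 * n * (x e * y e) + y e * y e)"
    by (intro sum.cong refl) (simp add: power2_eq_square algebra_simps)
  also have "\<dots> = n * n * (\<Sum>e\<in>?E. (x e)\<^sup>2) - 2 * n * q + n * q"
    by (simp add: sum.distrib sum_subtractf sum_distrib_left[symmetric] xy yy)
  finally have "n * q \<le> n * (n * (\<Sum>e\<in>?E. (x e)\<^sup>2))" by (simp add: mult_ac)
  then have "q \<le> n * (\<Sum>e\<in>?E. (x e)\<^sup>2)" using False by simp
  then show ?thesis by (simp add: q_def d_def)
qed

lemma avoidance_form_nonneg:
  assumes "n > 0" "B \<subseteq> triangles n"
  shows "0 \<le> (\<Sum>e\<in>edges n. \<Sum>f\<in>edges n. avoidance_matrix n B e f * x e * x f)"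
proof -
  have "(\<Sum>t\<in>B. (\<Sum>e\<in>edges n. x e * boundary_coeff e t)\<^sup>2) \<le>
      (\<Sum>t\<in>triangles n. (\<Sum>e\<in>edges n. x e * boundary_coeff e t)\<^sup>2)"
    using assms by (intro sum_mono2) auto
  also have "\<dots> \<le> n * (\<Sum>e\<in>edges n. (x e)\<^sup>2)" by (rule up_laplacian_le)
  finally show ?thesis using assms(1) unfolding avoidance_form by (simp add: divide_le_eq mult.commute)
qed

lemma avoidance_diag:
  assumes B: "B \<subseteq> triangles n" and e: "e \<in> edges n"
  shows "avoidance_matrix n B e e = 1 - real (card {t \<in> B. e \<subseteq> t}) / real n"
proof -
  have finB: "finite B" using B finite_triangles by (rule finite_subset)
  have "(\<Sum>t\<in>B. boundary_coeff e t * boundary_coeff e t) = (\<Sum>t\<in>B. of_bool (e \<subseteq> t) :: real)"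
  proof (rule sum.cong[OF refl])
    fix t assume t: "t \<in> B"
    show "boundary_coeff e t * boundary_coeff e t = (of_bool (e \<subseteq> t) :: real)"
    proof (cases "e \<subseteq> t")
      case True
      obtain a b where ab: "a < b" "e = {a, b}" "a \<in> {1..n}" "b \<in> {1..n}" using e by (rule edgesE)
      have "t \<in> {t \<in> triangles n. {a, b} \<subseteq> t}" using True t B ab by blast
      also have "{t \<in> triangles n. {a, b} \<subseteq> t} = (\<lambda>w. {a, b, w}) ` ({1..n} - {a, b})"
        using ab by (intro bij_betw_imp_surj_on[OF triangles_containing, symmetric]) auto
      finally obtain w where "w \<in> {1..n} - {a, b}" "t = {a, b, w}" by (rule imageE)
      then show ?thesis using triangle_boundary_oriented(2)[of a b n w] ab True by simp
    next
      case False
      then show ?thesis using boundary_coeff_eq_0[of t n e] t B by auto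
    qed
  qed
  also have "\<dots> = real (card {t \<in> B. e \<subseteq> t})"
    using finB by (simp add: of_bool_def sum.If_cases Int_def)
  finally show ?thesis by (simp add: avoidance_matrix_def)
qed

text \<open>Hadamard's inequality; the diagonal entries outside \<open>D\<close> are at most 1.\<close>

lemma det_avoidance_le:
  assumes n: "n > 0" and B: "B \<subseteq> triangles n" and D: "D \<subseteq> edges n"
    and deg: "\<And>e. e \<in> D \<Longrightarrow> n \<le> card {t \<in> B. e \<subseteq> t} + k"
  shows "det (matrix_of (edges n) (edges n) (avoidance_matrix n B)) \<le> (k / n) ^ card D"
proof -
  let ?M = "avoidance_matrix n B"
  have nonneg: "0 \<le> ?M e e" if "e \<in> edges n" for e
  proof -
    have "(\<Sum>f\<in>edges n. \<Sum>g\<in>edges n. ?M f g * (if f = e then 1 else 0) * (if g = e then 1 else 0)) =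
        (\<Sum>f\<in>edges n. if f = e then ?M f e else 0)"
      by (intro sum.cong refl) (use that in \<open>simp add: if_distrib[of "\<lambda>z. _ * z"] cong: if_cong\<close>)
    then show ?thesis using avoidance_form_nonneg[OF n B, of "\<lambda>f. if f = e then 1 else 0"] that by simp
  qed
  have "det (matrix_of (edges n) (edges n) ?M) \<le> (\<Prod>e\<in>edges n. ?M e e)"
    by (rule Hadamard_inequality) (auto intro: avoidance_matrix_sym avoidance_form_nonneg[OF n B])
  also have "\<dots> = (\<Prod>e\<in>D. ?M e e) * (\<Prod>e\<in>edges n - D. ?M e e)"
    using D by (simp add: prod.subset_diff mult.commute)
  also have "\<dots> \<le> (\<Prod>e\<in>D. real k / n) * (\<Prod>e\<in>edges n - D. 1)"
  proof (intro mult_mono prod_mono conjI)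
    fix e assume e: "e \<in> D"
    then have "real n \<le> real (card {t \<in> B. e \<subseteq> t}) + real k" using deg[OF e] by linarith
    then show "?M e e \<le> real k / n"
      using n D e by (subst avoidance_diag[OF B]) (auto simp: divide_simps)
  next
    fix e assume "e \<in> edges n - D"
    then show "?M e e \<le> 1" by (simp add: avoidance_diag[OF B])
  qed (use nonneg D in \<open>auto intro!: prod_nonneg\<close>)
  finally show ?thesis by simp
qed

section \<open>Graphs as cochains\<close>

definition odd_triangles :: "nat \<Rightarrow> nat set set \<Rightarrow> nat set set" where
  "odd_triangles n E = {t \<in> triangles n. odd (card {v \<in> t. t - {v} \<in> E})}"

lemma odd_triangles_subset: "odd_triangles n E \<subseteq> triangles n"
  by (auto simp: odd_triangles_def)

lemma of_nat_bit_eq_0: "(of_nat k :: bit) = 0 \<longleftrightarrow> even k"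
  by (induction k) auto

text \<open>Modulo 2 the incidence signs disappear, and the coboundary at a triangle is the parity
  of its number of graph edges.\<close>

lemma cocycle_iff_odd_triangles:
  assumes S: "S \<in> hypertrees n" and E: "E \<subseteq> edges n"
  shows "(indicator E :: nat set \<Rightarrow> bit) \<in> cocycles 1 S \<longleftrightarrow> faces 2 S \<inter> odd_triangles n E = {}"
proof -
  have f1: "faces 1 S = edges n" and f2: "faces 2 S \<subseteq> triangles n" using faces_hypertree[OF S] by auto
  have "(indicator E :: nat set \<Rightarrow> bit) \<in> cochains 1 S"
    unfolding cochains_def f1 using E by (auto simp: indicator_def)
  moreover have "(\<Sum>v\<in>t. incidence_sign t v * indicator E (t - {v}) :: bit) = 0 \<longleftrightarrow>
      t \<notin> odd_triangles n E" if t: "t \<in> faces 2 S" for t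
  proof -
    have fin: "finite t" using t f2 by (auto simp: triangles_def intro: finite_subset)
    have "(\<Sum>v\<in>t. incidence_sign t v * indicator E (t - {v}) :: bit) = (\<Sum>v\<in>t. of_bool (t - {v} \<in> E))"
      by (intro sum.cong refl) (simp add: incidence_sign_def indicator_def)
    also have "\<dots> = of_nat (card {v \<in> t. t - {v} \<in> E})"
      using fin by (simp add: of_bool_def sum.If_cases Int_def)
    finally show ?thesis using t f2 by (auto simp: of_nat_bit_eq_0 odd_triangles_def)
  qed
  ultimately show ?thesis
    by (auto simp: cocycles_def coboundary_def fun_eq_iff numeral_2_eq_2)
qed

lemma triangle_in_odd_triangles:
  assumes "{a, b} \<in> E" "a \<noteq> b" "w \<noteq> a" "w \<noteq> b" "a \<in> {1..n}" "b \<in> {1..n}" "w \<in> {1..n}"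
  shows "{a, b, w} \<in> odd_triangles n E \<longleftrightarrow> ({a, w} \<in> E \<longleftrightarrow> {b, w} \<in> E)"
proof -
  have "{a, b, w} - {a} = {b, w}" "{a, b, w} - {b} = {a, w}" "{a, b, w} - {w} = {a, b}"
    using assms by auto
  moreover have "{v \<in> {a, b, w}. P v} =
      (if P a then {a} else {}) \<union> (if P b then {b} else {}) \<union> (if P w then {w} else {})" for P
    by auto
  ultimately have "card {v \<in> {a, b, w}. {a, b, w} - {v} \<in> E} =
      of_bool ({b, w} \<in> E) + of_bool ({a, w} \<in> E) + 1"
    using assms by simp
  then show ?thesis using assms by (simp add: odd_triangles_def triangle_in_triangles)
qed

text \<open>The apexes to exclude are the two endpoints of \<open>e\<close> and at most one further
  neighbour of each, hence 4.\<close>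

lemma card_odd_triangles_containing:
  assumes E: "E \<subseteq> edges n" and e: "e \<in> E"
    and deg: "\<And>v. card {w. {v, w} \<in> E} \<le> 2"
  shows "n \<le> card {t \<in> odd_triangles n E. e \<subseteq> t} + 4"
proof -
  obtain a b where ab: "a < b" "e = {a, b}" "a \<in> {1..n}" "b \<in> {1..n}"
    using e E by (blast elim: edgesE)
  define N where "N v = {w. {v, w} \<in> E}" for v
  have finN: "finite (N v)" for v
    by (rule finite_subset[of _ "{1..n}"]) (use E in \<open>auto simp: N_def edge_in_edges dest!: subsetD\<close>)
  have "card (N a - {b}) \<le> 1" "card (N b - {a}) \<le> 1"
    using deg[of a] deg[of b] e ab finN by (auto simp: N_def insert_commute)
  let ?W = "{1..n} - ({a, b} \<union> (N a - {b}) \<union> (N b - {a}))"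
  have "card ({a, b} \<union> (N a - {b}) \<union> (N b - {a})) \<le> card {a, b} + card (N a - {b}) + card (N b - {a})"
    by (meson card_Un_le le_trans add_le_mono1)
  also have "\<dots> \<le> 4" using \<open>card (N a - {b}) \<le> 1\<close> \<open>card (N b - {a}) \<le> 1\<close> ab by simp
  finally have "card ?W + 4 \<ge> n"
    using diff_card_le_card_Diff[of "{a, b} \<union> (N a - {b}) \<union> (N b - {a})" "{1..n}"] finN by simp
  moreover have "card ?W \<le> card {t \<in> odd_triangles n E. e \<subseteq> t}"
  proof (rule card_inj_on_le[of "\<lambda>w. {a, b, w}"])
    show "inj_on (\<lambda>w. {a, b, w}) ?W" by (auto simp: inj_on_def)
    show "(\<lambda>w. {a, b, w}) ` ?W \<subseteq> {t \<in> odd_triangles n E. e \<subseteq> t}"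
      using ab e by (auto simp: triangle_in_odd_triangles N_def)
    show "finite {t \<in> odd_triangles n E. e \<subseteq> t}"
      using odd_triangles_subset[of n E] finite_subset[OF _ finite_triangles] by auto
  qed
  ultimately show ?thesis by linarith
qed

section \<open>Disjoint unions of 5-cycles\<close>

text \<open>A single index k addresses all cycles at once: cycle \<open>k div 5\<close>, position
  \<open>k mod 5\<close>. Sums over all cycles become one sum, and rotation is a bijection of
  \<open>{..<5 * h}\<close>.\<close>

definition nxt :: "nat \<Rightarrow> nat" where
  "nxt k = 5 * (k div 5) + Suc (k mod 5) mod 5"

definition prv :: "nat \<Rightarrow> nat" where
  "prv k = 5 * (k div 5) + (k mod 5 + 4) mod 5"

lemma mod5_cases:
  fixes k :: nat
  obtains j :: nat where "k = 5 * j" | j where "k = 5 * j + 1" | j where "k = 5 * j + 2"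
    | j where "k = 5 * j + 3" | j where "k = 5 * j + 4"
proof -
  have k: "k = 5 * (k div 5) + k mod 5" by simp
  have "k mod 5 < 5" by simp
  then consider "k mod 5 = 0" | "k mod 5 = 1" | "k mod 5 = 2" | "k mod 5 = 3" | "k mod 5 = 4"
    by linarith
  then show thesis using k that by cases (metis add_0_right)+
qed

lemma nxt_simps:
  "nxt (5 * j) = 5 * j + 1" "nxt (5 * j + 1) = 5 * j + 2" "nxt (5 * j + 2) = 5 * j + 3"
  "nxt (5 * j + 3) = 5 * j + 4" "nxt (5 * j + 4) = 5 * j"
proof -
  have d: "(5 * j + i) div 5 = j" "(5 * j + i) mod 5 = i" if "i < 5" for i using that by auto
  show "nxt (5 * j) = 5 * j + 1" "nxt (5 * j + 1) = 5 * j + 2" "nxt (5 * j + 2) = 5 * j + 3"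
    "nxt (5 * j + 3) = 5 * j + 4" "nxt (5 * j + 4) = 5 * j"
    using d[of 0] d[of 1] d[of 2] d[of 3] d[of 4] unfolding nxt_def by simp_all
qed

lemma prv_simps:
  "prv (5 * j) = 5 * j + 4" "prv (5 * j + 1) = 5 * j" "prv (5 * j + 2) = 5 * j + 1"
  "prv (5 * j + 3) = 5 * j + 2" "prv (5 * j + 4) = 5 * j + 3"
proof -
  have d: "(5 * j + i) div 5 = j" "(5 * j + i) mod 5 = i" if "i < 5" for i using that by auto
  show "prv (5 * j) = 5 * j + 4" "prv (5 * j + 1) = 5 * j" "prv (5 * j + 2) = 5 * j + 1"
    "prv (5 * j + 3) = 5 * j + 2" "prv (5 * j + 4) = 5 * j + 3"
    using d[of 0] d[of 1] d[of 2] d[of 3] d[of 4] unfolding prv_def by simp_all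
qed

lemmas cycle_simps = nxt_simps prv_simps nxt_simps[unfolded One_nat_def] prv_simps[unfolded One_nat_def]

lemma prv_nxt [simp]: "prv (nxt k) = k"
  by (rule mod5_cases[of k]) (simp_all only: cycle_simps)

lemma nxt_prv [simp]: "nxt (prv k) = k"
  by (rule mod5_cases[of k]) (simp_all only: cycle_simps)

lemma nxt_neq: "nxt k \<noteq> k" "nxt (nxt k) \<noteq> k" "prv k \<noteq> k" "prv k \<noteq> nxt k" "prv k \<noteq> nxt (nxt k)"
    "nxt (nxt k) \<noteq> nxt k"
  by (rule mod5_cases[of k]; simp only: cycle_simps; simp)+

lemma nxt_less: "nxt k < 5 * h \<longleftrightarrow> k < 5 * h"
  by (rule mod5_cases[of k]; simp only: cycle_simps; presburger)

lemma prv_less: "prv k < 5 * h \<longleftrightarrow> k < 5 * h"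
  using nxt_less[of "prv k" h] by simp

lemma bij_betw_nxt: "bij_betw nxt {..<5 * h} {..<5 * h}"
  by (rule bij_betw_byWitness[where f' = prv]) (auto simp: nxt_less prv_less)

lemma sum_blocks_of_5:
  fixes g :: "nat \<Rightarrow> 'a::comm_monoid_add"
  shows "(\<Sum>k<5 * h. g k) = (\<Sum>j<h. g (5 * j) + g (5 * j + 1) + g (5 * j + 2) + g (5 * j + 3) + g (5 * j + 4))"
proof (induction h)
  case (Suc h)
  have "{..<5 * Suc h} = {..<5 * h} \<union> {5 * h, 5 * h + 1, 5 * h + 2, 5 * h + 3, 5 * h + 4}" by auto
  then have "(\<Sum>k<5 * Suc h. g k) = (\<Sum>k<5 * h. g k) + (\<Sum>k\<in>{5 * h, 5 * h + 1, 5 * h + 2, 5 * h + 3, 5 * h + 4}. g k)"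
    by (simp only:) (rule sum.union_disjoint, auto)
  then show ?case using Suc by (simp add: add.assoc)
qed simp

text \<open>This is where the odd length of the cycles enters: the alternating sum of
  \<open>a + b, b + c, c + d, d + e, e + a\<close> is \<open>2 a\<close>, so that \<open>-1\<close> is not an eigenvalue of the
  cyclic shift.\<close>

lemma five_cycle_gap:
  fixes a b c d e :: real
  shows "(e - a)\<^sup>2 + (a - b)\<^sup>2 + (b - c)\<^sup>2 + (c - d)\<^sup>2 + (d - e)\<^sup>2 \<le>
    96 / 25 * (a\<^sup>2 + b\<^sup>2 + c\<^sup>2 + d\<^sup>2 + e\<^sup>2)"
proof -
  have alt: "(p - q + r - s + t)\<^sup>2 \<le> 5 * (p\<^sup>2 + q\<^sup>2 + r\<^sup>2 + s\<^sup>2 + t\<^sup>2)" for p q r s t :: real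
  proof -
    \<comment> \<open>Lagrange's identity for (p, q, r, s, t) and the alternating vector (1, -1, 1,
      -1, 1).\<close>
    have "0 \<le> (p + q)\<^sup>2 + (p - r)\<^sup>2 + (p + s)\<^sup>2 + (p - t)\<^sup>2 + (q + r)\<^sup>2 + (q - s)\<^sup>2 + (q + t)\<^sup>2
        + (r + s)\<^sup>2 + (r - t)\<^sup>2 + (s + t)\<^sup>2" by simp
    also have "\<dots> = 5 * (p\<^sup>2 + q\<^sup>2 + r\<^sup>2 + s\<^sup>2 + t\<^sup>2) - (p - q + r - s + t)\<^sup>2"
      by (simp add: power2_eq_square algebra_simps)
    finally show ?thesis by simp
  qed
  define Q where "Q = (a + b)\<^sup>2 + (b + c)\<^sup>2 + (c + d)\<^sup>2 + (d + e)\<^sup>2 + (e + a)\<^sup>2"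
  have "4 * a\<^sup>2 \<le> 5 * Q" using alt[of "a + b" "b + c" "c + d" "d + e" "e + a"]
    by (simp add: Q_def power2_eq_square algebra_simps)
  moreover have "4 * b\<^sup>2 \<le> 5 * Q" using alt[of "b + c" "c + d" "d + e" "e + a" "a + b"]
    by (simp add: Q_def power2_eq_square algebra_simps)
  moreover have "4 * c\<^sup>2 \<le> 5 * Q" using alt[of "c + d" "d + e" "e + a" "a + b" "b + c"]
    by (simp add: Q_def power2_eq_square algebra_simps)
  moreover have "4 * d\<^sup>2 \<le> 5 * Q" using alt[of "d + e" "e + a" "a + b" "b + c" "c + d"]
    by (simp add: Q_def power2_eq_square algebra_simps)
  moreover have "4 * e\<^sup>2 \<le> 5 * Q" using alt[of "e + a" "a + b" "b + c" "c + d" "d + e"]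
    by (simp add: Q_def power2_eq_square algebra_simps)
  \<comment> \<open>The smallest eigenvalue of \<open>Q\<close> is 2 - 2 cos (pi / 5), about 0.38.
    The cruder 4/25 from adding the five bounds is enough, and 96/25 is 4 - 4/25.\<close>
  ultimately have "4 * (a\<^sup>2 + b\<^sup>2 + c\<^sup>2 + d\<^sup>2 + e\<^sup>2) \<le> 25 * Q" by argo
  moreover have "(e - a)\<^sup>2 + (a - b)\<^sup>2 + (b - c)\<^sup>2 + (c - d)\<^sup>2 + (d - e)\<^sup>2 =
      4 * (a\<^sup>2 + b\<^sup>2 + c\<^sup>2 + d\<^sup>2 + e\<^sup>2) - Q"
    by (simp add: Q_def power2_eq_square algebra_simps)
  ultimately show ?thesis by linarith
qed

lemma sum_cyclic_differences_le:
  fixes t :: "nat \<Rightarrow> real"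
  shows "(\<Sum>k<5 * h. (t (prv k) - t k)\<^sup>2) \<le> 96 / 25 * (\<Sum>k<5 * h. (t k)\<^sup>2)"
  unfolding sum_blocks_of_5 prv_simps sum_distrib_left
  by (rule sum_mono) (rule five_cycle_gap)

lemma triangle_square_oriented:
  fixes x :: "nat set \<Rightarrow> real"
  assumes "a \<noteq> b" "w \<noteq> a" "w \<noteq> b" "a \<in> {1..n}" "b \<in> {1..n}" "w \<in> {1..n}"
  shows "(\<Sum>e\<in>edges n. x e * boundary_coeff e {a, b, w})\<^sup>2 =
    (oriented x a b + oriented x b w - oriented x a w)\<^sup>2"
proof -
  have *: "(\<Sum>e\<in>edges n. x e * boundary_coeff e {a, b, w})\<^sup>2 =
      (oriented x a b + oriented x b w - oriented x a w)\<^sup>2"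
    if "a < b" "w \<noteq> a" "w \<noteq> b" "a \<in> {1..n}" "b \<in> {1..n}" "w \<in> {1..n}" for a b
  proof -
    let ?c = "boundary_coeff {a, b} {a, b, w} :: real"
    let ?d = "\<Sum>e\<in>edges n. x e * boundary_coeff e {a, b, w}"
    have "?c * ?c = 1" by (rule triangle_boundary_oriented(2)) (use that in auto)
    then have "?d\<^sup>2 = (?c * ?c) * ?d\<^sup>2" by simp
    also have "\<dots> = (?c * ?d)\<^sup>2" by (simp add: power2_eq_square)
    also have "?c * ?d = oriented x a b + oriented x b w - oriented x a w"
      using triangle_boundary_oriented(1)[of a b n w x] that oriented_swap[of x w a] by simp
    finally show ?thesis .
  qed
  show ?thesis
  proof (cases "a < b")
    case True then show ?thesis using *[of a b] assms by blast
  next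
    case False
    then have "b < a" using assms by simp
    have "(oriented x a b + oriented x b w - oriented x a w)\<^sup>2 =
        (- (oriented x a b + oriented x b w - oriented x a w))\<^sup>2" by (simp only: power2_minus)
    also have "\<dots> = (oriented x b a + oriented x a w - oriented x b w)\<^sup>2"
      unfolding oriented_swap[of x a b] by (simp add: algebra_simps)
    finally show ?thesis using *[OF \<open>b < a\<close>] assms by (simp add: insert_commute)
  qed
qed

section \<open>A labelled family of disjoint 5-cycles and its odd triangles\<close>

locale five_cycle_system =
  fixes n h :: nat and v :: "nat \<Rightarrow> nat"
  assumes inj_v: "inj_on v {..<5 * h}" and range_v: "v ` {..<5 * h} \<subseteq> {1..n}"
begin

definition edge :: "nat \<Rightarrow> nat set" where "edge k = {v k, v (nxt k)}"

definition E :: "nat set set" where "E = edge ` {..<5 * h}"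

lemma v_eq: "k < 5 * h \<Longrightarrow> l < 5 * h \<Longrightarrow> v k = v l \<longleftrightarrow> k = l"
  using inj_v by (auto simp: inj_on_def)

lemma v_in: "k < 5 * h \<Longrightarrow> v k \<in> {1..n}"
  using range_v by blast

lemma edge_inj: "k < 5 * h \<Longrightarrow> l < 5 * h \<Longrightarrow> edge k = edge l \<longleftrightarrow> k = l"
  using nxt_neq(2)[of l] by (auto simp: edge_def doubleton_eq_iff v_eq nxt_less)

lemma card_E: "card E = 5 * h"
  unfolding E_def by (subst card_image) (auto simp: inj_on_def edge_inj)

lemma E_subset: "E \<subseteq> edges n"
  unfolding E_def
proof (rule image_subsetI)
  fix k assume "k \<in> {..<5 * h}"
  then have "k < 5 * h" "nxt k < 5 * h" by (simp_all add: nxt_less)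
  then show "edge k \<in> edges n"
    unfolding edge_def edge_in_edges using v_in nxt_neq(1)[of k] by (simp add: v_eq)
qed

lemma finite_E: "finite E" by (simp add: E_def)

lemma adjacent_iff:
  assumes k: "k < 5 * h"
  shows "{v k, w} \<in> E \<longleftrightarrow> w = v (nxt k) \<or> w = v (prv k)"
proof
  assume "{v k, w} \<in> E"
  then obtain l where l: "l < 5 * h" "{v k, w} = {v l, v (nxt l)}" by (auto simp: E_def edge_def)
  then have "v k = v l \<and> w = v (nxt l) \<or> v k = v (nxt l) \<and> w = v l" by (auto simp: doubleton_eq_iff)
  then show "w = v (nxt k) \<or> w = v (prv k)" using k l(1) by (auto simp: v_eq nxt_less)
next
  assume "w = v (nxt k) \<or> w = v (prv k)"
  then show "{v k, w} \<in> E"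
  proof
    assume "w = v (nxt k)" then show ?thesis using k by (auto simp: E_def edge_def)
  next
    assume "w = v (prv k)"
    then have "{v k, w} = edge (prv k)" by (auto simp: edge_def)
    then show ?thesis using k by (auto simp: E_def prv_less)
  qed
qed

lemma degree_le: "card {w. {u, w} \<in> E} \<le> 2"
proof (cases "\<exists>k<5 * h. u = v k")
  case True
  then obtain k where k: "k < 5 * h" "u = v k" by blast
  then have "{w. {u, w} \<in> E} = {v (nxt k), v (prv k)}" by (auto simp: adjacent_iff)
  then show ?thesis by (simp add: card_insert_if)
next
  case False
  then have "{w. {u, w} \<in> E} = {}"
    by (auto simp: E_def edge_def doubleton_eq_iff nxt_less)
  then show ?thesis by simp
qed

text \<open>The apexes of the odd triangles over \<open>edge k\<close>: an endpoint gives no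
  triangle, and the outer neighbours \<open>v (prv k)\<close> and \<open>v (nxt (nxt k))\<close>
  would contribute a second graph edge.\<close>

definition W :: "nat \<Rightarrow> nat set" where
  "W k = {1..n} - {v k, v (nxt k), v (prv k), v (nxt (nxt k))}"

text \<open>The vertices joined to \<open>v k\<close> by an edge off the graph; for k below
  \<open>5 * h\<close> this is the union of \<open>W k\<close> and \<open>W (prv k)\<close>.\<close>

definition Y :: "nat \<Rightarrow> nat set" where
  "Y k = {1..n} - {v k, v (nxt k), v (prv k)}"

lemma card_W:
  assumes "k < 5 * h"
  shows "card (W k) + 4 = n"
proof -
  have "card {v k, v (nxt k), v (prv k), v (nxt (nxt k))} = 4"
    using assms nxt_neq[of k] nxt_neq[of "nxt k"] by (simp add: v_eq nxt_less prv_less)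
  moreover have "{v k, v (nxt k), v (prv k), v (nxt (nxt k))} \<subseteq> {1..n}"
    using assms v_in by (simp add: nxt_less prv_less)
  ultimately show ?thesis unfolding W_def
    using card_mono[of "{1..n}" "{v k, v (nxt k), v (prv k), v (nxt (nxt k))}"]
    by (subst card_Diff_subset) auto
qed

lemma W_subset_Y: "W k \<subseteq> Y k" "k < 5 * h \<Longrightarrow> W (prv k) \<subseteq> Y k"
  by (auto simp: W_def Y_def)

text \<open>A 5-cycle contains no triangle, so an odd triangle has exactly one graph edge, which
  determines both \<open>k\<close> and the apex.\<close>

lemma bij_betw_odd_triangles:
  "bij_betw (\<lambda>(k, w). {v k, v (nxt k), w}) (SIGMA k:{..<5 * h}. W k) (odd_triangles n E)"
proof -
  have W: "v k \<noteq> v (nxt k)" "w \<noteq> v k" "w \<noteq> v (nxt k)" "v k \<in> {1..n}" "v (nxt k) \<in> {1..n}" "w \<in> {1..n}"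
    "{v k, v (nxt k)} \<in> E" "{v k, w} \<notin> E" "{v (nxt k), w} \<notin> E"
    if "k < 5 * h" "w \<in> W k" for k w
  proof -
    have l: "nxt k < 5 * h" using that by (simp add: nxt_less)
    show "v k \<noteq> v (nxt k)" using that l nxt_neq(1)[of k] by (simp add: v_eq)
    show "w \<noteq> v k" "w \<noteq> v (nxt k)" "w \<in> {1..n}" using that by (auto simp: W_def)
    show "v k \<in> {1..n}" "v (nxt k) \<in> {1..n}" using that(1) l v_in by auto
    show "{v k, v (nxt k)} \<in> E" using that by (auto simp: E_def edge_def)
    show "{v k, w} \<notin> E" using that by (auto simp: adjacent_iff W_def)
    show "{v (nxt k), w} \<notin> E" using that l by (auto simp: adjacent_iff W_def)
  qed
  show ?thesis
  proof (rule bij_betw_imageI)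
    show "inj_on (\<lambda>(k, w). {v k, v (nxt k), w}) (SIGMA k:{..<5 * h}. W k)"
    proof (rule inj_onI, clarify)
      fix k w l u assume k: "k < 5 * h" "w \<in> W k" and l: "l < 5 * h" "u \<in> W l"
        and eq: "{v k, v (nxt k), w} = {v l, v (nxt l), u}"
      note Wk = W[OF k] and Wl = W[OF l]
      have "{v l, v (nxt l)} \<subseteq> {v k, v (nxt k), w}" unfolding eq by auto
      then have "{v l, v (nxt l)} = {v k, v (nxt k)} \<or> {v l, v (nxt l)} = {v k, w} \<or>
          {v l, v (nxt l)} = {v (nxt k), w}" using Wl(1) by (auto simp: doubleton_eq_iff)
      then have "edge l = edge k" using Wl(7) Wk(8,9) unfolding edge_def by (elim disjE) simp_all
      then have kl: "k = l" using k l by (simp add: edge_inj)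
      have "w \<in> {v l, v (nxt l), u}" unfolding eq[symmetric] by simp
      then have "w = u" using Wk(2,3) unfolding kl by simp
      with kl show "k = l \<and> w = u" by simp
    qed
    show "(\<lambda>(k, w). {v k, v (nxt k), w}) ` (SIGMA k:{..<5 * h}. W k) = odd_triangles n E"
    proof (rule antisym; rule subsetI)
      fix t assume "t \<in> (\<lambda>(k, w). {v k, v (nxt k), w}) ` (SIGMA k:{..<5 * h}. W k)"
      then obtain k w where k: "k < 5 * h" "w \<in> W k" "t = {v k, v (nxt k), w}" by auto
      note Wk = W[OF k(1,2)]
      show "t \<in> odd_triangles n E"
        unfolding k(3) triangle_in_odd_triangles[OF Wk(7,1-6)] using Wk(8,9) by simp
    next
      fix t assume t: "t \<in> odd_triangles n E"
      then have "odd (card {x \<in> t. t - {x} \<in> E})" and sub: "t \<subseteq> {1..n}"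
        by (auto simp: odd_triangles_def triangles_def)
      then have "{x \<in> t. t - {x} \<in> E} \<noteq> {}" by (metis card.empty even_zero)
      then obtain x where x: "x \<in> t" "t - {x} \<in> E" by blast
      then obtain k where k: "k < 5 * h" "t - {x} = {v k, v (nxt k)}" by (auto simp: E_def edge_def)
      have l: "nxt k < 5 * h" using k by (simp add: nxt_less)
      have tk: "t = {v k, v (nxt k), x}" using x k by blast
      have xk: "x \<noteq> v k" "x \<noteq> v (nxt k)" using k(2) by blast+
      have vk: "v k \<noteq> v (nxt k)" using k(1) l nxt_neq(1)[of k] by (simp add: v_eq)
      \<comment> \<open>By parity the two other sides are both in the graph or both outside. Both
        inside would close a triangle, which \<open>nxt_neq(5)\<close> excludes.\<close>
      have "{v k, x} \<in> E \<longleftrightarrow> {v (nxt k), x} \<in> E"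
        using t triangle_in_odd_triangles[of "v k" "v (nxt k)" E x n] x k xk vk sub l v_in tk by auto
      then have "x \<noteq> v (prv k)" "x \<noteq> v (nxt (nxt k))"
        using k(1) l xk nxt_neq(5)[of k] by (auto simp: adjacent_iff v_eq prv_less nxt_less)
      then have "x \<in> W k" using x sub xk by (auto simp: W_def)
      then show "t \<in> (\<lambda>(k, w). {v k, v (nxt k), w}) ` (SIGMA k:{..<5 * h}. W k)"
        using k(1) tk by force
    qed
  qed
qed

end

context five_cycle_system
begin

section \<open>Lower bound for the quadratic form of the odd triangles\<close>

definition t :: "(nat set \<Rightarrow> real) \<Rightarrow> nat \<Rightarrow> real" where
  "t x k = oriented x (v k) (v (nxt k))"

text \<open>A triangle of \<open>odd_triangles n E\<close> consists of a graph edge \<open>edge k\<close> and an apex \<open>w \<in> W k\<close>. Expanding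
  the squared boundary terms, the pairs in \<open>fibre f\<close> contribute to the edge \<open>f\<close> outside the graph, and the
  form is at least \<open>4 \<Sum>\<^sub>k t\<^sub>k\<^sup>2 + \<Sum>\<^sub>f (d\<^sub>f x\<^sub>f\<^sup>2 - 2 x\<^sub>f z\<^sub>f)\<close>, where the \<open>z\<^sub>f\<close> are linear in the \<open>t\<^sub>k\<close>.\<close>

definition P :: "(nat \<times> nat) set" where
  "P = (SIGMA k:{..<5 * h}. Y k)"

definition fibre :: "nat set \<Rightarrow> (nat \<times> nat) set" where
  "fibre f = {p \<in> P. {v (fst p), snd p} = f}"

definition sg :: "nat \<Rightarrow> nat \<Rightarrow> real" where
  "sg k w = (if v k < w then 1 else - 1)"

text \<open>Collects the linear terms from the two odd triangles with apex w over the graph edges at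
  \<open>v k\<close>. If w lies off all cycles, both triangles are present and this is a plain
  cyclic difference of \<open>t\<close>.\<close>

definition y :: "(nat set \<Rightarrow> real) \<Rightarrow> nat \<times> nat \<Rightarrow> real" where
  "y x p = of_bool (snd p \<in> W (prv (fst p))) * t x (prv (fst p)) - of_bool (snd p \<in> W (fst p)) * t x (fst p)"

definition z :: "(nat set \<Rightarrow> real) \<Rightarrow> nat set \<Rightarrow> real" where
  "z x f = (\<Sum>p\<in>fibre f. sg (fst p) (snd p) * y x p)"

text \<open>A pair (k, w) costs 4: the edge {v k, w} occurs in up to two odd triangles with apex w,
  and each contributes its square doubled after the cross term is estimated.\<close>

definition d :: "nat set \<Rightarrow> real" where
  "d f = real n - 4 * real (card (fibre f))"

lemma finite_W [simp]: "finite (W k)" and finite_Y [simp]: "finite (Y k)"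
  by (simp_all add: W_def Y_def)

lemma finite_P [simp]: "finite P" by (simp add: P_def)

lemma finite_fibre [simp]: "finite (fibre f)" by (simp add: fibre_def)

lemma sum_odd_triangles_le:
  "(\<Sum>s\<in>odd_triangles n E. (\<Sum>e\<in>edges n. x e * boundary_coeff e s)\<^sup>2) \<le>
    (real n - 4) * (\<Sum>k<5 * h. (t x k)\<^sup>2) +
    (\<Sum>p\<in>P. 4 * (oriented x (v (fst p)) (snd p))\<^sup>2 + 2 * (oriented x (v (fst p)) (snd p) * y x p))"
proof -
  define X where "X k w = oriented x (v k) w" for k w
  define A where "A k w = 2 * (X k w)\<^sup>2 + 2 * t x (prv k) * X k w" for k w
  define B where "B k w = 2 * (X k w)\<^sup>2 - 2 * t x k * X k w" for k w
  have "(\<Sum>s\<in>odd_triangles n E. (\<Sum>e\<in>edges n. x e * boundary_coeff e s)\<^sup>2) =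
      (\<Sum>p\<in>(SIGMA k:{..<5 * h}. W k). (\<Sum>e\<in>edges n. x e * boundary_coeff e
        ((\<lambda>(k, w). {v k, v (nxt k), w}) p))\<^sup>2)"
    by (rule sum.reindex_bij_betw[OF bij_betw_odd_triangles, symmetric])
  also have "\<dots> = (\<Sum>p\<in>(SIGMA k:{..<5 * h}. W k). (t x (fst p) + X (nxt (fst p)) (snd p) - X (fst p) (snd p))\<^sup>2)"
  proof (rule sum.cong[OF refl])
    fix p assume p: "p \<in> (SIGMA k:{..<5 * h}. W k)"
    obtain k w where kw: "p = (k, w)" by (cases p)
    have k: "k < 5 * h" "w \<in> W k" using p kw by auto
    have l: "nxt k < 5 * h" using k by (simp add: nxt_less)
    have "(\<Sum>e\<in>edges n. x e * boundary_coeff e {v k, v (nxt k), w})\<^sup>2 =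
        (t x k + X (nxt k) w - X k w)\<^sup>2"
      unfolding t_def X_def
      by (rule triangle_square_oriented)
        (use k l nxt_neq(1)[of k] v_in in \<open>auto simp: W_def v_eq\<close>)
    then show "(\<Sum>e\<in>edges n. x e * boundary_coeff e ((\<lambda>(k, w). {v k, v (nxt k), w}) p))\<^sup>2 =
        (t x (fst p) + X (nxt (fst p)) (snd p) - X (fst p) (snd p))\<^sup>2" by (simp add: kw)
  qed
  also have "\<dots> = (\<Sum>k<5 * h. \<Sum>w\<in>W k. (t x k + X (nxt k) w - X k w)\<^sup>2)"
    by (subst sum.Sigma) (auto simp: case_prod_unfold)
  \<comment> \<open>Only the cross term of the two edges at the apex is estimated. The terms linear
    in \<open>t\<close> are kept exactly, since they produce the Laplacian of the cycles.\<close>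
  also have "\<dots> \<le> (\<Sum>k<5 * h. \<Sum>w\<in>W k. (t x k)\<^sup>2 + A (nxt k) w + B k w)"
  proof (intro sum_mono)
    fix k w
    have "0 \<le> (X (nxt k) w + X k w)\<^sup>2" by simp
    then show "(t x k + X (nxt k) w - X k w)\<^sup>2 \<le> (t x k)\<^sup>2 + A (nxt k) w + B k w"
      by (simp add: A_def B_def power2_eq_square algebra_simps)
  qed
  also have "\<dots> = (\<Sum>k<5 * h. real (card (W k)) * (t x k)\<^sup>2) + (\<Sum>k<5 * h. \<Sum>w\<in>W k. A (nxt k) w) +
      (\<Sum>k<5 * h. \<Sum>w\<in>W k. B k w)"
    by (simp add: sum.distrib)
  also have "(\<Sum>k<5 * h. \<Sum>w\<in>W k. A (nxt k) w) = (\<Sum>k<5 * h. \<Sum>w\<in>W (prv k). A k w)"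
    using sum.reindex_bij_betw[OF bij_betw_nxt, of "\<lambda>k. \<Sum>w\<in>W (prv k). A k w" h] by simp
  also have "(\<Sum>k<5 * h. real (card (W k)) * (t x k)\<^sup>2) = (real n - 4) * (\<Sum>k<5 * h. (t x k)\<^sup>2)"
    unfolding sum_distrib_left
  proof (rule sum.cong[OF refl])
    fix k assume "k \<in> {..<5 * h}"
    then have "real (card (W k)) = real n - 4" using card_W[of k] by simp
    then show "real (card (W k)) * (t x k)\<^sup>2 = (real n - 4) * (t x k)\<^sup>2" by simp
  qed
  finally have "(\<Sum>s\<in>odd_triangles n E. (\<Sum>e\<in>edges n. x e * boundary_coeff e s)\<^sup>2) \<le>
      (real n - 4) * (\<Sum>k<5 * h. (t x k)\<^sup>2) +
      (\<Sum>k<5 * h. (\<Sum>w\<in>W (prv k). A k w) + (\<Sum>w\<in>W k. B k w))"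
    by (simp add: sum.distrib)
  also have "(\<Sum>k<5 * h. (\<Sum>w\<in>W (prv k). A k w) + (\<Sum>w\<in>W k. B k w)) \<le>
      (\<Sum>k<5 * h. \<Sum>w\<in>Y k. 4 * (X k w)\<^sup>2 + 2 * (X k w * y x (k, w)))"
  proof (rule sum_mono)
    fix k assume k: "k \<in> {..<5 * h}"
    have "(\<Sum>w\<in>W (prv k). A k w) = (\<Sum>w\<in>Y k. if w \<in> W (prv k) then A k w else 0)"
      using W_subset_Y(2)[of k] k by (intro sum.mono_neutral_cong_left) auto
    moreover have "(\<Sum>w\<in>W k. B k w) = (\<Sum>w\<in>Y k. if w \<in> W k then B k w else 0)"
      using W_subset_Y(1)[of k] by (intro sum.mono_neutral_cong_left) auto
    \<comment> \<open>Squares may be overcounted here; the linear terms are matched exactly by the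
      indicators in \<open>y\<close>.\<close>
    moreover have "(if w \<in> W (prv k) then A k w else 0) + (if w \<in> W k then B k w else 0) \<le>
        4 * (X k w)\<^sup>2 + 2 * (X k w * y x (k, w))" for w
      by (simp add: A_def B_def y_def algebra_simps)
    ultimately show "(\<Sum>w\<in>W (prv k). A k w) + (\<Sum>w\<in>W k. B k w) \<le>
        (\<Sum>w\<in>Y k. 4 * (X k w)\<^sup>2 + 2 * (X k w * y x (k, w)))"
      by (simp add: sum.distrib[symmetric] sum_mono)
  qed
  also have "(\<Sum>k<5 * h. \<Sum>w\<in>Y k. 4 * (X k w)\<^sup>2 + 2 * (X k w * y x (k, w))) =
      (\<Sum>p\<in>P. 4 * (X (fst p) (snd p))\<^sup>2 + 2 * (X (fst p) (snd p) * y x p))"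
    unfolding P_def by (subst sum.Sigma) (auto simp: case_prod_unfold)
  finally show ?thesis by (simp add: X_def)
qed

lemma fibre_edge:
  assumes "p \<in> P"
  shows "{v (fst p), snd p} \<in> edges n - E"
  using assms v_in[of "fst p"] by (auto simp: P_def Y_def edge_in_edges adjacent_iff)

lemma sum_P: "(\<Sum>p\<in>P. g p) = (\<Sum>f\<in>edges n - E. \<Sum>p\<in>fibre f. (g p :: real))"
  unfolding fibre_def
  by (rule sum.group[symmetric]) (use fibre_edge in auto)

lemma fibre_oriented:
  assumes "p \<in> fibre f"
  shows "oriented x (v (fst p)) (snd p) = sg (fst p) (snd p) * x f"
proof -
  have "v (fst p) \<noteq> snd p" using assms by (auto simp: fibre_def P_def Y_def)
  then show ?thesis using assms by (auto simp: oriented_def sg_def fibre_def)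
qed

lemma sg_square [simp]: "sg k w * sg k w = 1" "(sg k w)\<^sup>2 = 1"
  by (auto simp: sg_def)

lemma fibre_determined:
  assumes "p \<in> fibre f" "q \<in> fibre f" "v (fst p) = v (fst q)"
  shows "p = q"
  using assms by (auto simp: fibre_def P_def v_eq prod_eq_iff doubleton_eq_iff)

lemma card_fibre_le:
  assumes "f \<in> edges n"
  shows "card (fibre f) \<le> 2"
proof -
  have "card (fibre f) \<le> card f"
  proof (rule card_inj_on_le[of "v \<circ> fst"])
    show "inj_on (v \<circ> fst) (fibre f)" using fibre_determined by (auto intro: inj_onI)
    show "(v \<circ> fst) ` fibre f \<subseteq> f" by (auto simp: fibre_def)
    show "finite f" using assms by (auto simp: edges_def intro: finite_subset)
  qed
  then show ?thesis using assms by (simp add: edges_def)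
qed

text \<open>Two pairs lie over \<open>f\<close> only if both its ends are cycle vertices. The factor
  2 from Cauchy-Schwarz must be confined to this case: applied to the main contribution, from apexes
  off the cycles, it would exceed the available 4.\<close>

lemma z_square_le:
  assumes f: "f \<in> edges n"
  shows "(z x f)\<^sup>2 \<le> (\<Sum>p\<in>fibre f. (if snd p \<in> v ` {..<5 * h} then 2 else 1) * (y x p)\<^sup>2)"
proof (cases "\<exists>p\<in>fibre f. snd p \<notin> v ` {..<5 * h}")
  case True
  then obtain p where p: "p \<in> fibre f" "snd p \<notin> v ` {..<5 * h}" by blast
  have "q = p" if q: "q \<in> fibre f" for q
  proof (rule fibre_determined[OF q p(1)])
    have "v (fst q) \<in> f" "f = {v (fst p), snd p}" "fst q < 5 * h" using p q by (auto simp: fibre_def P_def)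
    moreover from this have "v (fst q) \<in> v ` {..<5 * h}" by simp
    ultimately show "v (fst q) = v (fst p)" using p(2) by (metis insert_iff singletonD)
  qed
  then have "fibre f = {p}" using p by blast
  then show ?thesis using p by (simp add: z_def power_mult_distrib)
next
  case False
  have "(z x f)\<^sup>2 \<le> (\<Sum>p\<in>fibre f. (sg (fst p) (snd p) * y x p)\<^sup>2) * card (fibre f)"
    unfolding z_def by (rule sum_squared_le_sum_of_squares)
  also have "\<dots> \<le> (\<Sum>p\<in>fibre f. (sg (fst p) (snd p) * y x p)\<^sup>2) * 2"
    using card_fibre_le[OF f] by (intro mult_left_mono sum_nonneg) auto
  also have "\<dots> = (\<Sum>p\<in>fibre f. (if snd p \<in> v ` {..<5 * h} then 2 else 1) * (y x p)\<^sup>2)"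
    unfolding sum_distrib_right by (rule sum.cong[OF refl]) (use False in \<open>auto simp: power_mult_distrib\<close>)
  finally show ?thesis .
qed

text \<open>Apexes off the cycles give n times the cyclic differences, where the gap 96/25 enters.
  For each \<open>k\<close> at most \<open>5 * h\<close> apexes lie on cycles and cost 4 per square,
  that is 20h, and each square occurs for two values of \<open>k\<close>.\<close>

lemma sum_y_square_le:
  "(\<Sum>p\<in>P. (if snd p \<in> v ` {..<5 * h} then 2 else 1) * (y x p)\<^sup>2) \<le>
    (96 / 25 * real n + 40 * real h) * (\<Sum>k<5 * h. (t x k)\<^sup>2)"
proof -
  let ?V = "v ` {..<5 * h}"
  let ?g = "\<lambda>p. (if snd p \<in> ?V then 2 else 1) * (y x p)\<^sup>2"
  have "(\<Sum>p\<in>P. ?g p) = (\<Sum>k<5 * h. \<Sum>w\<in>Y k. ?g (k, w))"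
    unfolding P_def by (subst sum.Sigma) (auto simp: case_prod_unfold)
  also have "\<dots> \<le> (\<Sum>k<5 * h. real n * (t x (prv k) - t x k)\<^sup>2 + 20 * real h * ((t x (prv k))\<^sup>2 + (t x k)\<^sup>2))"
  proof (rule sum_mono)
    fix k assume k: "k \<in> {..<5 * h}"
    have "(\<Sum>w\<in>Y k. ?g (k, w)) = (\<Sum>w\<in>Y k - ?V. ?g (k, w)) + (\<Sum>w\<in>Y k \<inter> ?V. ?g (k, w))"
      by (subst sum.union_disjoint[symmetric]) (auto intro: sum.cong)
    also have "(\<Sum>w\<in>Y k - ?V. ?g (k, w)) = (\<Sum>w\<in>Y k - ?V. (t x (prv k) - t x k)\<^sup>2)"
    proof (rule sum.cong[OF refl])
      fix w assume w: "w \<in> Y k - ?V"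
      have "w \<noteq> v l" if "l < 5 * h" for l using w that by blast
      then have "w \<in> W k" "w \<in> W (prv k)"
        using w k by (auto simp: W_def Y_def nxt_less prv_less)
      then show "?g (k, w) = (t x (prv k) - t x k)\<^sup>2" using w by (simp add: y_def)
    qed
    also have "\<dots> \<le> real n * (t x (prv k) - t x k)\<^sup>2"
    proof -
      have "card (Y k - ?V) \<le> card {1..n}" by (intro card_mono) (auto simp: Y_def)
      then show ?thesis by (simp add: mult_right_mono)
    qed
    also have "(\<Sum>w\<in>Y k \<inter> ?V. ?g (k, w)) \<le> (\<Sum>w\<in>Y k \<inter> ?V. 4 * ((t x (prv k))\<^sup>2 + (t x k)\<^sup>2))"
    proof (rule sum_mono)
      fix w assume w: "w \<in> Y k \<inter> ?V"
      have "(a - b)\<^sup>2 \<le> 2 * (a\<^sup>2 + b\<^sup>2)" for a b :: real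
        using zero_le_power2[of "a + b"] by (simp add: power2_eq_square algebra_simps)
      from this[of "of_bool (w \<in> W (prv k)) * t x (prv k)" "of_bool (w \<in> W k) * t x k"]
      have "(y x (k, w))\<^sup>2 \<le> 2 * ((of_bool (w \<in> W (prv k)) * t x (prv k))\<^sup>2 + (of_bool (w \<in> W k) * t x k)\<^sup>2)"
        by (simp add: y_def)
      also have "\<dots> \<le> 2 * ((t x (prv k))\<^sup>2 + (t x k)\<^sup>2)" by (simp add: power_mult_distrib of_bool_def)
      finally show "?g (k, w) \<le> 4 * ((t x (prv k))\<^sup>2 + (t x k)\<^sup>2)" using w by simp
    qed
    also have "\<dots> \<le> 20 * real h * ((t x (prv k))\<^sup>2 + (t x k)\<^sup>2)"
    proof -
      have "card (Y k \<inter> ?V) \<le> card ?V" by (intro card_mono) auto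
      also have "\<dots> \<le> 5 * h" using card_image_le[of "{..<5 * h}" v] by simp
      finally have "real (card (Y k \<inter> ?V)) * 4 \<le> 20 * real h" by linarith
      then have "real (card (Y k \<inter> ?V)) * 4 * ((t x (prv k))\<^sup>2 + (t x k)\<^sup>2) \<le>
          20 * real h * ((t x (prv k))\<^sup>2 + (t x k)\<^sup>2)" by (rule mult_right_mono) simp
      then show ?thesis by (simp only: sum_constant mult.assoc)
    qed
    finally show "(\<Sum>w\<in>Y k. ?g (k, w)) \<le> real n * (t x (prv k) - t x k)\<^sup>2 + 20 * real h * ((t x (prv k))\<^sup>2 + (t x k)\<^sup>2)"
      by simp
  qed
  also have "\<dots> = real n * (\<Sum>k<5 * h. (t x (prv k) - t x k)\<^sup>2) +
      20 * real h * ((\<Sum>k<5 * h. (t x (prv k))\<^sup>2) + (\<Sum>k<5 * h. (t x k)\<^sup>2))"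
    by (simp add: sum.distrib sum_distrib_left[symmetric])
  also have "(\<Sum>k<5 * h. (t x (prv k))\<^sup>2) = (\<Sum>k<5 * h. (t x k)\<^sup>2)"
    using sum.reindex_bij_betw[OF bij_betw_nxt, of "\<lambda>k. (t x (prv k))\<^sup>2" h] by simp
  also have "real n * (\<Sum>k<5 * h. (t x (prv k) - t x k)\<^sup>2) \<le> real n * (96 / 25 * (\<Sum>k<5 * h. (t x k)\<^sup>2))"
    by (intro mult_left_mono sum_cyclic_differences_le) simp
  finally show ?thesis by (simp add: algebra_simps)
qed

lemma sum_E: "(\<Sum>e\<in>E. (x e)\<^sup>2) = (\<Sum>k<5 * h. (t x k)\<^sup>2)"
proof -
  have "(\<Sum>e\<in>E. (x e)\<^sup>2) = (\<Sum>k<5 * h. (x (edge k))\<^sup>2)"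
    unfolding E_def by (subst sum.reindex) (auto simp: inj_on_def edge_inj)
  also have "\<dots> = (\<Sum>k<5 * h. (t x k)\<^sup>2)"
  proof (rule sum.cong[OF refl])
    fix k assume "k \<in> {..<5 * h}"
    then have "v k \<noteq> v (nxt k)" using nxt_neq(1)[of k] by (simp add: v_eq nxt_less)
    then show "(x (edge k))\<^sup>2 = (t x k)\<^sup>2" by (auto simp: t_def edge_def oriented_def insert_commute)
  qed
  finally show ?thesis .
qed

text \<open>Completing the squares off the graph costs the sum of the squares of
  \<open>z x f\<close> over \<open>d f\<close>. This takes at most 39/10 out of the coefficient 4 on
  the graph edges, and 1/10 survives.\<close>

lemma form_lower_bound:
  fixes x :: "nat set \<Rightarrow> real"
  assumes n: "n \<ge> 700 * h + 600"
  shows "1 / 10 * (\<Sum>e\<in>E. (x e)\<^sup>2) + (\<Sum>f\<in>edges n - E. d f * (x f - z x f / d f)\<^sup>2) \<le>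
    n * (\<Sum>e\<in>edges n. (x e)\<^sup>2) - (\<Sum>s\<in>odd_triangles n E. (\<Sum>e\<in>edges n. x e * boundary_coeff e s)\<^sup>2)"
proof -
  let ?F = "edges n - E"
  define T where "T = (\<Sum>k<5 * h. (t x k)\<^sup>2)"
  have T0: "0 \<le> T" by (simp add: T_def sum_nonneg)
  have dpos: "d f \<ge> real n - 8" "d f > 0" if "f \<in> ?F" for f
    using card_fibre_le[of f] that n by (auto simp: d_def)
  have "(\<Sum>p\<in>P. 4 * (oriented x (v (fst p)) (snd p))\<^sup>2 + 2 * (oriented x (v (fst p)) (snd p) * y x p)) =
      (\<Sum>f\<in>?F. \<Sum>p\<in>fibre f. 4 * (x f)\<^sup>2 + 2 * x f * (sg (fst p) (snd p) * y x p))"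
    unfolding sum_P
    by (intro sum.cong refl) (simp add: fibre_oriented power_mult_distrib mult_ac)
  also have "\<dots> = (\<Sum>f\<in>?F. 4 * real (card (fibre f)) * (x f)\<^sup>2 + 2 * x f * z x f)"
    by (simp add: sum.distrib z_def sum_distrib_left[symmetric] mult_ac)
  finally have "(\<Sum>s\<in>odd_triangles n E. (\<Sum>e\<in>edges n. x e * boundary_coeff e s)\<^sup>2) \<le>
      (real n - 4) * T + (\<Sum>f\<in>?F. 4 * real (card (fibre f)) * (x f)\<^sup>2 + 2 * x f * z x f)"
    using sum_odd_triangles_le[of x] by (simp add: T_def)
  moreover have "(\<Sum>e\<in>edges n. (x e)\<^sup>2) = T + (\<Sum>f\<in>?F. (x f)\<^sup>2)"
    unfolding T_def sum_E[symmetric] using E_subset by (simp add: sum.subset_diff add.commute)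
  ultimately have "4 * T + (\<Sum>f\<in>?F. n * (x f)\<^sup>2 - (4 * real (card (fibre f)) * (x f)\<^sup>2 + 2 * x f * z x f)) \<le>
      n * (\<Sum>e\<in>edges n. (x e)\<^sup>2) - (\<Sum>s\<in>odd_triangles n E. (\<Sum>e\<in>edges n. x e * boundary_coeff e s)\<^sup>2)"
    by (simp add: sum_subtractf sum_distrib_left algebra_simps)
  moreover have "(\<Sum>f\<in>?F. n * (x f)\<^sup>2 - (4 * real (card (fibre f)) * (x f)\<^sup>2 + 2 * x f * z x f)) =
      (\<Sum>f\<in>?F. d f * (x f - z x f / d f)\<^sup>2 - (z x f)\<^sup>2 / d f)"
  proof (rule sum.cong[OF refl])
    fix f assume f: "f \<in> ?F"
    have "n * (x f)\<^sup>2 - (4 * real (card (fibre f)) * (x f)\<^sup>2 + 2 * x f * z x f) = d f * (x f)\<^sup>2 - 2 * x f * z x f"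
      by (simp add: d_def algebra_simps)
    also have "\<dots> = d f * (x f - z x f / d f)\<^sup>2 - (z x f)\<^sup>2 / d f"
      using dpos[OF f] by (simp add: field_simps power2_eq_square)
    finally show "n * (x f)\<^sup>2 - (4 * real (card (fibre f)) * (x f)\<^sup>2 + 2 * x f * z x f) =
        d f * (x f - z x f / d f)\<^sup>2 - (z x f)\<^sup>2 / d f" .
  qed
  moreover have "(\<Sum>f\<in>?F. (z x f)\<^sup>2 / d f) \<le> 39 / 10 * T"
  proof -
    have n8: "real n - 8 > 0" using n by linarith
    have "(\<Sum>f\<in>?F. (z x f)\<^sup>2 / d f) \<le> (\<Sum>f\<in>?F. (z x f)\<^sup>2 / (real n - 8))"
      using dpos n8 by (intro sum_mono divide_left_mono) auto
    also have "\<dots> \<le> (\<Sum>f\<in>?F. (\<Sum>p\<in>fibre f. (if snd p \<in> v ` {..<5 * h} then 2 else 1) * (y x p)\<^sup>2) / (real n - 8))"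
      using n8 by (intro sum_mono divide_right_mono z_square_le) auto
    also have "\<dots> = (\<Sum>p\<in>P. (if snd p \<in> v ` {..<5 * h} then 2 else 1) * (y x p)\<^sup>2) / (real n - 8)"
      unfolding sum_P by (simp add: sum_divide_distrib)
    also have "\<dots> \<le> (96 / 25 * real n + 40 * real h) * T / (real n - 8)"
      unfolding T_def using n8 by (intro divide_right_mono sum_y_square_le) simp
    also have "\<dots> \<le> 39 / 10 * (real n - 8) * T / (real n - 8)"
    proof (intro divide_right_mono mult_right_mono T0)
      \<comment> \<open>The slack 39/10 - 96/25 = 6/100, times n, has to absorb 40h and 8 * 39/10;
        this dictates the size of the threshold.\<close>
      have "real n \<ge> 700 * real h + 600" using n by linarith
      then show "96 / 25 * real n + 40 * real h \<le> 39 / 10 * (real n - 8)" by (simp add: algebra_simps)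
    qed (use n8 in simp)
    also have "\<dots> = 39 / 10 * T"
    proof -
      have "a * c * b / c = a * b" if "c \<noteq> 0" for a b c :: real using that by simp
      then show ?thesis using n8 by (metis less_irrefl)
    qed
    finally show ?thesis .
  qed
  ultimately show ?thesis by (simp add: sum_subtractf sum_E T_def)
qed

section \<open>From the quadratic form to the determinant\<close>

lemma card_P: "card P \<le> 5 * h * n"
proof -
  have "P \<subseteq> {..<5 * h} \<times> {1..n}" by (auto simp: P_def Y_def)
  then have "card P \<le> card ({..<5 * h} \<times> {1..n})" by (intro card_mono) auto
  then show ?thesis by (simp add: card_cartesian_product)
qed

text \<open>The coefficient of \<open>x e\<close> in the summand of \<open>p\<close> in
  \<open>z x f\<close>. It is made explicit because \<open>prod_le_det_matrix_of\<close> takes the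
  linear substitution as a matrix.\<close>

definition y_coeff :: "nat \<times> nat \<Rightarrow> nat set \<Rightarrow> real" where
  "y_coeff p e = sg (fst p) (snd p) *
      (of_bool (snd p \<in> W (prv (fst p))) * (of_bool (e = edge (prv (fst p))) * sg (prv (fst p)) (v (nxt (prv (fst p))))) -
       of_bool (snd p \<in> W (fst p)) * (of_bool (e = edge (fst p)) * sg (fst p) (v (nxt (fst p)))))"

lemma z_linear:
  "z x f = (\<Sum>e\<in>E. (\<Sum>p\<in>fibre f. y_coeff p e) * x e)"
proof -
  have t: "t x k = (\<Sum>e\<in>E. of_bool (e = edge k) * sg k (v (nxt k)) * x e)" if "k < 5 * h" for k
  proof -
    have "v k \<noteq> v (nxt k)" using that nxt_neq(1)[of k] by (simp add: v_eq nxt_less)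
    then have "t x k = sg k (v (nxt k)) * x (edge k)"
      by (auto simp: t_def oriented_def sg_def edge_def insert_commute)
    also have "\<dots> = (\<Sum>e\<in>E. if e = edge k then sg k (v (nxt k)) * x e else 0)"
      using that finite_E by (simp add: E_def)
    also have "\<dots> = (\<Sum>e\<in>E. of_bool (e = edge k) * sg k (v (nxt k)) * x e)"
      by (intro sum.cong) auto
    finally show ?thesis .
  qed
  have "z x f = (\<Sum>p\<in>fibre f. \<Sum>e\<in>E. y_coeff p e * x e)"
    unfolding z_def
  proof (rule sum.cong[OF refl])
    fix p assume "p \<in> fibre f"
    then have "fst p < 5 * h" "prv (fst p) < 5 * h" by (auto simp: fibre_def P_def prv_less)
    from t[OF this(1)] t[OF this(2)]
    show "sg (fst p) (snd p) * y x p = (\<Sum>e\<in>E. y_coeff p e * x e)"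
      by (simp only: y_def y_coeff_def left_diff_distrib right_diff_distrib sum_subtractf sum_distrib_left mult.assoc)
  qed
  then show ?thesis by (subst (asm) sum.swap) (simp add: sum_distrib_right)
qed

lemma det_avoidance_ge:
  assumes n: "n \<ge> 700 * h + 600"
  shows "(1 / (10 * n)) ^ (5 * h) * (1 - 8 / n) ^ (5 * h * n) \<le>
    det (matrix_of (edges n) (edges n) (avoidance_matrix n (odd_triangles n E)))"
proof -
  let ?F = "edges n - E"
  have n0: "real n > 0" "real n \<ge> 8" using n by auto
  define c where "c f e = (\<Sum>p\<in>fibre f. y_coeff p e)" for f e
  \<comment> \<open>The unipotent substitution of the completed squares: graph variables stay, and
    the variable of \<open>f\<close> is shifted by minus \<open>z x f / d f\<close>.\<close>
  define u where "u f e = (if f \<in> E then 0 else - c f e / d f)" for f e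
  define \<delta> where "\<delta> e = (if e \<in> E then 1 / (10 * n) else d e / n)" for e
  have dge: "d f \<ge> real n - 8" if "f \<in> edges n" for f
    using card_fibre_le[OF that] by (simp add: d_def)
  have u: "x f + (\<Sum>e\<in>E. u f e * x e) = (if f \<in> E then x f else x f - z x f / d f)" for x f
  proof -
    have "z x f = (\<Sum>e\<in>E. c f e * x e)" unfolding c_def by (rule z_linear)
    then show ?thesis by (simp add: u_def sum_negf sum_divide_distrib)
  qed
  have "(\<Prod>e\<in>edges n. \<delta> e) \<le> det (matrix_of (edges n) (edges n) (avoidance_matrix n (odd_triangles n E)))"
  proof (rule prod_le_det_matrix_of[where X = E and u = u])
    show "0 \<le> \<delta> e" if "e \<in> edges n" for e using dge[OF that] n0 by (simp add: \<delta>_def)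
    show "(\<Sum>i\<in>edges n. \<delta> i * (x i + (\<Sum>j\<in>E. u i j * x j))\<^sup>2) \<le>
        (\<Sum>i\<in>edges n. \<Sum>j\<in>edges n. avoidance_matrix n (odd_triangles n E) i j * x i * x j)" for x
    proof -
      have "(\<Sum>i\<in>edges n. \<delta> i * (x i + (\<Sum>j\<in>E. u i j * x j))\<^sup>2) =
          (\<Sum>i\<in>E. \<delta> i * (x i)\<^sup>2) + (\<Sum>i\<in>?F. \<delta> i * (x i - z x i / d i)\<^sup>2)"
        unfolding u using E_subset by (simp add: sum.subset_diff add.commute)
      also have "\<dots> = (1 / 10 * (\<Sum>e\<in>E. (x e)\<^sup>2) + (\<Sum>f\<in>?F. d f * (x f - z x f / d f)\<^sup>2)) / n"
        by (simp add: \<delta>_def sum_divide_distrib add_divide_distrib)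
      also have "\<dots> \<le> (n * (\<Sum>e\<in>edges n. (x e)\<^sup>2) - (\<Sum>s\<in>odd_triangles n E. (\<Sum>e\<in>edges n. x e * boundary_coeff e s)\<^sup>2)) / n"
        using n0 by (intro divide_right_mono form_lower_bound[OF n]) simp
      also have "\<dots> = (\<Sum>i\<in>edges n. \<Sum>j\<in>edges n. avoidance_matrix n (odd_triangles n E) i j * x i * x j)"
        unfolding avoidance_form using n0 by (simp add: diff_divide_distrib)
      finally show ?thesis .
    qed
  qed (use E_subset in \<open>auto simp: u_def avoidance_matrix_sym\<close>)
  moreover have "(1 / (10 * n)) ^ (5 * h) * (1 - 8 / n) ^ (5 * h * n) \<le> (\<Prod>e\<in>edges n. \<delta> e)"
  proof -
    \<comment> \<open>Off the graph \<open>\<delta> f\<close> equals 1 unless some pair lies over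
      \<open>f\<close>, so at most \<open>card P\<close> factors differ from 1.\<close>
    let ?F' = "{f \<in> ?F. fibre f \<noteq> {}}"
    have "?F' \<subseteq> (\<lambda>p. {v (fst p), snd p}) ` P" unfolding fibre_def by blast
    then have "card ?F' \<le> card P" by (meson card_image_le card_mono finite_P finite_imageI le_trans)
    then have cF: "card ?F' \<le> 5 * h * n" using card_P by linarith
    have "(\<Prod>e\<in>edges n. \<delta> e) = (\<Prod>e\<in>E. \<delta> e) * (\<Prod>f\<in>?F. \<delta> f)"
      using E_subset by (simp add: prod.subset_diff mult.commute)
    also have "(\<Prod>e\<in>E. \<delta> e) = (1 / (10 * n)) ^ (5 * h)" by (simp add: \<delta>_def card_E)
    also have "(\<Prod>f\<in>?F. \<delta> f) = (\<Prod>f\<in>?F'. \<delta> f)"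
      using n0 by (intro prod.mono_neutral_right) (auto simp: \<delta>_def d_def)
    finally have eq: "(\<Prod>e\<in>edges n. \<delta> e) = (1 / (10 * n)) ^ (5 * h) * (\<Prod>f\<in>?F'. \<delta> f)" .
    have "(1 - 8 / n) ^ (5 * h * n) \<le> (1 - 8 / real n) ^ card ?F'"
      using n0 cF by (intro power_decreasing) (auto simp: field_simps)
    also have "\<dots> = (\<Prod>f\<in>?F'. 1 - 8 / real n)" by simp
    also have "\<dots> \<le> (\<Prod>f\<in>?F'. \<delta> f)"
    proof (rule prod_mono)
      fix f assume "f \<in> ?F'"
      then have "(real n - 8) / n \<le> d f / n" "f \<notin> E" using dge n0 by (auto intro: divide_right_mono)
      then show "0 \<le> 1 - 8 / real n \<and> 1 - 8 / real n \<le> \<delta> f"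
        using n0 by (simp add: \<delta>_def diff_divide_distrib)
    qed
    finally show ?thesis unfolding eq by (intro mult_left_mono) simp_all
  qed
  ultimately show ?thesis by linarith
qed

end

section \<open>Counting disjoint 5-cycles\<close>

definition graph_of :: "nat \<Rightarrow> (nat \<Rightarrow> nat) \<Rightarrow> nat set set" where
  "graph_of h v = (\<lambda>k. {v k, v (nxt k)}) ` {..<5 * h}"

definition vertex_lists :: "nat \<Rightarrow> nat \<Rightarrow> nat list set" where
  "vertex_lists n m = {xs. length xs = m \<and> distinct xs \<and> set xs \<subseteq> {1..n}}"

lemma finite_vertex_lists: "finite (vertex_lists n m)"
  by (rule finite_subset[OF _ finite_lists_length_eq[of "{1..n}" m]]) (auto simp: vertex_lists_def)

lemma five_cycle_system_list:
  assumes "xs \<in> vertex_lists n (5 * h)"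
  shows "five_cycle_system n h ((!) xs)"
proof
  show "inj_on ((!) xs) {..<5 * h}"
    using assms by (auto simp: vertex_lists_def inj_on_def nth_eq_iff_index_eq)
  show "(!) xs ` {..<5 * h} \<subseteq> {1..n}"
    using assms by (auto simp: vertex_lists_def dest!: subsetD[OF _ nth_mem])
qed

lemma graph_of_eq_E:
  assumes "five_cycle_system n h v"
  shows "graph_of h v = five_cycle_system.E h v"
  using assms by (simp add: graph_of_def five_cycle_system.E_def five_cycle_system.edge_def)

lemma nxt_block: "i < 5 \<Longrightarrow> nxt (5 * j + i) = 5 * j + Suc i mod 5"
  by (simp add: nxt_def)

lemma graph_of_blocks:
  "graph_of h v = (\<Union>j<h. {{v (5 * j + i), v (5 * j + Suc i mod 5)} | i. i < 5})"
proof -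
  have "\<exists>j<h. \<exists>i<5. {v k, v (nxt k)} = {v (5 * j + i), v (5 * j + Suc i mod 5)}" if "k < 5 * h" for k
  proof (intro exI conjI)
    show "k div 5 < h" "k mod 5 < 5" using that by auto
    show "{v k, v (nxt k)} = {v (5 * (k div 5) + k mod 5), v (5 * (k div 5) + Suc (k mod 5) mod 5)}"
      by (simp add: nxt_def)
  qed
  moreover have "5 * j + i < 5 * h" if "j < h" "i < 5" for i j :: nat using that by linarith
  ultimately show ?thesis
    unfolding graph_of_def by (fastforce simp: nxt_block[symmetric])
qed

lemma graph_of_in_five_cycle_graphs:
  assumes xs: "xs \<in> vertex_lists n (5 * h)"
  shows "graph_of h ((!) xs) \<in> five_cycle_graphs n h"
proof -
  have len: "length xs = 5 * h" "distinct xs" "set xs \<subseteq> {1..n}" using xs by (auto simp: vertex_lists_def)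
  define C where "C j = {{xs ! (5 * j + i), xs ! (5 * j + Suc i mod 5)} | i. i < 5}" for j
  have idx: "5 * j + i < 5 * h" if "j < h" "i < 5" for i j :: nat using that by linarith
  have U: "\<Union>(C j) = (\<lambda>i. xs ! (5 * j + i)) ` {..<5}" for j
  proof -
    have "Suc i mod 5 < 5" for i :: nat by simp
    then show ?thesis unfolding C_def by blast
  qed
  have disj: "\<Union>(C j) \<inter> \<Union>(C l) = {}" if "j < h" "l < h" "j \<noteq> l" for j l
  proof -
    have "xs ! (5 * j + i) \<noteq> xs ! (5 * l + i')" if "i < 5" "i' < 5" for i i'
    proof -
      have "5 * j + i \<noteq> 5 * l + i'" using that \<open>j \<noteq> l\<close> by presburger
      then show ?thesis using len idx that \<open>j < h\<close> \<open>l < h\<close> by (simp add: nth_eq_iff_index_eq)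
    qed
    then show ?thesis unfolding U by blast
  qed
  have ne: "\<Union>(C j) \<noteq> {}" for j unfolding U by (simp add: lessThan_empty_iff)
  have inj: "inj_on C {..<h}" using disj ne by (fastforce intro: inj_onI)
  have cyc: "is_cycle_graph 5 (C j)" if "j < h" for j
    unfolding is_cycle_graph_def
  proof (intro exI conjI)
    let ?vs = "map (\<lambda>i. xs ! (5 * j + i)) [0..<5]"
    show "distinct ?vs" using len idx that by (auto simp: distinct_map inj_on_def nth_eq_iff_index_eq)
    show "length ?vs = 5" by simp
    show "C j = {{?vs ! i, ?vs ! (Suc i mod 5)} | i. i < 5}"
      unfolding C_def by (intro Collect_cong ex_cong1) auto
  qed
  have sub: "\<Union>(C j) \<subseteq> {1..n}" if "j < h" for j
    unfolding U
  proof (rule image_subsetI)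
    fix i assume "i \<in> {..<(5::nat)}"
    then have "xs ! (5 * j + i) \<in> set xs" using len idx that by simp
    then show "xs ! (5 * j + i) \<in> {1..n}" using len by blast
  qed
  have "graph_of h ((!) xs) = \<Union>(C ` {..<h})" unfolding graph_of_blocks C_def by blast
  moreover have "pairwise (\<lambda>C D. \<Union>C \<inter> \<Union>D = {}) (C ` {..<h})"
  proof (rule pairwiseI)
    fix A B assume "A \<in> C ` {..<h}" "B \<in> C ` {..<h}" "A \<noteq> B"
    then obtain j l where "A = C j" "B = C l" "j < h" "l < h" "j \<noteq> l" by auto
    then show "\<Union>A \<inter> \<Union>B = {}" using disj by simp
  qed
  moreover have "\<forall>A\<in>C ` {..<h}. is_cycle_graph 5 A \<and> \<Union>A \<subseteq> {1..n}" using cyc sub by blast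
  moreover have "finite (C ` {..<h}) \<and> card (C ` {..<h}) = h" by (simp add: card_image[OF inj])
  ultimately show ?thesis unfolding five_cycle_graphs_def by blast
qed

lemma nth_concat_blocks:
  assumes "\<And>x. x \<in> set xss \<Longrightarrow> length x = m" "j < length xss" "i < m"
  shows "concat xss ! (m * j + i) = xss ! j ! i"
  using assms
proof (induction xss arbitrary: j)
  case (Cons x xss j)
  then show ?case by (cases j) (auto simp: nth_append)
qed simp

text \<open>With one vertex list fixed for each cycle, the h! orders of the cycles give different
  concatenations. The further factor from rotating and reflecting cycles is given away; the second
  moment bound can afford this.\<close>

lemma fact_le_card_vertex_lists:
  assumes E: "E \<in> five_cycle_graphs n h"
  shows "fact h \<le> card {xs \<in> vertex_lists n (5 * h). graph_of h ((!) xs) = E}"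
proof -
  obtain \<C> where C: "finite \<C>" "card \<C> = h" "\<And>C. C \<in> \<C> \<Longrightarrow> is_cycle_graph 5 C"
    "\<And>C. C \<in> \<C> \<Longrightarrow> \<Union>C \<subseteq> {1..n}" "pairwise (\<lambda>C D. \<Union>C \<inter> \<Union>D = {}) \<C>" "E = \<Union>\<C>"
    using E unfolding five_cycle_graphs_def by blast
  define vs where "vs C = (SOME l. distinct l \<and> length l = 5 \<and> C = {{l ! i, l ! (Suc i mod 5)} | i. i < 5})"
    for C :: "nat set set"
  have vs: "distinct (vs C)" "length (vs C) = 5" "C = {{vs C ! i, vs C ! (Suc i mod 5)} | i. i < 5}"
    if "C \<in> \<C>" for C
    using someI_ex[of "\<lambda>l. distinct l \<and> length l = 5 \<and> C = {{l ! i, l ! (Suc i mod 5)} | i. i < 5}"]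
      C(3)[OF that] unfolding is_cycle_graph_def vs_def[symmetric] by blast+
  have setvs: "set (vs C) = \<Union>C" if "C \<in> \<C>" for C
  proof -
    have m: "Suc i mod 5 < 5" for i :: nat by simp
    have "set (vs C) = (\<lambda>i. vs C ! i) ` {..<5}"
      using vs(2)[OF that] by (auto simp: set_conv_nth)
    also have "\<dots> = \<Union>{{vs C ! i, vs C ! (Suc i mod 5)} | i. i < 5}" using m by blast
    finally show ?thesis using vs(3)[OF that] by simp
  qed
  have inj: "inj_on vs \<C>"
  proof (rule inj_onI)
    fix C D assume C: "C \<in> \<C>" and D: "D \<in> \<C>" and eq: "vs C = vs D"
    show "C = D" by (rule trans[OF vs(3)[OF C, unfolded eq] vs(3)[OF D, symmetric]])
  qed
  let ?g = "\<lambda>Cs. concat (map vs Cs)"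
  have "card (permutations_of_set \<C>) \<le> card {xs \<in> vertex_lists n (5 * h). graph_of h ((!) xs) = E}"
  proof (rule card_inj_on_le[of ?g])
    show "inj_on ?g (permutations_of_set \<C>)"
    proof (rule inj_onI)
      fix Cs Ds assume Cs: "Cs \<in> permutations_of_set \<C>" and Ds: "Ds \<in> permutations_of_set \<C>"
        and eq: "?g Cs = ?g Ds"
      have set: "set Cs = \<C>" "set Ds = \<C>" and len: "length Cs = length Ds"
        using Cs Ds by (auto simp: permutations_of_set_def distinct_card[symmetric])
      have "map vs Cs = map vs Ds"
      proof (rule concat_injective[OF eq])
        show "length (map vs Cs) = length (map vs Ds)" using len by simp
        show "\<forall>(x, y)\<in>set (zip (map vs Cs) (map vs Ds)). length x = length y"
        proof (rule ballI, rule case_prodI2)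
          fix p x y assume "p \<in> set (zip (map vs Cs) (map vs Ds))" "p = (x, y)"
          then have "x \<in> set (map vs Cs)" "y \<in> set (map vs Ds)"
            by (auto dest: set_zip_leftD set_zip_rightD simp del: set_map)
          then show "length x = length y" using vs(2) set by auto
        qed
      qed
      then show "Cs = Ds" using inj_on_map_eq_map[of vs Cs Ds] inj set by simp
    qed
    show "?g ` permutations_of_set \<C> \<subseteq> {xs \<in> vertex_lists n (5 * h). graph_of h ((!) xs) = E}"
    proof (rule image_subsetI)
      fix Cs assume "Cs \<in> permutations_of_set \<C>"
      then have Cs: "set Cs = \<C>" "distinct Cs" and len: "length Cs = h"
        using C(2) by (auto simp: permutations_of_set_def distinct_card[symmetric])
      have "length (?g Cs) = 5 * h"
      proof -
        have *: "map (length \<circ> vs) Cs = map (\<lambda>_. 5) Cs" using vs(2) Cs(1) by simp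
        show ?thesis unfolding length_concat map_map * by (simp add: len sum_list_triv)
      qed
      moreover have "distinct (?g Cs)"
        unfolding distinct_concat_iff
      proof (intro conjI allI impI ballI)
        show "distinct (removeAll [] (map vs Cs))"
          using Cs inj by (simp add: distinct_map distinct_removeAll)
        show "distinct ys" if "ys \<in> set (map vs Cs)" for ys using that vs(1) Cs by auto
        show "set ys \<inter> set zs = {}"
          if "ys \<in> set (map vs Cs) \<and> zs \<in> set (map vs Cs) \<and> ys \<noteq> zs" for ys zs
        proof -
          from that Cs(1) obtain A B where "A \<in> \<C>" "B \<in> \<C>" "ys = vs A" "zs = vs B" "A \<noteq> B" by auto
          then show ?thesis using C(5) by (simp add: setvs pairwise_def)
        qed
      qed
      moreover have "set (?g Cs) \<subseteq> {1..n}"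
      proof -
        have "set (vs A) \<subseteq> {1..n}" if "A \<in> set Cs" for A
          using that C(4) Cs(1) by (simp only: setvs)
        then show ?thesis by (simp only: set_concat set_map) blast
      qed
      moreover have "graph_of h ((!) (?g Cs)) = E"
      proof -
        have nth: "?g Cs ! (5 * j + i) = vs (Cs ! j) ! i" if "j < h" "i < 5" for i j
          using nth_concat_blocks[of "map vs Cs" 5 j i] that vs(2) Cs(1) len by auto
        have "graph_of h ((!) (?g Cs)) =
            (\<Union>j<h. {{vs (Cs ! j) ! i, vs (Cs ! j) ! (Suc i mod 5)} | i. i < 5})"
          unfolding graph_of_blocks
        proof (rule SUP_cong[OF refl], rule Collect_cong, rule ex_cong1)
          fix j x i assume j: "j \<in> {..<h}"
          show "(x = {?g Cs ! (5 * j + i), ?g Cs ! (5 * j + Suc i mod 5)} \<and> i < 5) =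
              (x = {vs (Cs ! j) ! i, vs (Cs ! j) ! (Suc i mod 5)} \<and> i < 5)"
            using j nth[of j i] nth[of j "Suc i mod 5"] by (cases "i < 5") simp_all
        qed
        also have "\<dots> = (\<Union>j<h. Cs ! j)"
        proof (rule SUP_cong[OF refl])
          fix j assume "j \<in> {..<h}"
          then have "Cs ! j \<in> \<C>" using Cs(1) len by auto
          from vs(3)[OF this]
          show "{{vs (Cs ! j) ! i, vs (Cs ! j) ! (Suc i mod 5)} | i. i < 5} = Cs ! j" by (rule sym)
        qed
        also have "\<dots> = \<Union>(set Cs)" using len by (auto simp: set_conv_nth)
        finally show ?thesis using C(6) Cs(1) by simp
      qed
      ultimately show "?g Cs \<in> {xs \<in> vertex_lists n (5 * h). graph_of h ((!) xs) = E}"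
        by (simp add: vertex_lists_def)
    qed
    show "finite {xs \<in> vertex_lists n (5 * h). graph_of h ((!) xs) = E}"
      using finite_vertex_lists by simp
  qed
  then show ?thesis using C by simp
qed

lemma five_cycle_graphs_eq: "five_cycle_graphs n h = (\<lambda>xs. graph_of h ((!) xs)) ` vertex_lists n (5 * h)"
proof (rule antisym; rule subsetI)
  fix E assume E: "E \<in> five_cycle_graphs n h"
  have "(0::nat) < fact h" by simp
  also have "\<dots> \<le> card {xs \<in> vertex_lists n (5 * h). graph_of h ((!) xs) = E}"
    by (rule fact_le_card_vertex_lists[OF E])
  finally have "{xs \<in> vertex_lists n (5 * h). graph_of h ((!) xs) = E} \<noteq> {}" by (metis card.empty less_irrefl)
  then show "E \<in> (\<lambda>xs. graph_of h ((!) xs)) ` vertex_lists n (5 * h)" by blast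
next
  fix E assume "E \<in> (\<lambda>xs. graph_of h ((!) xs)) ` vertex_lists n (5 * h)"
  then show "E \<in> five_cycle_graphs n h" using graph_of_in_five_cycle_graphs by blast
qed

lemma finite_five_cycle_graphs: "finite (five_cycle_graphs n h)"
  unfolding five_cycle_graphs_eq by (intro finite_imageI finite_vertex_lists)

lemma sum_five_cycle_graphs_le:
  fixes f :: "nat set set \<Rightarrow> real"
  assumes "\<And>E. 0 \<le> f E"
  shows "fact h * (\<Sum>E\<in>five_cycle_graphs n h. f E) \<le> (\<Sum>xs\<in>vertex_lists n (5 * h). f (graph_of h ((!) xs)))"
proof -
  let ?g = "\<lambda>xs. graph_of h ((!) xs)"
  have "fact h * (\<Sum>E\<in>five_cycle_graphs n h. f E) \<le>
      (\<Sum>E\<in>five_cycle_graphs n h. real (card {xs \<in> vertex_lists n (5 * h). ?g xs = E}) * f E)"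
    unfolding sum_distrib_left
  proof (intro sum_mono mult_right_mono assms)
    fix E assume "E \<in> five_cycle_graphs n h"
    then have "real (fact h) \<le> real (card {xs \<in> vertex_lists n (5 * h). ?g xs = E})"
      unfolding of_nat_le_iff by (rule fact_le_card_vertex_lists)
    then show "fact h \<le> real (card {xs \<in> vertex_lists n (5 * h). ?g xs = E})" by (simp only: of_nat_fact)
  qed
  also have "\<dots> = (\<Sum>E\<in>five_cycle_graphs n h. \<Sum>xs | xs \<in> vertex_lists n (5 * h) \<and> ?g xs = E. f (?g xs))"
  proof (rule sum.cong[OF refl])
    fix E
    have "(\<Sum>xs | xs \<in> vertex_lists n (5 * h) \<and> ?g xs = E. f (?g xs)) =
        (\<Sum>xs | xs \<in> vertex_lists n (5 * h) \<and> ?g xs = E. f E)" by (rule sum.cong) auto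
    then show "real (card {xs \<in> vertex_lists n (5 * h). ?g xs = E}) * f E =
        (\<Sum>xs | xs \<in> vertex_lists n (5 * h) \<and> ?g xs = E. f (?g xs))" by (simp only: sum_constant)
  qed
  also have "\<dots> = (\<Sum>xs\<in>vertex_lists n (5 * h). f (?g xs))"
    by (rule sum.group) (auto simp: finite_vertex_lists finite_five_cycle_graphs graph_of_in_five_cycle_graphs)
  finally show ?thesis .
qed

text \<open>Prescribed residues break the rotations and reflections of every cycle, so that only the
  order of the cycles remains free. The price is a factor of about 5 per vertex.\<close>

definition residue_lists :: "nat \<Rightarrow> nat \<Rightarrow> nat list set" where
  "residue_lists n m = {xs \<in> vertex_lists n m. \<forall>k<m. xs ! k mod 5 = k mod 5}"

lemma card_residue_class:
  assumes "i < 5"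
  shows "n div 5 \<le> card {x \<in> {1..n}. x mod 5 = i}"
proof -
  have "card {..<n div 5} \<le> card {x \<in> {1..n}. x mod 5 = i}"
  proof (rule card_inj_on_le[of "\<lambda>j. 5 * j + (if i = 0 then 5 else i)"])
    show "(\<lambda>j. 5 * j + (if i = 0 then 5 else i)) ` {..<n div 5} \<subseteq> {x \<in> {1..n}. x mod 5 = i}"
    proof (rule image_subsetI)
      fix j assume "j \<in> {..<n div 5}"
      then have "5 * j + 5 \<le> n" by auto
      then show "5 * j + (if i = 0 then 5 else i) \<in> {x \<in> {1..n}. x mod 5 = i}" using assms by auto
    qed
  qed (auto simp: inj_on_def)
  then show ?thesis by simp
qed

text \<open>A new entry can be any of the at least \<open>n div 5\<close> vertices in its residue
  class that is not among the at most \<open>M\<close> earlier ones. A fixed \<open>M\<close> keeps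
  the factor the same in every step.\<close>

lemma card_residue_lists: "m \<le> M \<Longrightarrow> (n div 5 - M) ^ m \<le> card (residue_lists n m)"
proof (induction m)
  case 0
  have "residue_lists n 0 = {[]}" by (auto simp: residue_lists_def vertex_lists_def)
  then show ?case by simp
next
  case (Suc m)
  let ?c = "{x \<in> {1..n}. x mod 5 = m mod 5}"
  have fin: "finite (residue_lists n k)" for k
    unfolding residue_lists_def using finite_vertex_lists by simp
  have "(n div 5 - M) ^ m * (n div 5 - M) \<le> card (residue_lists n m) * (n div 5 - M)"
    using Suc by (intro mult_right_mono) auto
  also have "\<dots> = (\<Sum>xs\<in>residue_lists n m. n div 5 - M)" by simp
  also have "\<dots> \<le> (\<Sum>xs\<in>residue_lists n m. card (?c - set xs))"
  proof (rule sum_mono)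
    fix xs assume "xs \<in> residue_lists n m"
    then have "length xs = m" by (simp add: residue_lists_def vertex_lists_def)
    then have "card (set xs) \<le> M" using card_length[of xs] Suc.prems by linarith
    moreover have "card ?c - card (set xs) \<le> card (?c - set xs)" by (rule diff_card_le_card_Diff) simp
    moreover have "n div 5 \<le> card ?c" by (rule card_residue_class) simp
    ultimately show "n div 5 - M \<le> card (?c - set xs)" by linarith
  qed
  also have "\<dots> = card (SIGMA xs:residue_lists n m. ?c - set xs)" by (rule card_SigmaI[symmetric]) (auto simp: fin)
  also have "\<dots> \<le> card (residue_lists n (Suc m))"
  proof (rule card_inj_on_le[of "\<lambda>(xs, a). xs @ [a]"])
    show "inj_on (\<lambda>(xs, a). xs @ [a]) (SIGMA xs:residue_lists n m. ?c - set xs)" by (auto simp: inj_on_def)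
    show "(\<lambda>(xs, a). xs @ [a]) ` (SIGMA xs:residue_lists n m. ?c - set xs) \<subseteq> residue_lists n (Suc m)"
      by (auto simp: residue_lists_def vertex_lists_def nth_append less_Suc_eq)
  qed (rule fin)
  finally show ?case by (simp add: mult.commute)
qed

text \<open>Walk along each cycle from its start: the two neighbours of a vertex have different
  residues modulo 5, so the residue singles out the next entry.\<close>

lemma residue_lists_determined:
  assumes xs: "xs \<in> residue_lists n (5 * h)" and ys: "ys \<in> residue_lists n (5 * h)"
    and eq: "graph_of h ((!) xs) = graph_of h ((!) ys)" and start: "\<And>j. j < h \<Longrightarrow> xs ! (5 * j) = ys ! (5 * j)"
  shows "xs = ys"
proof -
  interpret X: five_cycle_system n h "(!) xs"
    by (rule five_cycle_system_list) (use xs in \<open>simp add: residue_lists_def\<close>)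
  interpret Y: five_cycle_system n h "(!) ys"
    by (rule five_cycle_system_list) (use ys in \<open>simp add: residue_lists_def\<close>)
  have EE: "X.E = Y.E"
    using eq graph_of_eq_E[OF X.five_cycle_system_axioms] graph_of_eq_E[OF Y.five_cycle_system_axioms] by simp
  have res: "xs ! k mod 5 = k mod 5" "ys ! k mod 5 = k mod 5" if "k < 5 * h" for k
    using that xs ys by (auto simp: residue_lists_def)
  have step: "xs ! nxt k = ys ! nxt k" if k: "k < 5 * h" and "xs ! k = ys ! k" for k
  proof -
    have "{xs ! k, xs ! nxt k} \<in> X.E" using X.adjacent_iff[OF k, of "xs ! nxt k"] by simp
    then have "xs ! nxt k = ys ! nxt k \<or> xs ! nxt k = ys ! prv k"
      using Y.adjacent_iff[OF k, of "xs ! nxt k"] EE that(2) by simp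
    moreover have "nxt k mod 5 \<noteq> prv k mod 5"
      by (rule mod5_cases[of k]; simp only: cycle_simps mod_mult_self4 mod_mult_self1_is_0; simp)
    then have "xs ! nxt k \<noteq> ys ! prv k" using res(1)[of "nxt k"] res(2)[of "prv k"] k
      by (auto simp: nxt_less prv_less)
    ultimately show ?thesis by blast
  qed
  have "xs ! k = ys ! k" if k: "k < 5 * h" for k
  proof -
    have k0: "xs ! (5 * j) = ys ! (5 * j)" if "5 * j < 5 * h" for j using start that by simp
    have k1: "xs ! (5 * j + 1) = ys ! (5 * j + 1)" if "5 * j + 1 < 5 * h" for j
      using step[of "5 * j"] k0[of j] that by (simp only: nxt_simps)
    have k2: "xs ! (5 * j + 2) = ys ! (5 * j + 2)" if "5 * j + 2 < 5 * h" for j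
      using step[of "5 * j + 1"] k1[of j] that by (simp only: nxt_simps)
    have k3: "xs ! (5 * j + 3) = ys ! (5 * j + 3)" if "5 * j + 3 < 5 * h" for j
      using step[of "5 * j + 2"] k2[of j] that by (simp only: nxt_simps)
    have k4: "xs ! (5 * j + 4) = ys ! (5 * j + 4)" if "5 * j + 4 < 5 * h" for j
      using step[of "5 * j + 3"] k3[of j] that by (simp only: nxt_simps)
    show ?thesis by (rule mod5_cases[of k]) (use k k0 k1 k2 k3 k4 in blast)+
  qed
  then show ?thesis using xs ys by (auto simp: residue_lists_def vertex_lists_def intro: nth_equalityI)
qed

text \<open>A list in the fibre of a graph is determined by its entries divisible by 5, which form an
  ordering of the corresponding \<open>h\<close> vertices of the graph.\<close>

lemma card_residue_lists_le: "card (residue_lists n (5 * h)) \<le> fact h * card (five_cycle_graphs n h)"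
proof -
  let ?R = "residue_lists n (5 * h)"
  let ?g = "\<lambda>xs. graph_of h ((!) xs)"
  have fin: "finite ?R" unfolding residue_lists_def using finite_vertex_lists by simp
  have fibre: "card {xs \<in> ?R. ?g xs = E} \<le> fact h" for E
  proof (cases "{xs \<in> ?R. ?g xs = E} = {}")
    case False
    let ?r = "\<lambda>xs. map (\<lambda>j. xs ! (5 * j)) [0..<h]"
    define A where "A = {x \<in> \<Union>E. x mod 5 = 0}"
    have r: "distinct (?r xs) \<and> set (?r xs) = A" if xs: "xs \<in> {xs \<in> ?R. ?g xs = E}" for xs
    proof
      have len: "length xs = 5 * h" "distinct xs" and res: "\<And>k. k < 5 * h \<Longrightarrow> xs ! k mod 5 = k mod 5"
        and E: "graph_of h ((!) xs) = E"
        using xs by (auto simp: residue_lists_def vertex_lists_def)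
      show "distinct (?r xs)" using len by (auto simp: distinct_map inj_on_def nth_eq_iff_index_eq)
      have "\<Union>E = (!) xs ` {..<5 * h}"
        unfolding E[symmetric] graph_of_def using nxt_less by auto
      then have "A = (!) xs ` {k \<in> {..<5 * h}. xs ! k mod 5 = 0}"
        by (simp only: A_def Compr_image_eq)
      also have "{k \<in> {..<5 * h}. xs ! k mod 5 = 0} = {k \<in> {..<5 * h}. k mod 5 = 0}"
        by (rule Collect_cong) (simp add: res cong: conj_cong)
      also have "{k \<in> {..<5 * h}. k mod 5 = 0} = (\<lambda>j. 5 * j) ` {..<h}" by auto
      finally show "set (?r xs) = A" by (auto simp: image_image)
    qed
    obtain xs0 where xs0: "xs0 \<in> {xs \<in> ?R. ?g xs = E}" using False by blast
    have cA: "card A = h" using r[OF xs0] distinct_card[of "?r xs0"] by auto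
    have finA: "finite A" using r[OF xs0] List.finite_set[of "?r xs0"] by simp
    have "card {xs \<in> ?R. ?g xs = E} \<le> card (permutations_of_set A)"
    proof (rule card_inj_on_le[of ?r])
      show "inj_on ?r {xs \<in> ?R. ?g xs = E}"
      proof (rule inj_onI)
        fix xs ys assume "xs \<in> {xs \<in> ?R. ?g xs = E}" "ys \<in> {xs \<in> ?R. ?g xs = E}" "?r xs = ?r ys"
        then show "xs = ys" by (intro residue_lists_determined[of xs n h ys]) auto
      qed
      show "?r ` {xs \<in> ?R. ?g xs = E} \<subseteq> permutations_of_set A" using r by (auto simp: permutations_of_set_def)
      show "finite (permutations_of_set A)" by simp
    qed
    then show ?thesis using cA finA by simp
  next
    case True
    show ?thesis unfolding True by simp
  qed
  have sub: "?g ` ?R \<subseteq> five_cycle_graphs n h"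
    using graph_of_in_five_cycle_graphs by (auto simp: residue_lists_def)
  have "card ?R = (\<Sum>E\<in>five_cycle_graphs n h. card {xs \<in> ?R. ?g xs = E})"
    using sum.group[of ?R "five_cycle_graphs n h" ?g "\<lambda>_. 1::nat"] fin finite_five_cycle_graphs sub by simp
  also have "\<dots> \<le> (\<Sum>E\<in>five_cycle_graphs n h. fact h)" by (intro sum_mono fibre)
  finally show ?thesis by (simp add: mult.commute)
qed

section \<open>Overlaps of two graphs\<close>

lemma five_cycle_graph_properties:
  assumes "E \<in> five_cycle_graphs n h"
  shows "E \<subseteq> edges n" "card {w. {u, w} \<in> E} \<le> 2"
proof -
  obtain xs where xs: "xs \<in> vertex_lists n (5 * h)" "E = graph_of h ((!) xs)"
    using assms by (auto simp: five_cycle_graphs_eq)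
  interpret five_cycle_system n h "(!) xs" by (rule five_cycle_system_list[OF xs(1)])
  have "E = five_cycle_system.E h ((!) xs)" using xs(2) graph_of_eq_E[OF five_cycle_system_axioms] by simp
  then show "E \<subseteq> edges n" "card {w. {u, w} \<in> E} \<le> 2" using E_subset degree_le by simp_all
qed

text \<open>A common edge has the form {ys ! k, ys ! nxt k} with \<open>ys ! k\<close> in
  \<open>xs\<close>; charging it to \<open>k\<close> shows that there are no more common edges than
  common vertices.\<close>

lemma card_graph_Un:
  assumes xs: "xs \<in> vertex_lists n (5 * h)" and ys: "ys \<in> vertex_lists n (5 * h)"
  shows "10 * h \<le> card (graph_of h ((!) xs) \<union> graph_of h ((!) ys)) + length (filter (\<lambda>y. y \<in> set xs) ys)"
proof -
  let ?X = "graph_of h ((!) xs)" and ?Y = "graph_of h ((!) ys)"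
  let ?K = "{k. k < 5 * h \<and> ys ! k \<in> set xs}"
  have len: "length xs = 5 * h" "length ys = 5 * h" using xs ys by (auto simp: vertex_lists_def)
  have c: "card ?X = 5 * h" "card ?Y = 5 * h"
    using five_cycle_system.card_E[OF five_cycle_system_list[OF xs]]
      five_cycle_system.card_E[OF five_cycle_system_list[OF ys]]
      graph_of_eq_E[OF five_cycle_system_list[OF xs]] graph_of_eq_E[OF five_cycle_system_list[OF ys]] by simp_all
  have "\<Union>?X \<subseteq> set xs" using len nxt_less by (auto simp: graph_of_def)
  then have "?X \<inter> ?Y \<subseteq> (\<lambda>k. {ys ! k, ys ! nxt k}) ` ?K" by (auto simp: graph_of_def[of h "(!) ys"])
  moreover have finK: "finite ?K" by simp
  ultimately have "card (?X \<inter> ?Y) \<le> card ((\<lambda>k. {ys ! k, ys ! nxt k}) ` ?K)"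
    by (intro card_mono finite_imageI)
  also have "\<dots> \<le> card ?K" by (rule card_image_le[OF finK])
  also have "card ?K = length (filter (\<lambda>y. y \<in> set xs) ys)" by (simp add: length_filter_conv_card len)
  finally have "card (?X \<inter> ?Y) \<le> length (filter (\<lambda>y. y \<in> set xs) ys)" .
  moreover have "card ?X + card ?Y = card (?X \<union> ?Y) + card (?X \<inter> ?Y)"
    by (rule card_Un_Int) (auto simp: graph_of_def)
  ultimately show ?thesis using c by linarith
qed

lemma sum_lists_prod:
  fixes g :: "'a \<Rightarrow> real"
  assumes "finite A"
  shows "(\<Sum>xs | set xs \<subseteq> A \<and> length xs = m. prod_list (map g xs)) = (\<Sum>a\<in>A. g a) ^ m"
proof (induction m)
  case 0
  have "{xs. set xs \<subseteq> A \<and> length xs = 0} = {[]}" by auto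
  then show ?case by simp
next
  case (Suc m)
  let ?L = "\<lambda>m. {xs. set xs \<subseteq> A \<and> length xs = m}"
  have "(\<Sum>xs\<in>?L (Suc m). prod_list (map g xs)) = (\<Sum>(xs, a)\<in>?L m \<times> A. prod_list (map g (a # xs)))"
    unfolding lists_length_Suc_eq
    by (subst sum.reindex) (auto simp: inj_on_def case_prod_unfold)
  also have "\<dots> = (\<Sum>xs\<in>?L m. \<Sum>a\<in>A. g a * prod_list (map g xs))"
    by (subst sum.cartesian_product[symmetric]) simp
  also have "\<dots> = (\<Sum>xs\<in>?L m. prod_list (map g xs)) * (\<Sum>a\<in>A. g a)"
    by (subst sum_product) (simp add: mult.commute)
  finally show ?case using Suc by (simp add: mult.commute)
qed

lemma prod_list_if: "prod_list (map (\<lambda>y. if P y then c else 1) ys) = (c :: real) ^ length (filter P ys)"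
  by (induction ys) auto

text \<open>Without the distinctness condition the sum factors over positions. One position
  contributes n for each vertex of \<open>xs\<close>, at most \<open>5 * h\<close> of them, and 1
  for every other vertex.\<close>

lemma sum_power_common_le:
  assumes xs: "xs \<in> vertex_lists n (5 * h)" 
  shows "(\<Sum>ys\<in>vertex_lists n (5 * h). real n ^ length (filter (\<lambda>y. y \<in> set xs) ys)) \<le>
    ((5 * h + 1) * n) ^ (5 * h)"
proof -
  let ?g = "\<lambda>y. if y \<in> set xs then real n else 1"
  have len: "length xs = 5 * h" using xs by (auto simp: vertex_lists_def)
  have "(\<Sum>a\<in>{1..n}. ?g a) \<le> (\<Sum>a\<in>{1..n}. (if a \<in> set xs then real n else 0) + 1)"
    by (rule sum_mono) auto
  also have "\<dots> = real (card ({1..n} \<inter> set xs)) * n + n"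
    by (simp add: sum.distrib sum.inter_restrict[symmetric])
  also have "\<dots> \<le> real (5 * h) * n + n"
  proof -
    have "card ({1..n} \<inter> set xs) \<le> card (set xs)" by (intro card_mono) auto
    also have "\<dots> \<le> 5 * h" using card_length[of xs] len by simp
    finally show ?thesis by (simp add: mult_right_mono del: of_nat_mult)
  qed
  also have "\<dots> = real ((5 * h + 1) * n)" by (simp add: algebra_simps)
  finally have bound: "(\<Sum>a\<in>{1..n}. ?g a) \<le> real ((5 * h + 1) * n)" .
  have "(\<Sum>ys\<in>vertex_lists n (5 * h). real n ^ length (filter (\<lambda>y. y \<in> set xs) ys)) \<le>
      (\<Sum>ys | set ys \<subseteq> {1..n} \<and> length ys = 5 * h. real n ^ length (filter (\<lambda>y. y \<in> set xs) ys))"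
    by (rule sum_mono2) (auto simp: vertex_lists_def finite_lists_length_eq)
  also have "\<dots> = (\<Sum>a\<in>{1..n}. ?g a) ^ (5 * h)"
    by (subst sum_lists_prod[symmetric]) (auto simp: prod_list_if)
  also have "\<dots> \<le> real ((5 * h + 1) * n) ^ (5 * h)"
    by (rule power_mono[OF bound]) (simp add: sum_nonneg)
  finally show ?thesis by simp
qed

section \<open>Moments\<close>

abbreviation is_cocycle :: "nat set set \<Rightarrow> nat set set \<Rightarrow> bool" where
  "is_cocycle E S \<equiv> (indicator E :: nat set \<Rightarrow> bit) \<in> cocycles 1 S"

lemma prob_cocycle:
  assumes T: "determinantal_hypertree n T" and n: "n > 0" and E: "E \<in> five_cycle_graphs n h" "E' \<in> five_cycle_graphs n h"
  shows "measure_pmf.prob T {S. is_cocycle E S \<and> is_cocycle E' S} =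
    det (matrix_of (edges n) (edges n) (avoidance_matrix n (odd_triangles n E \<union> odd_triangles n E')))"
proof -
  have "measure_pmf.prob T {S. is_cocycle E S \<and> is_cocycle E' S} =
      measure_pmf.prob T {S. faces 2 S \<inter> (odd_triangles n E \<union> odd_triangles n E') = {}}"
  proof (rule measure_pmf.finite_measure_eq_AE)
    have "(is_cocycle E S \<and> is_cocycle E' S) =
        (faces 2 S \<inter> (odd_triangles n E \<union> odd_triangles n E') = {})" if "S \<in> set_pmf T" for S
    proof -
      have "S \<in> hypertrees n" using T that by (auto simp: determinantal_hypertree_def)
      then show ?thesis
        using cocycle_iff_odd_triangles five_cycle_graph_properties(1) E by (simp add: Int_Un_distrib)
    qed
    then show "AE S in measure_pmf T. (S \<in> {S. is_cocycle E S \<and> is_cocycle E' S}) =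
        (S \<in> {S. faces 2 S \<inter> (odd_triangles n E \<union> odd_triangles n E') = {}})"
      by (simp add: AE_measure_pmf_iff)
  qed simp_all
  then show ?thesis using prob_avoid[OF T n, of "odd_triangles n E \<union> odd_triangles n E'"] odd_triangles_subset by simp
qed

text \<open>An edge of either graph keeps its at least n - 4 odd triangles in the union of the two
  avoided sets, so every edge of the united graph has diagonal entry at most 4/n.\<close>

lemma prob_cocycle_le:
  assumes T: "determinantal_hypertree n T" and n: "n > 0" and E: "E \<in> five_cycle_graphs n h" "E' \<in> five_cycle_graphs n h"
  shows "measure_pmf.prob T {S. is_cocycle E S \<and> is_cocycle E' S} \<le>
    (4 / n) ^ card (E \<union> E')"
proof -
  let ?B = "odd_triangles n E \<union> odd_triangles n E'"
  have B: "?B \<subseteq> triangles n" using odd_triangles_subset by blast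
  have finB: "finite ?B" using B finite_triangles by (rule finite_subset)
  have deg: "n \<le> card {t \<in> odd_triangles n F. e \<subseteq> t} + 4" if "e \<in> F" "F \<in> five_cycle_graphs n h" for e F
    using that by (intro card_odd_triangles_containing five_cycle_graph_properties)
  have mono: "card {t \<in> odd_triangles n F. e \<subseteq> t} \<le> card {t \<in> ?B. e \<subseteq> t}" if "F = E \<or> F = E'" for e F
    using that finB by (intro card_mono) auto
  have "n \<le> card {t \<in> ?B. e \<subseteq> t} + 4" if "e \<in> E \<union> E'" for e
    using that deg[OF _ E(1), of e] deg[OF _ E(2), of e] mono[of E e] mono[of E' e] by auto
  then have "det (matrix_of (edges n) (edges n) (avoidance_matrix n ?B)) \<le> (real 4 / n) ^ card (E \<union> E')"
    using E five_cycle_graph_properties(1) by (intro det_avoidance_le[OF n B]) blast+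
  then show ?thesis unfolding prob_cocycle[OF T n E] by simp
qed

lemma expectation_sum_indicators:
  assumes "finite A"
  shows "measure_pmf.expectation T (\<lambda>S. \<Sum>a\<in>A. of_bool (P a S)) = (\<Sum>a\<in>A. measure_pmf.prob T {S. P a S})"
proof -
  have "of_bool (P a S) = (indicat_real {S. P a S} S)" for a S by (simp add: indicator_def)
  then have "measure_pmf.expectation T (\<lambda>S. \<Sum>a\<in>A. of_bool (P a S)) =
      measure_pmf.expectation T (\<lambda>S. \<Sum>a\<in>A. indicat_real {S. P a S} S)" by simp
  also have "\<dots> = (\<Sum>a\<in>A. measure_pmf.prob T {S. P a S})"
    by (subst Bochner_Integration.integral_sum) (auto simp: integrable_indicator_iff less_top[symmetric])
  finally show ?thesis .
qed

lemma five_cycle_cocycle_count_eq: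
  "real (five_cycle_cocycle_count n h S) =
    (\<Sum>E\<in>five_cycle_graphs n h. of_bool (is_cocycle E S))"
  unfolding five_cycle_cocycle_count_def
  using finite_five_cycle_graphs[of n h] by (simp add: of_bool_def sum.If_cases Int_def)

text \<open>The powers of n cancel: n^(5h) choices of \<open>xs\<close>, n^(5h) from the weighted
  sum over \<open>ys\<close>, and n^(-10h) from the probability. A shared edge loses a factor of
  order 1/n in the probability, which the weight n on a shared vertex pays for.\<close>

lemma second_moment_le:
  assumes T: "determinantal_hypertree n T" and n: "n \<ge> 4" and h: "h > 0"
  shows "measure_pmf.expectation T (\<lambda>S. (real (five_cycle_cocycle_count n h S))\<^sup>2) \<le> (100 * real h) ^ (5 * h) / (fact h)\<^sup>2"
proof -
  let ?G = "five_cycle_graphs n h" and ?L = "vertex_lists n (5 * h)"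
  let ?g = "\<lambda>xs. graph_of h ((!) xs)"
  have n0: "n > 0" "real n > 0" using n by auto
  have sq: "(real (five_cycle_cocycle_count n h S))\<^sup>2 =
      (\<Sum>p\<in>?G \<times> ?G. of_bool (is_cocycle (fst p) S \<and> is_cocycle (snd p) S))" for S
    unfolding five_cycle_cocycle_count_eq power2_eq_square sum_product sum.cartesian_product
    by (intro sum.cong) auto
  have "measure_pmf.expectation T (\<lambda>S. (real (five_cycle_cocycle_count n h S))\<^sup>2) =
      (\<Sum>p\<in>?G \<times> ?G. measure_pmf.prob T {S. is_cocycle (fst p) S \<and> is_cocycle (snd p) S})"
    unfolding sq by (rule expectation_sum_indicators) (simp add: finite_five_cycle_graphs)
  also have "\<dots> \<le> (\<Sum>p\<in>?G \<times> ?G. (4 / n) ^ card (fst p \<union> snd p))"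
    using prob_cocycle_le[OF T n0(1)] by (intro sum_mono) auto
  also have "\<dots> = (\<Sum>E\<in>?G. \<Sum>E'\<in>?G. (4 / n) ^ card (E \<union> E'))"
    by (simp add: sum.cartesian_product case_prod_unfold)
  finally have "(fact h)\<^sup>2 * measure_pmf.expectation T (\<lambda>S. (real (five_cycle_cocycle_count n h S))\<^sup>2) \<le>
      (fact h)\<^sup>2 * (\<Sum>E\<in>?G. \<Sum>E'\<in>?G. (4 / n) ^ card (E \<union> E'))" by (intro mult_left_mono) auto
  also have "\<dots> = fact h * (\<Sum>E\<in>?G. fact h * (\<Sum>E'\<in>?G. (4 / n) ^ card (E \<union> E')))"
    by (simp add: power2_eq_square sum_distrib_left mult.assoc)
  also have "\<dots> \<le> fact h * (\<Sum>E\<in>?G. \<Sum>ys\<in>?L. (4 / n) ^ card (E \<union> ?g ys))"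
    by (intro mult_left_mono sum_mono sum_five_cycle_graphs_le) auto
  also have "\<dots> \<le> (\<Sum>xs\<in>?L. \<Sum>ys\<in>?L. (4 / n) ^ card (?g xs \<union> ?g ys))"
    by (intro sum_five_cycle_graphs_le sum_nonneg) auto
  also have "\<dots> \<le> (\<Sum>xs\<in>?L. \<Sum>ys\<in>?L. 4 ^ (10 * h) / real n ^ (10 * h) * real n ^ length (filter (\<lambda>y. y \<in> set xs) ys))"
  proof (intro sum_mono)
    fix xs ys assume L: "xs \<in> ?L" "ys \<in> ?L"
    let ?v = "length (filter (\<lambda>y. y \<in> set xs) ys)" and ?m = "card (?g xs \<union> ?g ys)"
    have "?v \<le> length ys" by (rule length_filter_le)
    also have "length ys = 5 * h" using L by (simp add: vertex_lists_def)
    finally have v: "?v \<le> 10 * h" by linarith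
    \<comment> \<open>Lowering the exponent increases the power because n is at least 4.\<close>
    have "(4 / real n) ^ ?m \<le> (4 / n) ^ (10 * h - ?v)"
      using card_graph_Un[OF L] n by (intro power_decreasing) auto
    also have "\<dots> = 4 ^ (10 * h - ?v) / real n ^ (10 * h - ?v)" by (simp add: power_divide)
    also have "\<dots> \<le> 4 ^ (10 * h) / real n ^ (10 * h - ?v)"
      using n0 by (intro divide_right_mono power_increasing) auto
    also have "\<dots> = 4 ^ (10 * h) / real n ^ (10 * h) * real n ^ ?v"
      using n0 v by (simp add: power_diff)
    finally show "(4 / real n) ^ ?m \<le> 4 ^ (10 * h) / real n ^ (10 * h) * real n ^ ?v" .
  qed
  also have "\<dots> \<le> (\<Sum>xs\<in>?L. 4 ^ (10 * h) / real n ^ (10 * h) * real (((5 * h + 1) * n) ^ (5 * h)))"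
    unfolding sum_distrib_left[symmetric]
    by (intro sum_mono mult_left_mono sum_power_common_le) auto
  also have "\<dots> = real (card ?L) * (4 ^ (10 * h) / real n ^ (10 * h) * real (((5 * h + 1) * n) ^ (5 * h)))" by simp
  also have "\<dots> \<le> real n ^ (5 * h) * (4 ^ (10 * h) / real n ^ (10 * h) * real (((5 * h + 1) * n) ^ (5 * h)))"
  proof (rule mult_right_mono)
    have "card ?L \<le> card {xs. set xs \<subseteq> {1..n} \<and> length xs = 5 * h}"
      by (intro card_mono finite_lists_length_eq) (auto simp: vertex_lists_def)
    also have "\<dots> = n ^ (5 * h)" by (simp add: card_lists_length_eq)
    finally show "real (card ?L) \<le> real n ^ (5 * h)" unfolding of_nat_power[symmetric] of_nat_le_iff .
  qed simp
  also have "\<dots> = (16 * (5 * real h + 1)) ^ (5 * h)"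
  proof -
    have "(4::real) ^ (10 * h) = 16 ^ (5 * h)" by (simp add: power_mult)
    moreover have "real n ^ (10 * h) = real n ^ (5 * h) * real n ^ (5 * h)"
      by (simp add: power_add[symmetric])
    moreover have "real (((5 * h + 1) * n) ^ (5 * h)) = (5 * real h + 1) ^ (5 * h) * real n ^ (5 * h)"
      by (simp only: of_nat_power of_nat_mult of_nat_add of_nat_numeral of_nat_1 power_mult_distrib)
    moreover have "a * (b / (a * a) * (c * a)) = b * c" if "a \<noteq> 0" for a b c :: real using that by simp
    ultimately show ?thesis using n0 by (simp only: power_mult_distrib) simp
  qed
  \<comment> \<open>For h at least 1, 16 (5h + 1) is at most 96h.\<close>
  also have "\<dots> \<le> (100 * real h) ^ (5 * h)"
    using h by (intro power_mono) auto
  finally show ?thesis by (simp add: field_simps)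
qed

section \<open>The first moment\<close>

lemma one_minus_ge_exp:
  fixes x :: real
  assumes "x < 1"
  shows "exp (- (x / (1 - x))) \<le> 1 - x"
proof -
  have "1 / (1 - x) = 1 + x / (1 - x)" using assms by (simp add: field_simps)
  also have "\<dots> \<le> exp (x / (1 - x))" by (rule exp_ge_add_one_self)
  finally show ?thesis using assms by (simp add: exp_minus field_simps)
qed

lemma first_moment_ge:
  assumes T: "determinantal_hypertree n T" and n: "n \<ge> 700 * h + 600"
  shows "exp (- 100 * real h) / fact h \<le> measure_pmf.expectation T (\<lambda>S. real (five_cycle_cocycle_count n h S))"
proof -
  let ?G = "five_cycle_graphs n h"
  let ?b = "(1 / (10 * real n)) ^ (5 * h) * (1 - 8 / real n) ^ (5 * h * n)"
  have n0: "n > 0" "real n > 0" "real n \<ge> 72" using n by auto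
  have "real (card ?G) * ?b \<le> (\<Sum>E\<in>?G. measure_pmf.prob T {S. is_cocycle E S})"
  proof -
    have "?b \<le> measure_pmf.prob T {S. is_cocycle E S}" if E: "E \<in> ?G" for E
    proof -
      obtain xs where xs: "xs \<in> vertex_lists n (5 * h)" "E = graph_of h ((!) xs)"
        using E by (auto simp: five_cycle_graphs_eq)
      have "?b \<le> det (matrix_of (edges n) (edges n) (avoidance_matrix n (odd_triangles n E)))"
        using five_cycle_system.det_avoidance_ge[OF five_cycle_system_list[OF xs(1)] n]
        unfolding xs(2) graph_of_eq_E[OF five_cycle_system_list[OF xs(1)]]
        by (simp only: of_nat_mult of_nat_numeral)
      then show ?thesis using prob_cocycle[OF T n0(1) E E] by simp
    qed
    then have "(\<Sum>E\<in>?G. ?b) \<le> (\<Sum>E\<in>?G. measure_pmf.prob T {S. is_cocycle E S})" by (rule sum_mono)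
    then show ?thesis by simp
  qed
  also have "\<dots> = measure_pmf.expectation T (\<lambda>S. real (five_cycle_cocycle_count n h S))"
    unfolding five_cycle_cocycle_count_eq by (rule expectation_sum_indicators[OF finite_five_cycle_graphs, symmetric])
  finally have lb: "real (card ?G) * ?b \<le> measure_pmf.expectation T (\<lambda>S. real (five_cycle_cocycle_count n h S))" .
  \<comment> \<open>Passing from n/5 to n/6 pays for the rounding in \<open>n div 5\<close> and for
    the \<open>5 * h\<close> vertices that may already be in use.\<close>
  have "(real n / 6) ^ (5 * h) \<le> real (n div 5 - 5 * h) ^ (5 * h)"
  proof (rule power_mono)
    have "n = 5 * (n div 5) + n mod 5" "n mod 5 < 5" by simp_all
    then have "n \<le> 5 * (n div 5) + 4" by linarith
    moreover from this n have "30 * h + 4 \<le> n div 5" by linarith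
    ultimately have "n \<le> 6 * (n div 5 - 5 * h)" by (simp add: diff_mult_distrib2)
    then show "real n / 6 \<le> real (n div 5 - 5 * h)" by linarith
  qed simp
  also have "\<dots> \<le> real (card (residue_lists n (5 * h)))"
    unfolding of_nat_power[symmetric] of_nat_le_iff by (rule card_residue_lists) simp
  also have "\<dots> \<le> real (fact h * card ?G)"
    unfolding of_nat_le_iff by (rule card_residue_lists_le)
  also have "\<dots> = fact h * real (card ?G)" by simp
  finally have G: "(real n / 6) ^ (5 * h) / fact h \<le> real (card ?G)" by (simp add: field_simps)
  have b: "(1 / (10 * real n)) ^ (5 * h) * exp (- 45 * real h) \<le> ?b"
  proof (rule mult_left_mono)
    \<comment> \<open>8 / (n - 8) is at most 9 / n from n = 72 on, and 9 times \<open>5 * h\<close>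
      is 45h.\<close>
    have "exp (- (9 / real n)) \<le> exp (- ((8 / real n) / (1 - 8 / real n)))"
      using n0 by (simp add: field_simps)
    also have "\<dots> \<le> 1 - 8 / real n" using n0 by (intro one_minus_ge_exp) simp
    finally have "exp (- (9 / real n)) ^ (5 * h * n) \<le> (1 - 8 / real n) ^ (5 * h * n)"
      by (rule power_mono) simp
    moreover have "exp (- (9 / real n)) ^ (5 * h * n) = exp (- 45 * real h)"
      using n0 by (simp add: exp_of_nat_mult[symmetric])
    ultimately show "exp (- 45 * real h) \<le> (1 - 8 / real n) ^ (5 * h * n)" by simp
  qed simp
  \<comment> \<open>Each of the \<open>5 * h\<close> vertices costs 1/6 from counting and 1/10 from
    the determinant, together at least exp (- 11). The exponent 100 is 5 times 11 plus 45.\<close>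
  have "exp (- 100 * real h) = exp (- 11) ^ (5 * h) * exp (- 45 * real h)"
    by (simp add: exp_of_nat_mult[symmetric] exp_add[symmetric])
  also have "\<dots> \<le> (1 / 60) ^ (5 * h) * exp (- 45 * real h)"
  proof (intro mult_right_mono power_mono)
    have "(60::real) \<le> 2 ^ 11" by simp
    also have "\<dots> \<le> exp 1 ^ 11" using exp_ge_add_one_self[of 1] by (intro power_mono) auto
    also have "\<dots> = exp (11 :: real)" by (simp add: exp_of_nat_mult[symmetric])
    finally show "exp (- 11) \<le> 1 / (60 :: real)" by (simp add: exp_minus field_simps)
  qed simp_all
  also have "(1 / 60 :: real) ^ (5 * h) = (real n / 6) ^ (5 * h) * (1 / (10 * real n)) ^ (5 * h)"
    using n0 by (simp add: power_mult_distrib[symmetric])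
  finally have "exp (- 100 * real h) / fact h \<le>
      (real n / 6) ^ (5 * h) / fact h * ((1 / (10 * real n)) ^ (5 * h) * exp (- 45 * real h))"
    by (simp add: divide_right_mono)
  also have "\<dots> \<le> real (card ?G) * ?b"
    using n0 by (intro mult_mono G b) auto
  finally show ?thesis using lb by linarith
qed

theorem theorem4:
  fixes h :: nat
  assumes "h > 0"
  shows "\<exists>N. \<forall>n\<ge>N. \<forall>T. determinantal_hypertree n T \<longrightarrow>
    measure_pmf.expectation T (\<lambda>S. real (five_cycle_cocycle_count n h S))
      \<ge> exp (- 100 * real h) / fact h \<and>
    measure_pmf.expectation T (\<lambda>S. (real (five_cycle_cocycle_count n h S))\<^sup>2)
      \<le> (100 * real h) ^ (5 * h) / (fact h)\<^sup>2"
proof (intro exI allI impI conjI)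
  fix n T assume n: "700 * h + 600 \<le> n" and T: "determinantal_hypertree n T"
  show "measure_pmf.expectation T (\<lambda>S. real (five_cycle_cocycle_count n h S)) \<ge> exp (- 100 * real h) / fact h"
    using first_moment_ge[OF T n] .
  show "measure_pmf.expectation T (\<lambda>S. (real (five_cycle_cocycle_count n h S))\<^sup>2)
      \<le> (100 * real h) ^ (5 * h) / (fact h)\<^sup>2"
    by (rule second_moment_le[OF T _ assms]) (use n in linarith)
qed

end
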